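(* Fix $\beta>0$. Suppose that $(Q_N)$ is an admissible sequence with limit potential $V$ (as defined in the context) and that the restriction $V|_{\mathbb{R}}$ is continuous in an $\mathbb{R}$-neighbourhood of the $V$-droplet $S_V$. Let $c_N^\beta(p)=\tfrac1N\int_{\mathbb{R}}\mathbf{R}_N^\beta(p+i\eta)\,d\eta$, $p\in\mathbb{R}$. Then $\tfrac1\pi c_N^\beta\to\sigma_V$ as $N\to\infty$ in the weak sense of measures on $\mathbb{R}$; that is, $\tfrac1\pi\int_{\mathbb{R}}f(\xi)\,c_N^\beta(\xi)\,d\xi\to\int_{\mathbb{R}}f\,d\sigma_V$ for every bounded continuous function $f$ on $\mathbb{R}$.
   Context: Notation: $\zeta=\xi+i\eta$, $dA=\tfrac1\pi\,d\xi\,d\eta$, $dA_N=(dA)^{\otimes N}$, $\Delta=\tfrac14\left(\frac{\partial^2}{\partial\xi^2}+\frac{\partial^2}{\partial\eta^2}\right)$. An external potential is a lower semicontinuous function $W:\mathbb{C}\to\mathbb{R}\cup\{+\infty\}$, finite on some set of positive capacity, with $\liminf_{\zeta\to\infty}\frac{W(\zeta)}{2\log|\zeta|}\ge k$ where $k>1$ is a fixed constant. Its energy functional is $I_W[\mu]=\iint\log\frac1{|\zeta-\eta|}\,d\mu(\zeta)\,d\mu(\eta)+\int W\,d\mu$ for compactly supported Borel probability measures $\mu$; $\sigma_W$ is the unique minimizer (equilibrium measure), the droplet is $S_W=\operatorname{supp}\sigma_W$, and Robin's constant is $\gamma(W)=I_W[\sigma_W]$. Gibbs measure: $H_N=\sum_{j\ne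 k}\log\frac1{|\zeta_j-\zeta_k|}+N\sum_jQ_N(\zeta_j)$, $d\mathbf{P}_N^\beta=\frac1{Z_N^\beta}e^{-\beta H_N}\,dA_N$, $Z_N^\beta=\int_{\mathbb{C}^N}e^{-\beta H_N}\,dA_N$. For a sample $\{\zeta_j\}_1^N$ from $\mathbf{P}_N^\beta$, the $1$-point function is $\mathbf{R}_N^\beta(\zeta)=\lim_{\varepsilon\to0}\varepsilon^{-2}\mathbf{E}_N^\beta[\#(\{\zeta_j\}_1^N\cap D(\zeta,\varepsilon))]$, with $D(\zeta,\varepsilon)$ the open disc of center $\zeta$ and radius $\varepsilon$. Standing conditions: (i) $Q_N$ and $V$ are external potentials with the same constant $k$; $Q_N$ increases monotonically to $V$ as $N\to\infty$; $V=+\infty$ on $\mathbb{C}\setminus\mathbb{R}$. (ii) Each $Q_N$ is continuous in some fixed neighbourhood of $S_V$ and real-analytic there, with the possible exception of one or several singular points at which $\Delta Q_N=+\infty$ for each $N$; $d\sigma_{Q_N}=\Delta Q_N\cdot\mathbf{1}_{S_{Q_N}}\,dA$. (iii) $\sigma_V$ is absolutely continuous with respect to Lebesgue measure on $\mathbb{R}$; its density $\sigma_V(\xi)$ is continuous on $\mathbb{R}$ with the possible exception of finitely many singular points. (iv) $S_{Q_N}$ equals the coincidence set $\{Q_N=\check Q_N\}$, where $\check Q_N$ is the supremum of all subharmonic functions $s$ on $\mathbb{C}$ with $s\le Q_N$ and $s(\zeta)\le\log|\zeta|^2+O(1)$ as $\zeta\to\infty$. (v) $Q_N(\zeta)=Q_N(\bar\zeta)$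 and $Q_N(\zeta)\ge Q_N(\operatorname{Re}\zeta)$ for all $\zeta\in\mathbb{C}$, and $\Delta Q_N\ge mN$ on $S_{Q_N}$ for some constant $m>0$. (vi) $\partial S_{Q_N}$ consists of finitely many real-analytic Jordan curves without singular points, and there are continuous functions $h_N:\mathbb{R}\to[0,\infty)$ with $S_{Q_N}=\{\xi+i\eta:-h_N(\xi)\le\eta\le h_N(\xi)\}$. (vii) The limit $\rho(\xi)=\lim_{N\to\infty}\sqrt{N/\Delta Q_N(\xi)}$ exists as a finite and strictly positive number whenever $\sigma_V(\xi)>0$. The sequence $(Q_N)$ is called admissible if it satisfies these standing conditions and $\liminf_{N\to\infty}\frac1{N^2}\log Z_N^\beta\ge-\beta\cdot\gamma(V)$. *)

theory Defs
  imports "HOL-Probability.Probability"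
begin

section \<open>Integration of extended real functions\<close>

text \<open>
  Used only for functions one of whose two parts has a finite integral, so that the
  difference is never of the form \<open>\<infinity> - \<infinity>\<close>.
\<close>

definition ereal_integral :: "'a measure \<Rightarrow> ('a \<Rightarrow> ereal) \<Rightarrow> ereal" where
  "ereal_integral M f =
     enn2ereal (\<integral>\<^sup>+x. e2ennreal (f x) \<partial>M) - enn2ereal (\<integral>\<^sup>+x. e2ennreal (- f x) \<partial>M)"

definition ennexp :: "ereal \<Rightarrow> ennreal" where
  "ennexp x = (if x = \<infinity> then \<infinity> else if x = - \<infinity> then 0 else ennreal (exp (real_of_ereal x)))"

definition ennln :: "ennreal \<Rightarrow> ereal" where
  "ennln x = (if x = \<infinity> then \<infinity> else if x = 0 then - \<infinity> else ereal (ln (enn2real x)))"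


section \<open>Logarithmic potential theory\<close>

definition area :: "complex measure" where
  "area = density lborel (\<lambda>_. ennreal (1 / pi))"

definition measure_support :: "'a::topological_space measure \<Rightarrow> 'a set" where
  "measure_support \<mu> = {z. \<forall>U. open U \<and> z \<in> U \<longrightarrow> emeasure \<mu> U > 0}"

definition compact_prob_measures :: "complex measure set" where
  "compact_prob_measures =
     {\<mu>. prob_space \<mu> \<and> sets \<mu> = sets borel \<and> compact (measure_support \<mu>)}"

definition log_kernel :: "complex \<Rightarrow> complex \<Rightarrow> ereal" where
  "log_kernel z w = (if z = w then \<infinity> else ereal (ln (1 / cmod (z - w))))"

definition log_energy :: "complex measure \<Rightarrow> ereal" where
  "log_energy \<mu> = ereal_integral (\<mu> \<Otimes>\<^sub>M \<mu>) (\<lambda>(z, w). log_kernel z w)"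

definition log_capacity :: "complex set \<Rightarrow> ennreal" where
  "log_capacity E =
     (SUP \<mu>\<in>{\<mu> \<in> compact_prob_measures. measure_support \<mu> \<subseteq> E}. ennexp (- log_energy \<mu>))"

definition lower_semicontinuous :: "('a::topological_space \<Rightarrow> ereal) \<Rightarrow> bool" where
  "lower_semicontinuous f \<longleftrightarrow> (\<forall>a. open {z. a < f z})"

definition upper_semicontinuous :: "('a::topological_space \<Rightarrow> ereal) \<Rightarrow> bool" where
  "upper_semicontinuous f \<longleftrightarrow> (\<forall>a. open {z. f z < a})"

definition external_potential :: "real \<Rightarrow> (complex \<Rightarrow> ereal) \<Rightarrow> bool" where
  "external_potential k W \<longleftrightarrow>
     (\<forall>z. W z \<noteq> - \<infinity>) \<and> lower_semicontinuous W \<and>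
     (\<exists>E. log_capacity E > 0 \<and> (\<forall>z\<in>E. W z < \<infinity>)) \<and>
     Liminf at_infinity (\<lambda>z. W z / ereal (2 * ln (cmod z))) \<ge> ereal k"

definition energy :: "(complex \<Rightarrow> ereal) \<Rightarrow> complex measure \<Rightarrow> ereal" where
  "energy W \<mu> = log_energy \<mu> + ereal_integral \<mu> W"

text \<open>The minimizer exists and is unique for every external potential (Frostman).\<close>

definition equilibrium_measure :: "(complex \<Rightarrow> ereal) \<Rightarrow> complex measure" where
  "equilibrium_measure W =
     (THE \<mu>. \<mu> \<in> compact_prob_measures \<and> (\<forall>\<nu>\<in>compact_prob_measures. energy W \<mu> \<le> energy W \<nu>))"

definition droplet :: "(complex \<Rightarrow> ereal) \<Rightarrow> complex set" where
  "droplet W = measure_support (equilibrium_measure W)"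

definition robin_constant :: "(complex \<Rightarrow> ereal) \<Rightarrow> ereal" where
  "robin_constant W = energy W (equilibrium_measure W)"

definition subharmonic :: "(complex \<Rightarrow> ereal) \<Rightarrow> bool" where
  "subharmonic s \<longleftrightarrow>
     (\<forall>z. s z \<noteq> \<infinity>) \<and> upper_semicontinuous s \<and>
     (\<forall>z r. r > 0 \<longrightarrow>
        s z \<le> ereal_integral (restrict_space lborel {0..2*pi}) (\<lambda>t. s (z + of_real r * cis t))
               / ereal (2 * pi))"

definition obstacle_function :: "(complex \<Rightarrow> ereal) \<Rightarrow> complex \<Rightarrow> ereal" where
  "obstacle_function W z =
     (SUP s\<in>{s. subharmonic s \<and> (\<forall>w. s w \<le> W w) \<and>
               (\<exists>C. \<forall>\<^sub>F w in at_infinity. s w \<le> ereal (ln ((cmod w)\<^sup>2) + C))}. s z)"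


section \<open>Regularity\<close>

text \<open>
  One quarter of the usual Laplacian. It is the pointwise Laplacian of the real-valued function
  obtained from \<open>W\<close>, and meaningful only where \<open>W\<close> is finite and twice differentiable.
\<close>

definition laplacian :: "(complex \<Rightarrow> ereal) \<Rightarrow> complex \<Rightarrow> real" where
  "laplacian W z =
     (deriv (deriv (\<lambda>t::real. real_of_ereal (W (z + of_real t)))) 0 +
      deriv (deriv (\<lambda>t::real. real_of_ereal (W (z + \<i> * of_real t)))) 0) / 4"

definition real_analytic_at :: "(complex \<Rightarrow> real) \<Rightarrow> complex \<Rightarrow> bool" where
  "real_analytic_at u z \<longleftrightarrow>
     (\<exists>r>0. \<exists>a :: nat \<times> nat \<Rightarrow> real. \<forall>x y. \<bar>x\<bar> < r \<and> \<bar>y\<bar> < r \<longrightarrow>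
        ((\<lambda>(m, n). a (m, n) * x ^ m * y ^ n) has_sum u (z + Complex x y)) UNIV)"

text \<open>
  A real-analytic parametrization of a closed curve by the unit circle is the restriction of a
  function that is holomorphic near the circle; the curve has no singular point if the
  parametrization can be chosen regular.
\<close>

definition analytic_jordan_curve :: "complex set \<Rightarrow> bool" where
  "analytic_jordan_curve C \<longleftrightarrow>
     (\<exists>f. f analytic_on sphere 0 1 \<and> inj_on f (sphere 0 1) \<and>
          (\<forall>z\<in>sphere 0 1. deriv f z \<noteq> 0) \<and> C = f ` sphere 0 1)"


section \<open>Gibbs measure\<close>

definition hamiltonian :: "(complex \<Rightarrow> ereal) \<Rightarrow> nat \<Rightarrow> (nat \<Rightarrow> complex) \<Rightarrow> ereal" where
  "hamiltonian W N \<zeta> =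
     (\<Sum>j<N. \<Sum>l\<in>{..<N} - {j}. log_kernel (\<zeta> j) (\<zeta> l)) + ereal (real N) * (\<Sum>j<N. W (\<zeta> j))"

definition area_power :: "nat \<Rightarrow> (nat \<Rightarrow> complex) measure" where
  "area_power N = Pi\<^sub>M {..<N} (\<lambda>_. area)"

definition partition_function :: "real \<Rightarrow> (complex \<Rightarrow> ereal) \<Rightarrow> nat \<Rightarrow> ennreal" where
  "partition_function \<beta> W N = (\<integral>\<^sup>+\<zeta>. ennexp (- (ereal \<beta> * hamiltonian W N \<zeta>)) \<partial>area_power N)"

definition gibbs_measure :: "real \<Rightarrow> (complex \<Rightarrow> ereal) \<Rightarrow> nat \<Rightarrow> (nat \<Rightarrow> complex) measure" where
  "gibbs_measure \<beta> W N =
     density (area_power N)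
       (\<lambda>\<zeta>. ennexp (- (ereal \<beta> * hamiltonian W N \<zeta>)) / partition_function \<beta> W N)"

text \<open>
  Points are counted with multiplicity; configurations with multiple points have probability 0.
  The limit exists for almost every point of the plane; elsewhere the value is immaterial, since
  the function is only ever integrated.
\<close>

definition one_point_function :: "real \<Rightarrow> (complex \<Rightarrow> ereal) \<Rightarrow> nat \<Rightarrow> complex \<Rightarrow> real" where
  "one_point_function \<beta> W N z =
     Lim (at_right 0) (\<lambda>\<epsilon>.
       (\<integral>\<zeta>. real (card {j \<in> {..<N}. \<zeta> j \<in> ball z \<epsilon>}) \<partial>gibbs_measure \<beta> W N) / \<epsilon>\<^sup>2)"

text \<open>
  The Lebesgue (complete) measure makes the integral insensitive to the values of the one-point
  function on null sets.
\<close>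

definition cross_section :: "real \<Rightarrow> (complex \<Rightarrow> ereal) \<Rightarrow> nat \<Rightarrow> real \<Rightarrow> real" where
  "cross_section \<beta> W N p =
     (1 / real N) * (\<integral>\<eta>. one_point_function \<beta> W N (Complex p \<eta>) \<partial>lebesgue)"


section \<open>Admissible sequences\<close>

text \<open>
  Sequences are indexed by \<open>N \<ge> 1\<close>. The sets \<open>\<Lambda>\<close> and \<open>F\<close> are the neighbourhood of the droplet of
  \<open>V\<close> and the set of singular points of the potentials \<open>Q N\<close>, and \<open>G\<close> and \<open>s\<close> are the set of
  singular points and the density of the equilibrium measure of \<open>V\<close>.
\<close>

definition increasing_limit ::
  "real \<Rightarrow> (nat \<Rightarrow> complex \<Rightarrow> ereal) \<Rightarrow> (complex \<Rightarrow> ereal) \<Rightarrow> bool" where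
  "increasing_limit k Q V \<longleftrightarrow>
     external_potential k V \<and> (\<forall>N\<ge>1. external_potential k (Q N)) \<and>
     (\<forall>N\<ge>1. \<forall>z. Q N z \<le> Q (Suc N) z) \<and> (\<forall>z. (\<lambda>N. Q N z) \<longlonglongrightarrow> V z) \<and>
     (\<forall>z. z \<notin> \<real> \<longrightarrow> V z = \<infinity>)"

text \<open>
  At the singular points, the Laplacian being \<open>+\<infinity>\<close> means that it tends to \<open>+\<infinity>\<close> there.
\<close>

definition regular_potentials ::
  "(nat \<Rightarrow> complex \<Rightarrow> ereal) \<Rightarrow> (complex \<Rightarrow> ereal) \<Rightarrow> complex set \<Rightarrow> complex set \<Rightarrow> bool" where
  "regular_potentials Q V \<Lambda> F \<longleftrightarrow>
     open \<Lambda> \<and> droplet V \<subseteq> \<Lambda> \<and> finite F \<and> F \<subseteq> \<Lambda> \<and>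
     (\<forall>N\<ge>1. continuous_on \<Lambda> (Q N) \<and>
        (\<forall>z\<in>\<Lambda> - F. Q N z < \<infinity> \<and> real_analytic_at (\<lambda>w. real_of_ereal (Q N w)) z) \<and>
        (\<forall>z\<in>F. filterlim (laplacian (Q N)) at_top (at z)) \<and>
        equilibrium_measure (Q N) =
          density area (\<lambda>z. ennreal (laplacian (Q N) z) * indicator (droplet (Q N)) z))"

definition equilibrium_density ::
  "(complex \<Rightarrow> ereal) \<Rightarrow> (real \<Rightarrow> real) \<Rightarrow> real set \<Rightarrow> bool" where
  "equilibrium_density V s G \<longleftrightarrow>
     finite G \<and> (\<forall>x. s x \<ge> 0) \<and> continuous_on (- G) s \<and>
     equilibrium_measure V = distr (density lborel (\<lambda>x. ennreal (s x))) borel complex_of_real"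

definition droplets_are_coincidence_sets :: "(nat \<Rightarrow> complex \<Rightarrow> ereal) \<Rightarrow> bool" where
  "droplets_are_coincidence_sets Q \<longleftrightarrow>
     (\<forall>N\<ge>1. droplet (Q N) = {z. Q N z = obstacle_function (Q N) z})"

definition conjugation_symmetric_potentials :: "(nat \<Rightarrow> complex \<Rightarrow> ereal) \<Rightarrow> bool" where
  "conjugation_symmetric_potentials Q \<longleftrightarrow>
     (\<forall>N\<ge>1. \<forall>z. Q N z = Q N (cnj z) \<and> Q N z \<ge> Q N (of_real (Re z)))"

text \<open>At the singular points the Laplacian is \<open>+\<infinity>\<close>, so the bound holds there by convention.\<close>

definition laplacian_lower_bound :: "(nat \<Rightarrow> complex \<Rightarrow> ereal) \<Rightarrow> complex set \<Rightarrow> bool" where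
  "laplacian_lower_bound Q F \<longleftrightarrow>
     (\<exists>m>0. \<forall>N\<ge>1. \<forall>z\<in>droplet (Q N) - F. laplacian (Q N) z \<ge> m * real N)"

text \<open>
  The description of the droplet by \<open>h\<close> is over its projection to the real line: without this
  restriction the region \<open>\<bar>\<eta>\<bar> \<le> h \<xi>\<close> contains the whole line and no compact set has this form.
  The absence of singular points of the boundary (cusps and double points) makes the curves
  regular and pairwise disjoint.
\<close>

definition regular_droplets :: "(nat \<Rightarrow> complex \<Rightarrow> ereal) \<Rightarrow> bool" where
  "regular_droplets Q \<longleftrightarrow>
     (\<forall>N\<ge>1.
        (\<exists>\<C>. finite \<C> \<and> (\<forall>C\<in>\<C>. analytic_jordan_curve C) \<and> pairwise disjnt \<C> \<and>
             frontier (droplet (Q N)) = \<Union>\<C>) \<and>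
        (\<exists>h :: real \<Rightarrow> real. continuous_on UNIV h \<and> (\<forall>\<xi>. h \<xi> \<ge> 0) \<and>
             droplet (Q N) =
               {Complex \<xi> \<eta> |\<xi> \<eta>. \<xi> \<in> Re ` droplet (Q N) \<and> - h \<xi> \<le> \<eta> \<and> \<eta> \<le> h \<xi>}))"

text \<open>
  The density has no prescribed value at points of \<open>G\<close>, and the quotient vanishes at points of
  \<open>F\<close>. Since \<open>G\<close> may be enlarged by finitely many points, excluding \<open>F\<close> is no restriction.
\<close>

definition limiting_profile ::
  "(nat \<Rightarrow> complex \<Rightarrow> ereal) \<Rightarrow> (real \<Rightarrow> real) \<Rightarrow> real set \<Rightarrow> complex set \<Rightarrow> bool" where
  "limiting_profile Q s G F \<longleftrightarrow>
     (\<forall>\<xi>. \<xi> \<notin> G \<and> complex_of_real \<xi> \<notin> F \<and> s \<xi> > 0 \<longrightarrow>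
        (\<exists>\<rho>>0. (\<lambda>N. sqrt (real N / laplacian (Q N) (of_real \<xi>))) \<longlonglongrightarrow> \<rho>))"

definition standing_conditions ::
  "real \<Rightarrow> (nat \<Rightarrow> complex \<Rightarrow> ereal) \<Rightarrow> (complex \<Rightarrow> ereal) \<Rightarrow> bool" where
  "standing_conditions k Q V \<longleftrightarrow>
     increasing_limit k Q V \<and>
     (\<exists>\<Lambda> F s G.
        regular_potentials Q V \<Lambda> F \<and>
        equilibrium_density V s G \<and>
        droplets_are_coincidence_sets Q \<and>
        conjugation_symmetric_potentials Q \<and>
        laplacian_lower_bound Q F \<and>
        regular_droplets Q \<and>
        limiting_profile Q s G F)"

definition admissible ::
  "real \<Rightarrow> real \<Rightarrow> (nat \<Rightarrow> complex \<Rightarrow> ereal) \<Rightarrow> (complex \<Rightarrow> ereal) \<Rightarrow> bool" where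
  "admissible \<beta> k Q V \<longleftrightarrow>
     standing_conditions k Q V \<and>
     liminf (\<lambda>N. ennln (partition_function \<beta> (Q N) N) / ereal ((real N)\<^sup>2))
       \<ge> - (ereal \<beta> * robin_constant V)"

end

theory Submission
  imports Defs
begin

text \<open>
  At the scale \<open>N\<^sup>2\<close> the partition function is determined by the energy alone. The test function \<open>f\<close>
  is therefore recovered from the response of the minimal energy to a perturbation of the
  potential.

  Let \<open>m\<^sub>N\<close> be the expectation of the average of \<open>f (Re \<zeta>\<^sub>j)\<close> over the sample; it equals
  \<open>(1 / \<pi>) \<integral> f c\<^sub>N\<close>, because the one-point function is almost everywhere the density of the intensity
  measure of the process (\<open>cross_section_expectation\<close>). Replacing \<open>Q\<^sub>N\<close> by \<open>Q\<^sub>N + t f\<close>, with \<open>f \<ge> 0\<close>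
  depending on the real part only, multiplies the partition function by at least
  \<open>exp (- \<beta> t N\<^sup>2 m\<^sub>N)\<close>, by Jensen's inequality. In the other direction it is bounded through the minimal
  energy of \<open>n\<close>-point configurations for any fixed \<open>n \<le> N\<close>, since the minimal energy per pair
  increases with the number of points. Together with the assumed lower bound for the partition
  function this shows that if \<open>m\<^sub>N \<le> a\<close> for infinitely many \<open>N\<close>, then \<open>n\<close>-point configurations
  have, in the potential \<open>Q\<^sub>M + t f\<close>, energies per pair arbitrarily close to \<open>\<gamma>(V) + t a\<close> or smaller
  (\<open>perturbed_config_energy_bound\<close>).

  For fixed \<open>n\<close>, compactness in \<open>\<complex>\<^sup>n\<close> replaces \<open>Q\<^sub>M\<close> by \<open>V\<close> and puts the points on the real line. For
  \<open>n \<rightarrow> \<infinity>\<close>, compactness of measures on the line yields a probability measure \<open>\<mu>\<^sub>t\<close> with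
  \<open>I\<^sub>V[\<mu>\<^sub>t] + t \<integral> f d\<mu>\<^sub>t \<le> \<gamma>(V) + t a\<close> (\<open>perturbed_line_measure\<close>). As \<open>\<gamma>(V)\<close> is the minimal energy,
  \<open>\<integral> f d\<mu>\<^sub>t \<le> a\<close>. For \<open>t \<rightarrow> 0\<close> the energies of the \<open>\<mu>\<^sub>t\<close> tend to the minimum, so that they
  subconverge to the unique minimizer \<open>\<sigma>\<^sub>V\<close>, and \<open>\<integral> f d\<sigma>\<^sub>V \<le> a\<close> (\<open>equilibrium_mean_le\<close>).

  Existence and uniqueness of the equilibrium measure are needed only on the real line, outside of
  which \<open>V\<close> is infinite. Existence is again compactness. Uniqueness follows from the strict positive
  definiteness of the logarithmic kernel (\<open>mutual_energy_strict\<close>), which on the line is elementary: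
  the logarithm is a superposition of tent functions \<open>(h - \<bar>x - y\<bar>)\<^sup>+\<close>, each of them the
  autocorrelation of the indicator of an interval. Throughout, energies are shifted by a constant
  \<open>B\<close> that makes them nonnegative.
\<close>

section \<open>Differentiation of measures along balls\<close>

text \<open>
  By Vitali, almost all of \<open>E\<close> is covered by disjoint balls on which \<open>\<alpha>\<close> is at most \<open>\<beta>\<close> and
  which lie in an open set whose \<open>\<beta>\<close>-measure exceeds that of \<open>E\<close> as little as desired.
\<close>

lemma emeasure_le_of_small_balls:
  fixes \<alpha> \<beta> :: "'a::euclidean_space measure"
  assumes sa: "sets \<alpha> = sets borel" and sb: "sets \<beta> = sets borel"
    and ac: "\<And>A. A \<in> null_sets lborel \<Longrightarrow> emeasure \<alpha> A = 0"
    and E: "E \<in> sets borel"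
    and outer: "\<And>e::real. e > 0 \<Longrightarrow> \<exists>U. open U \<and> E \<subseteq> U \<and> emeasure \<beta> U \<le> emeasure \<beta> E + ennreal e"
    and small: "\<And>z d. z \<in> E \<Longrightarrow> d > 0 \<Longrightarrow>
        \<exists>r. 0 < r \<and> r < d \<and> emeasure \<alpha> (cball z r) \<le> emeasure \<beta> (cball z r)"
  shows "emeasure \<alpha> E \<le> emeasure \<beta> E"
proof (rule ennreal_le_epsilon)
  fix e :: real assume "e > 0"
  then obtain U where U: "open U" "E \<subseteq> U" "emeasure \<beta> U \<le> emeasure \<beta> E + ennreal e"
    using outer[of e] by auto
  define K where "K = {(z, r). 0 < r \<and> cball z r \<subseteq> U \<and> emeasure \<alpha> (cball z r) \<le> emeasure \<beta> (cball z r)}"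
  have "\<exists>i. i \<in> K \<and> x \<in> cball (fst i) (snd i) \<and> snd i < d" if x: "x \<in> E" and d: "0 < d" for x d
  proof -
    obtain d' where d': "d' > 0" "cball x d' \<subseteq> U"
      using U x by (meson open_contains_cball subsetD)
    obtain r where r: "0 < r" "r < min d d'" "emeasure \<alpha> (cball x r) \<le> emeasure \<beta> (cball x r)"
      using small[OF x, of "min d d'"] d' d by auto
    have "cball x r \<subseteq> U" using d' r by (meson dual_order.trans min_less_iff_conj nless_le subset_cball)
    then show ?thesis using r by (intro exI[of _ "(x, r)"]) (auto simp: K_def)
  qed
  then have cov: "\<And>x d. x \<in> E \<Longrightarrow> 0 < d \<Longrightarrow> \<exists>i. i \<in> K \<and> x \<in> cball (fst i) (snd i) \<and> snd i < d"
    by blast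
  have pos: "\<And>i. i \<in> K \<Longrightarrow> 0 < snd i" by (auto simp: K_def)
  obtain C where C: "countable C" "C \<subseteq> K"
     "pairwise (\<lambda>i j. disjnt (cball (fst i) (snd i)) (cball (fst j) (snd j))) C"
     "negligible (E - (\<Union>i \<in> C. cball (fst i) (snd i)))"
    by (rule Vitali_covering_theorem_cballs[OF pos cov]) blast+
  define D where "D = (\<Union>i \<in> C. cball (fst i) (snd i))"
  have D[measurable]: "D \<in> sets borel"
    unfolding D_def using C(1) by (intro sets.countable_UN') auto
  have disj: "disjoint_family_on (\<lambda>i. cball (fst i) (snd i)) C"
    using C(3) by (auto simp: disjoint_family_on_def pairwise_def disjnt_def)
  have "E - D \<in> null_sets lborel"
    using C(4) E D unfolding D_def[symmetric] negligible_iff_null_sets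
    by (subst (asm) null_sets_completion_iff) auto
  then have z: "emeasure \<alpha> (E - D) = 0" by (rule ac)
  have "emeasure \<alpha> E \<le> emeasure \<alpha> ((E - D) \<union> D)"
    using E D sa by (intro emeasure_mono) auto
  also have "\<dots> \<le> emeasure \<alpha> (E - D) + emeasure \<alpha> D"
    using E D sa by (intro emeasure_subadditive) auto
  also have "\<dots> = emeasure \<alpha> D" using z by simp
  also have "\<dots> = (\<integral>\<^sup>+i. emeasure \<alpha> (cball (fst i) (snd i)) \<partial>count_space C)"
    unfolding D_def using C(1) disj sa by (intro emeasure_UN_countable) auto
  also have "\<dots> \<le> (\<integral>\<^sup>+i. emeasure \<beta> (cball (fst i) (snd i)) \<partial>count_space C)"
    using C(2) by (intro nn_integral_mono) (auto simp: K_def)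
  also have "\<dots> = emeasure \<beta> D"
    unfolding D_def using C(1) disj sb by (intro emeasure_UN_countable[symmetric]) auto
  also have "\<dots> \<le> emeasure \<beta> U"
    using C(2) U(1) sb by (intro emeasure_mono) (fastforce simp: D_def K_def)+
  finally show "emeasure \<alpha> E \<le> emeasure \<beta> E + ennreal e" using U(3) by simp
qed

lemma sphere_null_lborel: "sphere z r \<in> null_sets (lborel :: 'a::euclidean_space measure)"
  using negligible_sphere[of z r]
  by (auto simp: null_sets_completion_iff negligible_iff_null_sets)

lemma continuous_integral_ball:
  fixes g :: "'a::euclidean_space \<Rightarrow> real"
  assumes g: "integrable lborel g"
  shows "continuous_on UNIV (\<lambda>z. \<integral>w. indicator (ball z r) w * g w \<partial>lborel)"
proof (rule continuous_at_imp_continuous_on, intro ballI, unfold continuous_at_sequentially, safe)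
  fix z and x :: "nat \<Rightarrow> 'a" assume x: "x \<longlonglongrightarrow> z"
  have [measurable]: "g \<in> borel_measurable borel" using g by auto
  have ae: "AE w in lborel. w \<notin> sphere z r"
    by (rule AE_not_in[OF sphere_null_lborel])
  have lim: "(\<lambda>n. indicator (ball (x n) r) w * g w) \<longlonglongrightarrow> indicator (ball z r) w * g w"
    if "w \<notin> sphere z r" for w
  proof -
    have t: "(\<lambda>n. dist (x n) w) \<longlonglongrightarrow> dist z w" by (intro tendsto_intros x)
    have "eventually (\<lambda>n. w \<in> ball (x n) r \<longleftrightarrow> w \<in> ball z r) sequentially"
    proof (cases "dist z w < r")
      case True
      then show ?thesis using order_tendstoD(2)[OF t True] by (auto elim: eventually_mono)
    next
      case False
      with that have "dist z w > r" by auto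
      then show ?thesis using order_tendstoD(1)[OF t, of r] by (auto elim!: eventually_mono)
    qed
    then have "eventually (\<lambda>n. indicator (ball (x n) r) w * g w = indicator (ball z r) w * g w) sequentially"
      by (auto elim!: eventually_mono simp: indicator_def)
    then show ?thesis by (rule tendsto_eventually)
  qed
  show "((\<lambda>z. \<integral>w. indicator (ball z r) w * g w \<partial>lborel) \<circ> x) \<longlonglongrightarrow> (\<integral>w. indicator (ball z r) w * g w \<partial>lborel)"
    unfolding comp_def
    by (rule integral_dominated_convergence[where w="\<lambda>w. \<bar>g w\<bar>"])
       (use g in \<open>auto intro!: eventually_mono[OF ae] lim simp del: indicator_simps\<close>,
        auto simp: indicator_def)
qed

text \<open>
  If the upper (lower) derivative exceeded (fell below) the density on a set of positive measure,
  there would be rationals separating them on such a set, against the comparison above.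
\<close>

lemma differentiation_of_density:
  fixes g :: "'a::euclidean_space \<Rightarrow> real"
  assumes g: "integrable lborel g" and g0: "\<And>z. g z \<ge> 0"
  defines "\<rho> \<equiv> density lborel (\<lambda>z. ennreal (g z))"
  shows "AE z in lborel. ((\<lambda>r. measure \<rho> (ball z r) / measure lborel (ball z r)) \<longlongrightarrow> g z) (at_right 0)"
proof -
  have gm[measurable]: "g \<in> borel_measurable borel" using g by auto
  have sr[measurable_cong]: "sets \<rho> = sets borel" by (simp add: \<rho>_def)
  have spr: "space \<rho> = UNIV" by (simp add: \<rho>_def)
  have "emeasure \<rho> UNIV = ennreal (\<integral>z. g z \<partial>lborel)"
    unfolding \<rho>_def using g g0 by (subst emeasure_density) (auto intro!: nn_integral_eq_integral)
  then interpret \<rho>: finite_measure \<rho>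
    by (intro finite_measureI) (simp add: spr)
  define v where "v r = measure lborel (ball (0::'a) r)" for r
  have v: "measure lborel (ball z r) = v r" for z :: 'a and r :: real
  proof (cases "r \<ge> 0")
    case True
    then show ?thesis by (simp add: v_def content_ball)
  qed (simp add: v_def ball_empty)
  have vpos: "v r > 0" if "r > 0" for r
    using that unfolding v_def by (intro content_ball_pos)
  have ball_cball: "emeasure \<mu> (cball z r) = emeasure \<mu> (ball z r)"
    if "\<And>A. A \<in> null_sets lborel \<Longrightarrow> emeasure \<mu> A = 0" "sets \<mu> = sets borel" for \<mu> and z :: 'a and r
  proof (rule antisym)
    have "emeasure \<mu> (cball z r) \<le> emeasure \<mu> (ball z r \<union> sphere z r)"
      using that(2) by (intro emeasure_mono) auto
    also have "\<dots> \<le> emeasure \<mu> (ball z r) + emeasure \<mu> (sphere z r)"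
      using that(2) by (intro emeasure_subadditive) auto
    also have "emeasure \<mu> (sphere z r) = 0" using that(1)[OF sphere_null_lborel] .
    finally show "emeasure \<mu> (cball z r) \<le> emeasure \<mu> (ball z r)" by simp
  qed (rule emeasure_mono, auto simp: that(2))
  have ac_r: "emeasure \<rho> A = 0" if "A \<in> null_sets lborel" for A
  proof -
    have "absolutely_continuous lborel \<rho>" unfolding \<rho>_def by (intro absolutely_continuousI_density) auto
    then show ?thesis using that by (auto simp: absolutely_continuous_def null_sets_def)
  qed
  define L :: "real \<Rightarrow> 'a measure" where "L c = density lborel (\<lambda>_. ennreal c)" for c
  have sl[measurable_cong]: "sets (L c) = sets borel" for c by (simp add: L_def)
  have el: "emeasure (L c) A = ennreal c * emeasure lborel A" if "A \<in> sets borel" for c A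
    unfolding L_def using that by (simp add: emeasure_density nn_integral_cmult)
  have ac_l: "emeasure (L c) A = 0" if "A \<in> null_sets lborel" for A c
    using that by (subst el) (auto simp: null_sets_def)
  define \<phi> where "\<phi> r z = measure \<rho> (ball z r)" for z r
  have "\<phi> r z = (\<integral>w. indicator (ball z r) w * g w \<partial>lborel)" for r z
  proof -
    have "emeasure \<rho> (ball z r) = (\<integral>\<^sup>+w. ennreal (indicator (ball z r) w * g w) \<partial>lborel)"
      unfolding \<rho>_def by (subst emeasure_density) (auto intro!: nn_integral_cong simp: indicator_def)
    also have "\<dots> = ennreal (\<integral>w. indicator (ball z r) w * g w \<partial>lborel)"
      using g g0 by (intro nn_integral_eq_integral)
        (auto intro!: integrable_mult_indicator[where 'b=real, simplified])
    finally show ?thesis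
      unfolding \<phi>_def measure_def using g0 by (simp add: integral_nonneg_AE)
  qed
  then have \<phi>c: "continuous_on UNIV (\<phi> r)" for r
    using continuous_integral_ball[OF g, of r] by (simp add: fun_eq_iff cong: continuous_on_cong)
  \<comment> \<open>These sets are Borel: as spheres are null sets, the mass of a ball depends continuously on its
    center, so that each is a countable intersection of open sets.\<close>
  define Up where "Up a = (\<Inter>n. \<Union>r\<in>{0<..<1/Suc n}. {z. \<phi> r z > a * v r})" for a
  define Lo where "Lo a = (\<Inter>n. \<Union>r\<in>{0<..<1/Suc n}. {z. \<phi> r z < a * v r})" for a
  have [measurable]: "Up a \<in> sets borel" "Lo a \<in> sets borel" for a
    unfolding Up_def Lo_def
    by (intro sets.countable_INT' borel_open open_UN ballI open_Collect_less \<phi>c continuous_on_const; auto)+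
  have UpD: "\<exists>r. 0 < r \<and> r < d \<and> \<phi> r z > a * v r" if z: "z \<in> Up a" and "d > 0" for z a d
  proof -
    obtain n where "1 / Suc n < d" using \<open>d > 0\<close> nat_approx_posE by auto
    moreover obtain r where "r \<in> {0<..<1/Suc n}" "\<phi> r z > a * v r" using z unfolding Up_def by blast
    ultimately show ?thesis by (intro exI[of _ r]) auto
  qed
  have LoD: "\<exists>r. 0 < r \<and> r < d \<and> \<phi> r z < a * v r" if z: "z \<in> Lo a" and "d > 0" for z a d
  proof -
    obtain n where "1 / Suc n < d" using \<open>d > 0\<close> nat_approx_posE by auto
    moreover obtain r where "r \<in> {0<..<1/Suc n}" "\<phi> r z < a * v r" using z unfolding Lo_def by blast
    ultimately show ?thesis by (intro exI[of _ r]) auto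
  qed
  have emb: "emeasure \<rho> (ball z r) = ennreal (\<phi> r z)" for z r
    by (simp add: \<phi>_def \<rho>.emeasure_eq_measure)
  have elb: "emeasure (L c) (ball z r) = ennreal (c * v r)" if "c \<ge> 0" for c z r
  proof -
    have "emeasure lborel (ball z r) = ennreal (v r)"
      using v[of z r] emeasure_bounded_finite[OF bounded_ball, of z r]
      by (metis emeasure_eq_ennreal_measure infinity_ennreal_def order_less_irrefl)
    then show ?thesis using that by (simp add: el ennreal_mult')
  qed
  have null: "E \<in> null_sets lborel"
    if "E \<in> sets borel" "E \<subseteq> ball 0 R" "0 \<le> b" "b < a" "ennreal a * emeasure lborel E \<le> ennreal b * emeasure lborel E"
    for E :: "'a set" and R a b
  proof -
    have "emeasure lborel E < \<infinity>"
      using that by (intro emeasure_bounded_finite) (rule bounded_subset[OF bounded_ball])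
    then obtain x where x: "emeasure lborel E = ennreal x" "x \<ge> 0"
      by (cases "emeasure lborel E") auto
    then have "a * x \<le> b * x"
      using that by (simp add: ennreal_mult'[symmetric])
    then have "x \<le> 0" using that(4) x(2) by (meson leD mult_le_cancel_right not_le)
    then show ?thesis using x that by (auto simp: null_sets_def)
  qed
  have outer_r: "\<exists>U. open U \<and> E \<subseteq> U \<and> emeasure \<rho> U \<le> emeasure \<rho> E + ennreal e"
    if "E \<in> sets borel" "e > 0" for E and e :: real
  proof -
    have "emeasure \<rho> E = (INF U\<in>{U. E \<subseteq> U \<and> open U}. emeasure \<rho> U)"
      using that by (intro outer_regular) (auto simp: sr)
    moreover have "emeasure \<rho> E < emeasure \<rho> E + ennreal e"
      using that by (simp add: \<rho>.emeasure_eq_measure ennreal_plus[symmetric] ennreal_less_iff del: ennreal_plus)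
    ultimately show ?thesis
      using INF_less_iff[of "emeasure \<rho>" "{U. E \<subseteq> U \<and> open U}" "emeasure \<rho> E + ennreal e"]
      by (auto simp: less_imp_le)
  qed
  have outer_l: "\<exists>U. open U \<and> E \<subseteq> U \<and> emeasure (L c) U \<le> emeasure (L c) E + ennreal e"
    if E: "E \<in> sets borel" and e: "e > 0" and c: "c \<ge> 0" for E c and e :: real
  proof -
    obtain U where U: "open U" "E \<subseteq> U" "emeasure lborel (U - E) < ennreal (e / (c + 1))"
      using outer_regular_lborel[OF E, of "e / (c+1)"] e c by (metis add_nonneg_pos divide_pos_pos zero_less_one)
    have "emeasure (L c) U \<le> emeasure (L c) E + emeasure (L c) (U - E)"
      using U E by (intro order.trans[OF emeasure_mono emeasure_subadditive]) (auto simp: sl)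
    also have "emeasure (L c) (U - E) \<le> ennreal c * ennreal (e / (c + 1))"
      using U E by (subst el) (auto intro!: mult_left_mono)
    also have "\<dots> = ennreal (c * (e / (c + 1)))" using e c by (subst ennreal_mult) auto
    also have "\<dots> \<le> ennreal e" using that by (intro ennreal_leI) (simp add: field_simps)
    finally show ?thesis using U by (intro exI[of _ U]) (auto simp: add_left_mono)
  qed
  have 1: "{z. g z \<le> b} \<inter> Up a \<inter> ball 0 R \<in> null_sets lborel" (is "?E \<in> _") if "b < a" for a b R
  proof (cases "b \<ge> 0")
    case True
    have m: "?E \<in> sets borel" by measurable
    have "ennreal a * emeasure lborel ?E = emeasure (L a) ?E" using m by (simp add: el)
    also have "\<dots> \<le> emeasure \<rho> ?E"
    proof (rule emeasure_le_of_small_balls[OF sl sr ac_l m outer_r[OF m]])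
      fix z d assume "z \<in> ?E" "(0::real) < d"
      then obtain r where "0 < r" "r < d" "\<phi> r z > a * v r" using UpD by blast
      then show "\<exists>r>0. r < d \<and> emeasure (L a) (cball z r) \<le> emeasure \<rho> (cball z r)"
        using True that
        by (intro exI[of _ r]) (simp add: ball_cball[OF ac_l sl] ball_cball[OF ac_r sr] emb elb ennreal_leI)
    qed
    also have "\<dots> = (\<integral>\<^sup>+z. ennreal (g z) * indicator ?E z \<partial>lborel)"
      unfolding \<rho>_def using m by (subst emeasure_density) auto
    also have "\<dots> \<le> (\<integral>\<^sup>+z. ennreal b * indicator ?E z \<partial>lborel)"
      by (intro nn_integral_mono) (auto simp: indicator_def intro!: ennreal_leI)
    also have "\<dots> = ennreal b * emeasure lborel ?E"
      using m by (intro nn_integral_cmult_indicator) simp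
    finally show ?thesis using null[OF m _ True that, of R] by auto
  next
    case False
    then have "?E = {}" using g0 by (auto simp: not_le intro: less_le_trans) (meson g0 leD order.trans)
    then show ?thesis by simp
  qed
  have 2: "{z. g z \<ge> a} \<inter> Lo b \<inter> ball 0 R \<in> null_sets lborel" (is "?E \<in> _") if "b < a" for a b R
  proof (cases "b \<ge> 0")
    case True
    have m: "?E \<in> sets borel" by measurable
    have "ennreal a * emeasure lborel ?E = (\<integral>\<^sup>+z. ennreal a * indicator ?E z \<partial>lborel)"
      using m by (intro nn_integral_cmult_indicator[symmetric]) simp
    also have "\<dots> \<le> (\<integral>\<^sup>+z. ennreal (g z) * indicator ?E z \<partial>lborel)"
      by (intro nn_integral_mono) (auto simp: indicator_def intro!: ennreal_leI)
    also have "\<dots> = emeasure \<rho> ?E"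
      unfolding \<rho>_def using m by (subst emeasure_density) auto
    also have "\<dots> \<le> emeasure (L b) ?E"
    proof (rule emeasure_le_of_small_balls[OF sr sl ac_r m outer_l[OF m _ True]])
      fix z d assume "z \<in> ?E" "(0::real) < d"
      then obtain r where "0 < r" "r < d" "\<phi> r z < b * v r" using LoD by blast
      then show "\<exists>r>0. r < d \<and> emeasure \<rho> (cball z r) \<le> emeasure (L b) (cball z r)"
        using True that
        by (intro exI[of _ r]) (simp add: ball_cball[OF ac_l sl] ball_cball[OF ac_r sr] emb elb ennreal_leI)
    qed
    also have "\<dots> = ennreal b * emeasure lborel ?E" using m by (simp add: el)
    finally show ?thesis using null[OF m _ True that, of R] by auto
  next
    case False
    have "z \<notin> Lo b" for z
    proof
      assume "z \<in> Lo b"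
      then obtain r where "0 < r" "\<phi> r z < b * v r" using LoD[of z b 1] by auto
      moreover have "\<phi> r z \<ge> 0" by (simp add: \<phi>_def)
      moreover have "b * v r \<le> 0" using False vpos[OF \<open>0 < r\<close>] by (simp add: mult_nonpos_nonneg)
      ultimately show False by simp
    qed
    then have "?E = {}" by blast
    then show ?thesis by (metis null_sets.empty_sets)
  qed
  have "AE z in lborel. \<forall>b\<in>\<rat>. \<forall>a\<in>\<rat>. \<forall>n::nat. b < a \<longrightarrow>
      z \<notin> {z. g z \<le> b} \<inter> Up a \<inter> ball 0 n \<and> z \<notin> {z. g z \<ge> a} \<inter> Lo b \<inter> ball 0 n"
    using 1 2 by (intro AE_ball_countable[THEN iffD2] countable_rat ballI AE_all_countable[THEN iffD2] allI AE_impI AE_conjI AE_not_in)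
  then show ?thesis
  proof (eventually_elim)
    case (elim z)
    obtain n :: nat where n: "norm z < n" using reals_Archimedean2 by blast
    have U: "z \<notin> Up a" if a: "a \<in> \<rat>" and ga: "g z < a" for a
    proof -
      obtain b where "b \<in> \<rat>" "g z < b" "b < a" using Rats_dense_in_real[OF ga] by blast
      then show ?thesis using elim n a by (force simp: dist_norm)
    qed
    have L: "z \<notin> Lo b" if b: "b \<in> \<rat>" and gb: "b < g z" for b
    proof -
      obtain a where "a \<in> \<rat>" "b < a" "a < g z" using Rats_dense_in_real[OF gb] by blast
      then show ?thesis using elim n b by (force simp: dist_norm)
    qed
    have "((\<lambda>r. \<phi> r z / v r) \<longlongrightarrow> g z) (at_right 0)"
    proof (rule order_tendstoI)
      fix y assume "y < g z"
      then obtain b where b: "b \<in> \<rat>" "y < b" "b < g z" using Rats_dense_in_real by blast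
      then obtain n where n: "\<And>r. r \<in> {0<..<1/Suc n} \<Longrightarrow> \<not> \<phi> r z < b * v r"
        using L unfolding Lo_def by blast
      show "\<forall>\<^sub>F r in at_right 0. y < \<phi> r z / v r"
        unfolding eventually_at_right_field
      proof (intro exI[of _ "1/Suc n"] conjI allI impI)
        fix r :: real assume "0 < r" "r < 1 / Suc n"
        then have "b * v r \<le> \<phi> r z" using n[of r] by simp
        then have "b \<le> \<phi> r z / v r" using vpos[OF \<open>0 < r\<close>] by (simp add: field_simps)
        then show "y < \<phi> r z / v r" using b by simp
      qed simp
    next
      fix y assume "g z < y"
      then obtain b where b: "b \<in> \<rat>" "g z < b" "b < y" using Rats_dense_in_real by blast
      then obtain n where n: "\<And>r. r \<in> {0<..<1/Suc n} \<Longrightarrow> \<not> \<phi> r z > b * v r"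
        using U unfolding Up_def by blast
      show "\<forall>\<^sub>F r in at_right 0. \<phi> r z / v r < y"
        unfolding eventually_at_right_field
      proof (intro exI[of _ "1/Suc n"] conjI allI impI)
        fix r :: real assume "0 < r" "r < 1 / Suc n"
        then have "b * v r \<ge> \<phi> r z" using n[of r] by simp
        then have "b \<ge> \<phi> r z / v r" using vpos[OF \<open>0 < r\<close>] by (simp add: field_simps)
        then show "\<phi> r z / v r < y" using b by simp
      qed simp
    qed
    then show ?case by (simp add: v \<phi>_def)
  qed
qed

section \<open>The one-point function is the density of the intensity measure\<close>

lemma integral_lebesgue_eq_lborel:
  fixes f g :: "'a::euclidean_space \<Rightarrow> real"
  assumes g: "g \<in> borel_measurable borel" and ae: "AE x in lborel. f x = g x"
  shows "integral\<^sup>L lebesgue f = integral\<^sup>L lborel g"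
proof -
  have gl: "g \<in> borel_measurable lebesgue" using g by (intro measurable_completion) auto
  have ae': "AE x in lebesgue. f x = g x" using ae by (rule AE_completion)
  have fl: "f \<in> borel_measurable lebesgue"
  proof (rule measurableI)
    fix A :: "real set" assume "A \<in> sets borel"
    then have "g -` A \<inter> space lebesgue \<in> sets lebesgue" using gl by (rule measurable_sets[rotated])
    then show "f -` A \<inter> space lebesgue \<in> sets lebesgue"
      by (rule completion.in_sets_AE[rotated]) (use ae' in \<open>auto elim!: eventually_mono\<close>)
  qed simp
  have "integral\<^sup>L lebesgue f = integral\<^sup>L lebesgue g"
    by (rule integral_cong_AE[OF fl gl ae'])
  also have "\<dots> = integral\<^sup>L lborel g" using g by (intro integral_completion) auto
  finally show ?thesis .
qed

lemma measurable_Complex [measurable (raw)]: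
  assumes "f \<in> borel_measurable M" "g \<in> borel_measurable M"
  shows "(\<lambda>x. Complex (f x) (g x)) \<in> borel_measurable M"
  using assms by (simp add: borel_measurable_complex_iff)

lemma lborel_complex_eq:
  "lborel = distr (lborel \<Otimes>\<^sub>M lborel) borel (\<lambda>p. Complex (fst p) (snd p))"
proof (rule lborel_eqI)
  fix l u :: complex assume le: "\<And>b. b \<in> Basis \<Longrightarrow> l \<bullet> b \<le> u \<bullet> b"
  have le': "Re l \<le> Re u" "Im l \<le> Im u"
    using le[of 1] le[of \<i>] by (simp_all add: Basis_complex_def inner_complex_def)
  have "emeasure (distr (lborel \<Otimes>\<^sub>M lborel) borel (\<lambda>p. Complex (fst p) (snd p))) (box l u)
      = emeasure (lborel \<Otimes>\<^sub>M lborel) ({Re l<..<Re u} \<times> {Im l<..<Im u})"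
    by (subst emeasure_distr) (auto intro!: arg_cong[where f="emeasure _"]
        simp: box_def Basis_complex_def inner_complex_def space_pair_measure)
  also have "\<dots> = ennreal (Re u - Re l) * ennreal (Im u - Im l)"
    using le' by (subst lborel.emeasure_pair_measure_Times) auto
  also have "\<dots> = ennreal (\<Prod>b\<in>Basis. (u - l) \<bullet> b)"
    using le' by (simp add: Basis_complex_def inner_complex_def ennreal_mult)
  finally show "emeasure (distr (lborel \<Otimes>\<^sub>M lborel) borel (\<lambda>p. Complex (fst p) (snd p))) (box l u)
    = ennreal (\<Prod>b\<in>Basis. (u - l) \<bullet> b)" .
qed simp

lemma sigma_finite_area: "sigma_finite_measure area"
  unfolding area_def by (subst sigma_finite_measure.sigma_finite_iff_density_finite[OF sigma_finite_lborel]) auto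

lemma sets_area [measurable_cong, simp]: "sets area = sets borel"
  by (simp add: area_def)

lemma space_area [simp]: "space area = UNIV"
  by (simp add: area_def)

lemma measurable_coordinate: "j < N \<Longrightarrow> (\<lambda>\<zeta>. \<zeta> j) \<in> borel_measurable (area_power N)"
  using measurable_component_singleton[of j "{..<N}" "\<lambda>_. area"]
  by (simp cong: measurable_cong_sets add: area_power_def)

text \<open>
  Absolute continuity is passed on to the marginals, whose densities the Radon-Nikodym theorem
  provides almost everywhere.
\<close>

lemma marginal_density:
  assumes P: "prob_space P" and ac: "absolutely_continuous (area_power N) P"
    and sP: "sets P = sets (area_power N)" and j: "j < N"
  obtains g :: "complex \<Rightarrow> real" where "g \<in> borel_measurable borel" "\<And>z. g z \<ge> 0"
    "distr P borel (\<lambda>\<zeta>. \<zeta> j) = density lborel (\<lambda>z. ennreal (g z))"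
proof -
  interpret product_sigma_finite "\<lambda>_::nat. area"
    by (simp add: product_sigma_finite_def sigma_finite_area)
  interpret P: prob_space P by (rule P)
  note comp = measurable_coordinate[OF j]
  then have compP[measurable]: "(\<lambda>\<zeta>. \<zeta> j) \<in> measurable P borel"
    using sP by (simp cong: measurable_cong_sets)
  interpret D: prob_space "distr P borel (\<lambda>\<zeta>. \<zeta> j)"
    by (rule P.prob_space_distr) simp
  have "absolutely_continuous lborel (distr P borel (\<lambda>\<zeta>. \<zeta> j))"
    unfolding absolutely_continuous_def
  proof
    fix A :: "complex set" assume A: "A \<in> null_sets lborel"
    then have Am: "A \<in> sets borel" and A0: "emeasure lborel A = 0" by auto
    have "A \<in> null_sets area"
      unfolding area_def using A AE_not_in[OF A] by (subst null_sets_density_iff) auto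
    then have "emeasure (area_power N) (Pi\<^sub>E {..<N} (\<lambda>i. if i = j then A else UNIV)) = 0"
      unfolding area_power_def using j Am by (subst emeasure_PiM) (auto simp: prod_zero_iff)
    moreover have eq: "Pi\<^sub>E {..<N} (\<lambda>i. if i = j then A else UNIV) = (\<lambda>\<zeta>. \<zeta> j) -` A \<inter> space (area_power N)"
      using j by (auto simp: area_power_def space_PiM PiE_def Pi_def split: if_splits)
    moreover have "(\<lambda>\<zeta>. \<zeta> j) -` A \<inter> space (area_power N) \<in> sets (area_power N)"
      using comp Am by (rule measurable_sets)
    ultimately have "(\<lambda>\<zeta>. \<zeta> j) -` A \<inter> space (area_power N) \<in> null_sets (area_power N)" by auto
    then have "(\<lambda>\<zeta>. \<zeta> j) -` A \<inter> space P \<in> null_sets P"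
      using ac sets_eq_imp_space_eq[OF sP] by (auto simp: absolutely_continuous_def)
    then show "A \<in> null_sets (distr P borel (\<lambda>\<zeta>. \<zeta> j))"
      using Am by (auto simp: null_sets_def emeasure_distr)
  qed
  then obtain f where f: "f \<in> borel_measurable lborel" "density lborel f = distr P borel (\<lambda>\<zeta>. \<zeta> j)"
    using sigma_finite_measure.Radon_Nikodym[OF sigma_finite_lborel, of "distr P borel (\<lambda>\<zeta>. \<zeta> j)"] by auto
  have [measurable]: "f \<in> borel_measurable borel" using f by simp
  have "(\<integral>\<^sup>+z. f z \<partial>lborel) = emeasure (density lborel f) UNIV"
    by (subst emeasure_density) auto
  also have "\<dots> = 1" using f D.emeasure_space_1 by simp
  finally have "AE z in lborel. f z \<noteq> \<infinity>"
    by (intro nn_integral_PInf_AE) auto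
  then have "density lborel (\<lambda>z. ennreal (enn2real (f z))) = density lborel f"
    by (intro density_cong) (auto elim!: eventually_mono simp: top.not_eq_extremum)
  then show ?thesis
    using f by (intro that[of "\<lambda>z. enn2real (f z)"]) auto
qed

text \<open>
  Differentiation along discs identifies the one-point function with \<open>\<pi>\<close> times the Lebesgue density
  of the intensity measure, almost everywhere; integrating it over vertical lines is then Fubini's
  theorem.
\<close>

lemma cross_section_expectation:
  fixes f :: "real \<Rightarrow> real"
  assumes P: "prob_space (gibbs_measure \<beta> W N)"
    and ac: "absolutely_continuous (area_power N) (gibbs_measure \<beta> W N)"
    and f[measurable]: "f \<in> borel_measurable borel" and bd: "\<And>x. \<bar>f x\<bar> \<le> C"
  shows "(1 / pi) * (\<integral>\<xi>. f \<xi> * cross_section \<beta> W N \<xi> \<partial>lebesgue) =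
         (1 / real N) * (\<integral>\<zeta>. (\<Sum>j<N. f (Re (\<zeta> j))) \<partial>gibbs_measure \<beta> W N)"
proof -
  define P where "P = gibbs_measure \<beta> W N"
  have sP: "sets P = sets (area_power N)" by (simp add: P_def gibbs_measure_def)
  interpret P: prob_space P using P by (simp add: P_def)
  have "\<forall>j. \<exists>g. j < N \<longrightarrow> g \<in> borel_measurable borel \<and> (\<forall>z. g z \<ge> 0) \<and>
    distr P borel (\<lambda>\<zeta>. \<zeta> j) = density lborel (\<lambda>z. ennreal (g z))"
    using marginal_density[OF P ac] sP unfolding P_def by metis
  then obtain G where G: "\<And>j. j < N \<Longrightarrow> G j \<in> borel_measurable borel" "\<And>j z. j < N \<Longrightarrow> G j z \<ge> 0"
    "\<And>j. j < N \<Longrightarrow> distr P borel (\<lambda>\<zeta>. \<zeta> j) = density lborel (\<lambda>z. ennreal (G j z))"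
    by metis
  have comp: "(\<lambda>\<zeta>. \<zeta> j) \<in> measurable P borel" if "j < N" for j
    using measurable_coordinate[OF that] sP by (simp cong: measurable_cong_sets)
  define g where "g z = (\<Sum>j<N. G j z)" for z
  have [measurable]: "g \<in> borel_measurable borel" unfolding g_def using G(1) by simp
  have g0: "g z \<ge> 0" for z unfolding g_def using G(2) by (intro sum_nonneg) auto
  have intG: "integrable lborel (G j)" if "j < N" for j
  proof (rule integrableI_bounded)
    interpret D: prob_space "distr P borel (\<lambda>\<zeta>. \<zeta> j)"
      by (rule P.prob_space_distr) (rule comp[OF that])
    have "(\<integral>\<^sup>+z. ennreal (norm (G j z)) \<partial>lborel) = emeasure (density lborel (\<lambda>z. ennreal (G j z))) UNIV"
      using G(1,2)[OF that] by (subst emeasure_density) auto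
    also have "\<dots> = 1" using G(3)[OF that] D.emeasure_space_1 by simp
    finally show "(\<integral>\<^sup>+z. ennreal (norm (G j z)) \<partial>lborel) < \<infinity>" by simp
  qed (use G(1)[OF that] in simp)
  then have intg: "integrable lborel g" unfolding g_def by (intro Bochner_Integration.integrable_sum) auto
  have distr_int: "(\<integral>\<zeta>. h (\<zeta> j) \<partial>P) = (\<integral>z. h z * G j z \<partial>lborel)"
    if [measurable]: "h \<in> borel_measurable borel" and "j < N" for h :: "complex \<Rightarrow> real" and j
  proof -
    have "(\<integral>\<zeta>. h (\<zeta> j) \<partial>P) = (\<integral>z. h z \<partial>distr P borel (\<lambda>\<zeta>. \<zeta> j))"
      using comp[OF that(2)] by (subst integral_distr) auto
    also have "\<dots> = (\<integral>z. G j z *\<^sub>R h z \<partial>lborel)"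
      unfolding G(3)[OF that(2)] using G(1,2)[OF that(2)]
      by (intro integral_density) auto
    finally show ?thesis by (simp add: mult.commute)
  qed
  have hG: "integrable lborel (\<lambda>z. h z * G j z)"
    if [measurable]: "h \<in> borel_measurable borel" and "j < N" and hC: "\<And>z. \<bar>h z\<bar> \<le> K"
    for h :: "complex \<Rightarrow> real" and j K
  proof (rule Bochner_Integration.integrable_bound)
    show "integrable lborel (\<lambda>z. K * G j z)" using intG[OF that(2)] by simp
    show "(\<lambda>z. h z * G j z) \<in> borel_measurable lborel" using G(1)[OF that(2)] by measurable
    have "\<bar>h z\<bar> * \<bar>G j z\<bar> \<le> \<bar>K\<bar> * \<bar>G j z\<bar>" for z
      by (intro mult_right_mono order.trans[OF hC abs_ge_self]) simp
    then show "AE z in lborel. norm (h z * G j z) \<le> norm (K * G j z)" by (simp add: abs_mult)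
  qed
  have expect: "(\<integral>\<zeta>. (\<Sum>j<N. h (\<zeta> j)) \<partial>P) = (\<integral>z. h z * g z \<partial>lborel)"
    if h[measurable]: "h \<in> borel_measurable borel" and hC: "\<And>z. \<bar>h z\<bar> \<le> K" for h :: "complex \<Rightarrow> real" and K
  proof -
    have "(\<integral>\<zeta>. (\<Sum>j<N. h (\<zeta> j)) \<partial>P) = (\<Sum>j<N. \<integral>\<zeta>. h (\<zeta> j) \<partial>P)"
      using comp hC by (intro Bochner_Integration.integral_sum P.integrable_const_bound[of _ K])
        (auto intro!: AE_I2 measurable_compose[OF _ h])
    also have "\<dots> = (\<Sum>j<N. \<integral>z. h z * G j z \<partial>lborel)"
      using distr_int[OF h] by (intro sum.cong) auto
    also have "\<dots> = (\<integral>z. (\<Sum>j<N. h z * G j z) \<partial>lborel)"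
      using hG[OF h _ hC] by (intro Bochner_Integration.integral_sum[symmetric]) auto
    finally show ?thesis by (simp add: g_def sum_distrib_left)
  qed
  define \<rho> where "\<rho> = density lborel (\<lambda>z. ennreal (g z))"
  have ball: "(\<integral>\<zeta>. real (card {j \<in> {..<N}. \<zeta> j \<in> ball z \<epsilon>}) \<partial>P) = measure \<rho> (ball z \<epsilon>)" for z \<epsilon>
  proof -
    have "(\<integral>\<zeta>. real (card {j \<in> {..<N}. \<zeta> j \<in> ball z \<epsilon>}) \<partial>P) = (\<integral>\<zeta>. (\<Sum>j<N. indicator (ball z \<epsilon>) (\<zeta> j)) \<partial>P)"
      by (intro Bochner_Integration.integral_cong refl)
         (simp add: indicator_def sum.If_cases Int_def del: mem_ball)
    also have "\<dots> = (\<integral>w. indicator (ball z \<epsilon>) w * g w \<partial>lborel)"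
      by (rule expect[of _ 1]) (auto simp: indicator_def)
    also have "\<dots> = measure \<rho> (ball z \<epsilon>)"
    proof -
      have "integrable lborel (\<lambda>w. indicator (ball z \<epsilon>) w * g w)"
        using integrable_mult_indicator[OF _ intg, of "ball z \<epsilon>"] by simp
      then have "emeasure \<rho> (ball z \<epsilon>) = ennreal (\<integral>w. indicator (ball z \<epsilon>) w * g w \<partial>lborel)"
        unfolding \<rho>_def using g0
        by (subst emeasure_density)
           (auto intro!: nn_integral_eq_integral[symmetric, THEN trans, symmetric] nn_integral_cong
                 simp: indicator_def)
      then show ?thesis unfolding measure_def using g0 by (simp add: integral_nonneg_AE)
    qed
    finally show ?thesis .
  qed
  have one: "AE z in lborel. one_point_function \<beta> W N z = pi * g z"
    using differentiation_of_density[OF intg g0, folded \<rho>_def]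
  proof eventually_elim
    case (elim z)
    have vol: "measure lborel (ball z r) = pi * r\<^sup>2" if "r > 0" for r
      using that by (simp add: content_ball unit_ball_vol_2)
    have "((\<lambda>r. pi * (measure \<rho> (ball z r) / measure lborel (ball z r))) \<longlongrightarrow> pi * g z) (at_right 0)"
      by (intro tendsto_intros elim)
    then have "((\<lambda>\<epsilon>. measure \<rho> (ball z \<epsilon>) / \<epsilon>\<^sup>2) \<longlongrightarrow> pi * g z) (at_right 0)"
      by (rule Lim_transform_eventually)
         (auto simp: eventually_at_right_field vol intro!: exI[of _ 1])
    then show ?case
      unfolding one_point_function_def P_def[symmetric] ball by (intro tendsto_Lim) auto
  qed
  have "AE p in lborel \<Otimes>\<^sub>M lborel. one_point_function \<beta> W N (Complex (fst p) (snd p)) = pi * g (Complex (fst p) (snd p))"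
    using AE_distrD[OF _ one[unfolded lborel_complex_eq]] by simp
  then have sec: "AE p in lborel. AE \<eta> in lborel. one_point_function \<beta> W N (Complex p \<eta>) = pi * g (Complex p \<eta>)"
    using lborel_pair.AE_pair by fastforce
  have cs: "AE p in lborel. f p * cross_section \<beta> W N p = f p * ((1 / real N) * (\<integral>\<eta>. pi * g (Complex p \<eta>) \<partial>lborel))"
    using sec
  proof eventually_elim
    case (elim p)
    then show ?case unfolding cross_section_def by (subst integral_lebesgue_eq_lborel[OF _ elim]) auto
  qed
  have hb: "\<bar>f (Re z)\<bar> \<le> C" for z using bd by auto
  have int2: "integrable lborel (\<lambda>z. f (Re z) * g z)"
    unfolding g_def sum_distrib_left using hG[of "\<lambda>z. f (Re z)", OF _ _ hb]
    by (intro Bochner_Integration.integrable_sum) auto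
  have "(\<integral>\<xi>. f \<xi> * cross_section \<beta> W N \<xi> \<partial>lebesgue)
      = (\<integral>p. f p * ((1 / real N) * (\<integral>\<eta>. pi * g (Complex p \<eta>) \<partial>lborel)) \<partial>lborel)"
    by (rule integral_lebesgue_eq_lborel[OF _ cs]) measurable
  also have "\<dots> = (pi / real N) * (\<integral>p. (\<integral>\<eta>. f p * g (Complex p \<eta>) \<partial>lborel) \<partial>lborel)"
    by (subst Bochner_Integration.integral_mult_right_zero[symmetric])
       (intro Bochner_Integration.integral_cong refl; simp)
  also have "(\<integral>p. (\<integral>\<eta>. f p * g (Complex p \<eta>) \<partial>lborel) \<partial>lborel)
    = (\<integral>q. f (fst q) * g (Complex (fst q) (snd q)) \<partial>(lborel \<Otimes>\<^sub>M lborel))"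
  proof -
    have "integrable (lborel \<Otimes>\<^sub>M lborel) (\<lambda>q. f (fst q) * g (Complex (fst q) (snd q)))"
      using int2 unfolding lborel_complex_eq by (subst (asm) integrable_distr_eq) auto
    then show ?thesis
      by (subst lborel_pair.integral_fst'[symmetric]) auto
  qed
  also have "\<dots> = (\<integral>z. f (Re z) * g z \<partial>lborel)"
    by (subst lborel_complex_eq, subst integral_distr) auto
  also have "\<dots> = (\<integral>\<zeta>. (\<Sum>j<N. f (Re (\<zeta> j))) \<partial>P)"
    by (rule expect[symmetric, OF _ hb]) measurable
  finally show ?thesis by (simp add: P_def field_simps)
qed

section \<open>Weighted logarithmic energy\<close>

definition growth :: "complex \<Rightarrow> real" where
  "growth z = ln (1 + cmod z)"

text \<open>
  The logarithmic kernel becomes nonnegative, even at infinity, when half of the potential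
  \<open>2 ln (1 + \<bar>z\<bar>)\<close> is attached to each of its arguments; what is left of an external
  potential is nonnegative as well, up to a constant. All energies are then integrals of
  nonnegative functions.
\<close>

definition log_pair :: "complex \<Rightarrow> complex \<Rightarrow> ennreal" where
  "log_pair z w = e2ennreal (log_kernel z w + ereal (growth z + growth w))"

definition reduced :: "real \<Rightarrow> (complex \<Rightarrow> ereal) \<Rightarrow> complex \<Rightarrow> ennreal" where
  "reduced B W z = e2ennreal (W z + ereal (B - 2 * growth z))"

definition weighted_energy :: "(complex \<Rightarrow> ennreal) \<Rightarrow> complex measure \<Rightarrow> ennreal" where
  "weighted_energy q \<mu> = (\<integral>\<^sup>+z. \<integral>\<^sup>+w. log_pair z w + q z \<partial>\<mu> \<partial>\<mu>)"

definition lsc :: "('a::topological_space \<Rightarrow> ennreal) \<Rightarrow> bool" where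
  "lsc q \<longleftrightarrow> (\<forall>z x. x \<longlonglongrightarrow> z \<longrightarrow> q z \<le> liminf (\<lambda>n. q (x n)))"

lemma growth_nonneg: "growth z \<ge> 0"
  by (simp add: growth_def)

lemma growth_bound_weaken:
  assumes "\<delta> > 0" and "ereal (2 * (1 + \<delta>) * growth z - B) \<le> w"
  shows "ereal (2 * growth z - B) \<le> w"
proof (rule order.trans[OF _ assms(2)])
  show "ereal (2 * growth z - B) \<le> ereal (2 * (1 + \<delta>) * growth z - B)"
    using assms(1) growth_nonneg[of z] by (simp add: algebra_simps)
qed

lemma continuous_growth: "continuous_on UNIV growth"
  unfolding growth_def by (intro continuous_intros) (auto simp: add_nonneg_eq_0_iff)

lemma measurable_growth [measurable]: "growth \<in> borel_measurable borel"
  by (intro borel_measurable_continuous_onI continuous_growth)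

lemma cmod_diff_le_growth: "cmod (z - w) \<le> (1 + cmod z) * (1 + cmod w)"
proof -
  have "cmod (z - w) \<le> cmod z + cmod w" by (rule norm_triangle_ineq4)
  also have "\<dots> \<le> (1 + cmod z) * (1 + cmod w)" by (simp add: algebra_simps)
  finally show ?thesis .
qed

lemma log_kernel_growth_nonneg: "0 \<le> log_kernel z w + ereal (growth z + growth w)"
proof (cases "z = w")
  case False
  have "ln (cmod (z - w)) \<le> ln ((1 + cmod z) * (1 + cmod w))"
    using False cmod_diff_le_growth[of z w] by (intro ln_mono) auto
  also have "\<dots> = growth z + growth w"
    unfolding growth_def by (intro ln_mult_pos) (auto simp: add_pos_nonneg)
  finally show ?thesis using False by (simp add: log_kernel_def ln_div)
qed (simp add: log_kernel_def)

lemma log_pair_diag [simp]: "log_pair z z = \<infinity>"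
  by (simp add: log_pair_def log_kernel_def)

lemma log_pair_off_diag:
  "z \<noteq> w \<Longrightarrow> log_pair z w = ennreal (growth z + growth w - ln (cmod (z - w)))"
  by (simp add: log_pair_def log_kernel_def ln_div e2ennreal_ereal)

lemma log_pair_commute: "log_pair z w = log_pair w z"
  by (cases "z = w") (simp_all add: log_pair_off_diag norm_minus_commute add.commute)

lemma log_pair_tendsto:
  assumes x: "x \<longlonglongrightarrow> z" and y: "y \<longlonglongrightarrow> w"
  shows "(\<lambda>n. log_pair (x n) (y n)) \<longlonglongrightarrow> log_pair z w"
proof (cases "z = w")
  case False
  have "eventually (\<lambda>n. dist (x n) (y n) > 0) sequentially"
    using False by (intro order_tendstoD(1)[OF tendsto_dist[OF x y]]) auto
  then have ev: "eventually (\<lambda>n. ennreal (growth (x n) + growth (y n) - ln (cmod (x n - y n))) = log_pair (x n) (y n)) sequentially"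
    by eventually_elim (auto simp: log_pair_off_diag)
  have "(\<lambda>n. ennreal (growth (x n) + growth (y n) - ln (cmod (x n - y n)))) \<longlonglongrightarrow> ennreal (growth z + growth w - ln (cmod (z - w)))"
    using False unfolding growth_def
    by (intro tendsto_ennrealI tendsto_intros x y) (auto simp: add_nonneg_eq_0_iff)
  from Lim_transform_eventually[OF this ev] show ?thesis
    using False by (simp add: log_pair_off_diag)
next
  case True
  have d0: "(\<lambda>n. dist (x n) (y n)) \<longlonglongrightarrow> 0" using tendsto_dist[OF x y] True by simp
  have "eventually (\<lambda>n. a < log_pair (x n) (y n)) sequentially" if a: "a < \<infinity>" for a
  proof -
    obtain r where r: "a = ennreal r" "r \<ge> 0" using a by (cases a) auto
    have "eventually (\<lambda>n. dist (x n) (y n) < exp (- r - 1)) sequentially"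
      by (rule order_tendstoD(2)[OF d0]) simp
    then show ?thesis
    proof eventually_elim
      case (elim n)
      show ?case
      proof (cases "x n = y n")
        case False
        then have "ln (cmod (x n - y n)) < ln (exp (- r - 1))"
          using elim by (subst ln_less_cancel_iff) (auto simp: dist_norm)
        then have "r < growth (x n) + growth (y n) - ln (cmod (x n - y n))"
          using growth_nonneg[of "x n"] growth_nonneg[of "y n"] by simp
        then show ?thesis using False r by (simp add: log_pair_off_diag ennreal_lessI)
      qed (use a in auto)
    qed
  qed
  then show ?thesis using True by (intro order_tendstoI) auto
qed

lemma measurable_log_pair [measurable]:
  "(\<lambda>p. log_pair (fst p) (snd p)) \<in> borel_measurable (borel \<Otimes>\<^sub>M borel)"
proof -
  have "continuous_on UNIV (\<lambda>p. log_pair (fst p) (snd p))"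
    by (intro continuous_at_imp_continuous_on ballI, unfold continuous_at_sequentially comp_def)
       (auto intro!: log_pair_tendsto tendsto_fst tendsto_snd)
  then show ?thesis unfolding borel_prod by (rule borel_measurable_continuous_onI)
qed

lemma measurable_log_pair' [measurable (raw)]:
  assumes "f \<in> borel_measurable M" "g \<in> borel_measurable M"
  shows "(\<lambda>x. log_pair (f x) (g x)) \<in> borel_measurable M"
  using measurable_compose[OF measurable_Pair[OF assms] measurable_log_pair] by simp

lemma log_kernel_eq_log_pair: "log_kernel z w = enn2ereal (log_pair z w) - ereal (growth z + growth w)"
  using log_kernel_growth_nonneg[of z w] unfolding log_pair_def
  by (subst enn2ereal_e2ennreal) (auto simp: log_kernel_def)

lemma measurable_log_kernel [measurable (raw)]:
  assumes [measurable]: "f \<in> borel_measurable M" "g \<in> borel_measurable M"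
  shows "(\<lambda>x. log_kernel (f x) (g x)) \<in> borel_measurable M"
  unfolding log_kernel_eq_log_pair by measurable

lemma measurable_lsc:
  fixes q :: "'a::first_countable_topology \<Rightarrow> ennreal"
  assumes "lsc q" shows "q \<in> borel_measurable borel"
proof (rule borel_measurableI_le)
  fix a
  have "closed {z. q z \<le> a}"
    unfolding closed_sequential_limits
  proof safe
    fix x z assume x: "\<forall>n. x n \<in> {z. q z \<le> a}" "x \<longlonglongrightarrow> z"
    then have "q z \<le> liminf (\<lambda>n. q (x n))" using assms by (auto simp: lsc_def)
    also have "\<dots> \<le> a" using x by (intro Liminf_le) (auto intro!: always_eventually)
    finally show "q z \<le> a" .
  qed
  then show "{x \<in> space borel. q x \<le> a} \<in> sets borel" by simp
qed

lemma measurable_lower_semicontinuous: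
  "lower_semicontinuous W \<Longrightarrow> W \<in> borel_measurable borel"
  by (intro borel_measurableI_greater) (auto simp: lower_semicontinuous_def)

lemma lsc_reduced:
  assumes W: "lower_semicontinuous W"
  shows "lsc (reduced B W)"
  unfolding lsc_def
proof (intro allI impI)
  fix z and x :: "nat \<Rightarrow> complex" assume x: "x \<longlonglongrightarrow> z"
  have g: "(\<lambda>n. B - 2 * growth (x n)) \<longlonglongrightarrow> B - 2 * growth z"
    unfolding growth_def by (intro tendsto_intros x) (auto simp: add_nonneg_eq_0_iff)
  show "reduced B W z \<le> liminf (\<lambda>n. reduced B W (x n))"
    unfolding le_Liminf_iff
  proof (intro allI impI)
    fix a assume a: "a < reduced B W z"
    then obtain r where r: "a = ennreal r" "r \<ge> 0" by (cases a) auto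
    have "ereal r < W z + ereal (B - 2 * growth z)"
      using a r unfolding reduced_def
      by (cases "W z") (auto simp: e2ennreal_ereal ennreal_less_iff e2ennreal_neg)
    then have "ereal (r - (B - 2 * growth z)) < W z"
      by (cases "W z") auto
    then obtain s where s: "r - (B - 2 * growth z) < s" "ereal s < W z"
      using ereal_dense2 by (metis ereal_less_eq(3) ereal_less(2) less_ereal.simps(1))
    have "open {w. ereal s < W w}" using W by (simp add: lower_semicontinuous_def)
    then have 1: "eventually (\<lambda>n. ereal s < W (x n)) sequentially"
      using s x topological_tendstoD[OF x, of "{w. ereal s < W w}"] by simp
    have 2: "eventually (\<lambda>n. B - 2 * growth (x n) > r - s) sequentially"
      using s by (intro order_tendstoD(1)[OF g]) auto
    from 1 2 show "eventually (\<lambda>n. a < reduced B W (x n)) sequentially"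
    proof eventually_elim
      case (elim n)
      then have "ereal r < W (x n) + ereal (B - 2 * growth (x n))"
        by (cases "W (x n)") auto
      then show ?case using r unfolding reduced_def
        by (cases "W (x n)") (auto simp: e2ennreal_ereal ennreal_less_iff ennreal_lessI)
    qed
  qed
qed

text \<open>
  The growth condition controls the potential near infinity, with room to spare because \<open>k > 1\<close>;
  on a disc, semicontinuity and compactness bound it from below.
\<close>

lemma external_potential_growth:
  assumes W: "external_potential k W" and k: "k > 1"
  obtains \<delta> B where "\<delta> > 0" "\<And>z. ereal (2 * (1 + \<delta>) * growth z - B) \<le> W z"
proof -
  have lsc: "\<And>a. open {z. a < W z}" and nb: "\<And>z. W z \<noteq> - \<infinity>"
    and lim: "Liminf at_infinity (\<lambda>z. W z / ereal (2 * ln (cmod z))) \<ge> ereal k"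
    using W by (auto simp: external_potential_def lower_semicontinuous_def)
  define d where "d = (k - 1) / 2"
  have d: "d > 0" "1 + d < k" using k by (auto simp: d_def field_simps)
  have "ereal (1 + d) < Liminf at_infinity (\<lambda>z. W z / ereal (2 * ln (cmod z)))"
    using d lim by (meson ereal_less(2) less_ereal.simps(1) order_less_le_trans)
  then have "eventually (\<lambda>z. ereal (1 + d) < W z / ereal (2 * ln (cmod z))) at_infinity"
    by (rule less_LiminfD)
  then obtain R0 where R0: "\<And>z. R0 \<le> cmod z \<Longrightarrow> ereal (1 + d) < W z / ereal (2 * ln (cmod z))"
    by (auto simp: eventually_at_infinity)
  define R where "R = max R0 2"
  have cov: "cball (0::complex) R \<subseteq> (\<Union>n::nat. {z. ereal (- real n) < W z})"
  proof
    fix z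
    have "\<exists>n::nat. ereal (- real n) < W z"
    proof (cases "W z")
      case (real r)
      obtain n :: nat where "- r < n" using reals_Archimedean2 by blast
      then show ?thesis using real by (intro exI[of _ n]) auto
    qed (use nb in auto)
    then show "z \<in> (\<Union>n::nat. {z. ereal (- real n) < W z})" by auto
  qed
  obtain C' where C': "finite C'" "cball (0::complex) R \<subseteq> (\<Union>n\<in>C'. {z. ereal (- real n) < W z})"
    by (rule compactE_image[OF compact_cball lsc cov]) blast
  define m where "m = real (Max (insert 0 C'))"
  have m: "ereal (- m) \<le> W z" if zR: "cmod z \<le> R" for z
  proof -
    have "z \<in> cball 0 R" using zR by simp
    then obtain n where n: "n \<in> C'" "ereal (- real n) < W z" using C'(2) by blast
    have "n \<le> Max (insert 0 C')" using C'(1) n by (intro Max_ge) auto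
    then have "ereal (- m) \<le> ereal (- real n)" by (simp add: m_def)
    then show ?thesis using n(2) by (meson less_imp_le order.trans)
  qed
  define B where "B = m + 2 * (1 + d) * ln (1 + R) + 2 * (1 + d) * ln 2"
  have m0: "m \<ge> 0" by (simp add: m_def)
  have "ereal (2 * (1 + d) * growth z - B) \<le> W z" for z
  proof (cases "cmod z \<le> R")
    case True
    then have "growth z \<le> ln (1 + R)" unfolding growth_def by (intro ln_mono) (auto simp: add_pos_nonneg)
    then have "2 * (1 + d) * growth z \<le> 2 * (1 + d) * ln (1 + R)" using d by (intro mult_left_mono) auto
    moreover have "0 \<le> 2 * (1 + d) * ln 2" using d by simp
    ultimately have "ereal (2 * (1 + d) * growth z - B) \<le> ereal (- m)" by (simp add: B_def)
    also have "\<dots> \<le> W z" by (rule m[OF True])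
    finally show ?thesis .
  next
    case False
    then have z: "cmod z > 2" "R0 \<le> cmod z" by (auto simp: R_def)
    have l0: "ln (cmod z) > 0" using z by (intro ln_gt_zero) simp
    have "growth z \<le> ln (2 * cmod z)" unfolding growth_def using z by (intro ln_mono) auto
    also have "\<dots> = ln 2 + ln (cmod z)" using z by (intro ln_mult_pos) auto
    finally have "2 * (1 + d) * growth z \<le> 2 * (1 + d) * (ln 2 + ln (cmod z))"
      using d by (intro mult_left_mono) auto
    moreover have "0 \<le> 2 * (1 + d) * ln (1 + R)" using d by (auto simp: R_def)
    ultimately have "2 * (1 + d) * growth z - B \<le> (1 + d) * (2 * ln (cmod z))"
      using m0 by (simp add: B_def algebra_simps)
    moreover have "ereal ((1 + d) * (2 * ln (cmod z))) \<le> W z"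
      using R0[OF z(2)] l0 nb[of z] by (cases "W z") (auto simp: field_simps)
    ultimately show ?thesis by (meson ereal_less_eq(3) order.trans)
  qed
  then show ?thesis using d that by blast
qed

lemma AE_measure_support:
  fixes \<mu> :: "'a::second_countable_topology measure"
  assumes s: "sets \<mu> = sets borel"
  shows "AE z in \<mu>. z \<in> measure_support \<mu>"
proof -
  obtain \<B> :: "'a set set" where B: "countable \<B>" "topological_basis \<B>"
    using ex_countable_basis by blast
  let ?N = "\<Union>U\<in>{U\<in>\<B>. emeasure \<mu> U = 0}. U"
  have op: "U \<in> \<B> \<Longrightarrow> open U" for U using B topological_basis_open by blast
  have "?N \<in> null_sets \<mu>"
    using B(1) op s by (intro null_sets_UN') (auto simp: null_sets_def)
  then show ?thesis
  proof (rule AE_I')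
    show "{z \<in> space \<mu>. z \<notin> measure_support \<mu>} \<subseteq> ?N"
    proof
      fix z assume "z \<in> {z \<in> space \<mu>. z \<notin> measure_support \<mu>}"
      then obtain U where U: "open U" "z \<in> U" "emeasure \<mu> U = 0"
        by (auto simp: measure_support_def zero_less_iff_neq_zero)
      then obtain B' where "B' \<in> \<B>" "z \<in> B'" "B' \<subseteq> U" using topological_basisE[OF B(2)] by metis
      moreover have "emeasure \<mu> B' \<le> emeasure \<mu> U" using \<open>B' \<subseteq> U\<close> U(1) s by (intro emeasure_mono) auto
      ultimately show "z \<in> ?N" using U(3) by auto
    qed
  qed
qed

text \<open>
  The negative part of \<open>f\<close> is dominated by \<open>g\<close>, so only the positive part can have an infinite
  integral and no \<open>\<infinity> - \<infinity>\<close> arises when \<open>g\<close> is subtracted again.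
\<close>

lemma ereal_integral_shift:
  fixes g :: "'a \<Rightarrow> real"
  assumes f[measurable]: "f \<in> borel_measurable M" and g: "integrable M g"
    and nn: "AE x in M. 0 \<le> f x + ereal (g x)"
  shows "ereal_integral M f = enn2ereal (\<integral>\<^sup>+x. e2ennreal (f x + ereal (g x)) \<partial>M) - ereal (\<integral>x. g x \<partial>M)"
proof -
  have [measurable]: "g \<in> borel_measurable M" using g by simp
  let ?A = "\<integral>\<^sup>+x. e2ennreal (f x + ereal (g x)) \<partial>M"
  let ?p = "\<integral>\<^sup>+x. e2ennreal (f x) \<partial>M" and ?n = "\<integral>\<^sup>+x. e2ennreal (- f x) \<partial>M"
  let ?gp = "\<integral>\<^sup>+x. ennreal (g x) \<partial>M" and ?gn = "\<integral>\<^sup>+x. ennreal (- g x) \<partial>M"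
  have pt: "e2ennreal (u + ereal v) + (e2ennreal (- u) + ennreal (- v)) = e2ennreal u + ennreal v
    \<and> e2ennreal (- u) \<le> ennreal v" if "0 \<le> u + ereal v" for u v
    using that
    by (cases u; cases "v \<ge> 0"; cases "real_of_ereal u \<ge> 0")
       (auto simp: e2ennreal_ereal e2ennreal_neg ennreal_neg ennreal_plus[symmetric] simp del: ennreal_plus)
  have eq: "?A + (?n + ?gn) = ?p + ?gp"
  proof -
    have "?A + (?n + ?gn) = (\<integral>\<^sup>+x. e2ennreal (f x + ereal (g x)) + (e2ennreal (- f x) + ennreal (- g x)) \<partial>M)"
      by (simp add: nn_integral_add)
    also have "\<dots> = (\<integral>\<^sup>+x. e2ennreal (f x) + ennreal (g x) \<partial>M)"
      by (intro nn_integral_cong_AE) (use nn pt in \<open>auto elim!: eventually_mono\<close>)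
    also have "\<dots> = ?p + ?gp" by (simp add: nn_integral_add)
    finally show ?thesis .
  qed
  have le: "?n \<le> ?gp"
    by (intro nn_integral_mono_AE) (use nn pt in \<open>auto elim!: eventually_mono\<close>)
  have fin: "?gp < \<infinity>" "?gn < \<infinity>" using g by (auto simp: real_integrable_def top.not_eq_extremum)
  then obtain a b where ab: "?gp = ennreal a" "a \<ge> 0" "?gn = ennreal b" "b \<ge> 0"
    by (metis ennreal_cases infinity_ennreal_def less_irrefl)
  have "?n < \<infinity>" using le fin by simp
  then obtain c where c: "?n = ennreal c" "c \<ge> 0" by (metis ennreal_cases infinity_ennreal_def less_irrefl)
  have ig: "(\<integral>x. g x \<partial>M) = a - b" using g ab by (subst real_lebesgue_integral_def) auto
  show ?thesis
    unfolding ereal_integral_def ig c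
  proof (cases ?A)
    case (real u)
    then obtain v where v: "?p = ennreal v" "v \<ge> 0"
      using eq ab c by (cases ?p) (auto simp: ennreal_plus[symmetric] simp del: ennreal_plus)
    have "u + (c + b) = v + a"
      using eq ab c real v by (simp add: ennreal_plus[symmetric] del: ennreal_plus)
    then show "enn2ereal ?p - enn2ereal (ennreal c) = enn2ereal ?A - ereal (a - b)"
      using ab c real v by (simp add: enn2ereal_ennreal)
  next
    case top
    then have "?p = \<top>" using eq ab by (cases ?p) (auto simp: ennreal_plus[symmetric] simp del: ennreal_plus)
    then show "enn2ereal ?p - enn2ereal (ennreal c) = enn2ereal ?A - ereal (a - b)"
      using top c by (simp add: enn2ereal_ennreal)
  qed
qed

lemma integrable_growth:
  assumes "\<mu> \<in> compact_prob_measures"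
  shows "integrable \<mu> growth"
proof -
  have s: "sets \<mu> = sets borel" and c: "compact (measure_support \<mu>)" and P: "prob_space \<mu>"
    using assms by (auto simp: compact_prob_measures_def)
  interpret prob_space \<mu> by (rule P)
  obtain R where R: "\<And>z. z \<in> measure_support \<mu> \<Longrightarrow> cmod z \<le> R"
    using compact_imp_bounded[OF c] by (auto simp: bounded_iff)
  show ?thesis
  proof (rule integrable_const_bound)
    show "AE z in \<mu>. norm (growth z) \<le> ln (1 + R)"
      using AE_measure_support[OF s]
    proof eventually_elim
      case (elim z)
      then have "growth z \<le> ln (1 + R)"
        using R[OF elim] unfolding growth_def by (intro ln_mono) (auto simp: add_pos_nonneg)
      then show ?case using growth_nonneg by simp
    qed
  qed (use s in \<open>simp cong: measurable_cong_sets\<close>)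
qed

lemma log_energy_eq:
  assumes \<mu>: "\<mu> \<in> compact_prob_measures"
  shows "log_energy \<mu> = enn2ereal (\<integral>\<^sup>+z. \<integral>\<^sup>+w. log_pair z w \<partial>\<mu> \<partial>\<mu>) - ereal (2 * (\<integral>z. growth z \<partial>\<mu>))"
proof -
  have s[measurable_cong]: "sets \<mu> = sets borel" and P: "prob_space \<mu>"
    using \<mu> by (auto simp: compact_prob_measures_def)
  interpret prob_space \<mu> by (rule P)
  interpret pair_prob_space \<mu> \<mu> ..
  note ig = integrable_growth[OF \<mu>]
  have i1: "integrable (\<mu> \<Otimes>\<^sub>M \<mu>) (\<lambda>p. growth (fst p))" "(\<integral>p. growth (fst p) \<partial>(\<mu> \<Otimes>\<^sub>M \<mu>)) = (\<integral>z. growth z \<partial>\<mu>)"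
    using ig prob_space.distr_pair_fst[OF P, of \<mu>] integrable_distr_eq[of fst "\<mu> \<Otimes>\<^sub>M \<mu>" \<mu> growth]
      integral_distr[of fst "\<mu> \<Otimes>\<^sub>M \<mu>" \<mu> growth] by auto
  have i2: "integrable (\<mu> \<Otimes>\<^sub>M \<mu>) (\<lambda>p. growth (snd p))" "(\<integral>p. growth (snd p) \<partial>(\<mu> \<Otimes>\<^sub>M \<mu>)) = (\<integral>z. growth z \<partial>\<mu>)"
    using i1 integrable_product_swap[OF i1(1)] integral_product_swap[of "\<lambda>p. growth (fst p)"]
    by (simp_all add: case_prod_unfold)
  have "log_energy \<mu> = enn2ereal (\<integral>\<^sup>+p. e2ennreal (log_kernel (fst p) (snd p) + ereal (growth (fst p) + growth (snd p))) \<partial>(\<mu> \<Otimes>\<^sub>M \<mu>))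
     - ereal (\<integral>p. growth (fst p) + growth (snd p) \<partial>(\<mu> \<Otimes>\<^sub>M \<mu>))"
    unfolding log_energy_def case_prod_beta using i1 i2
    by (intro ereal_integral_shift AE_I2 log_kernel_growth_nonneg) auto
  also have "(\<integral>p. growth (fst p) + growth (snd p) \<partial>(\<mu> \<Otimes>\<^sub>M \<mu>)) = 2 * (\<integral>z. growth z \<partial>\<mu>)"
    using i1 i2 by simp
  also have "(\<integral>\<^sup>+p. e2ennreal (log_kernel (fst p) (snd p) + ereal (growth (fst p) + growth (snd p))) \<partial>(\<mu> \<Otimes>\<^sub>M \<mu>))
     = (\<integral>\<^sup>+z. \<integral>\<^sup>+w. log_pair z w \<partial>\<mu> \<partial>\<mu>)"
    unfolding log_pair_def[symmetric]
    using sigma_finite_measure.nn_integral_fst[OF prob_space_imp_sigma_finite[OF P], of "\<lambda>p. log_pair (fst p) (snd p)" \<mu>] by simp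
  finally show ?thesis .
qed

lemma weighted_energy_add:
  assumes P: "prob_space \<mu>" and s[measurable_cong]: "sets \<mu> = sets borel" and q[measurable]: "q \<in> borel_measurable borel"
  shows "weighted_energy q \<mu> = (\<integral>\<^sup>+z. \<integral>\<^sup>+w. log_pair z w \<partial>\<mu> \<partial>\<mu>) + (\<integral>\<^sup>+z. q z \<partial>\<mu>)"
proof -
  interpret prob_space \<mu> by (rule P)
  have sp: "space \<mu> = UNIV" using sets_eq_imp_space_eq[OF s] by simp
  have "weighted_energy q \<mu> = (\<integral>\<^sup>+z. (\<integral>\<^sup>+w. log_pair z w \<partial>\<mu>) + q z \<partial>\<mu>)"
    unfolding weighted_energy_def using emeasure_space_1
    by (intro nn_integral_cong) (subst nn_integral_add, auto)
  also have "\<dots> = (\<integral>\<^sup>+z. \<integral>\<^sup>+w. log_pair z w \<partial>\<mu> \<partial>\<mu>) + (\<integral>\<^sup>+z. q z \<partial>\<mu>)"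
    by (intro nn_integral_add) auto
  finally show ?thesis .
qed

lemma energy_eq_weighted_energy:
  assumes \<mu>: "\<mu> \<in> compact_prob_measures" and W: "lower_semicontinuous W"
    and lower: "\<And>z. ereal (2 * growth z - B) \<le> W z"
  shows "energy W \<mu> = enn2ereal (weighted_energy (reduced B W) \<mu>) - ereal B"
proof -
  have s[measurable_cong]: "sets \<mu> = sets borel" and P: "prob_space \<mu>"
    using \<mu> by (auto simp: compact_prob_measures_def)
  interpret prob_space \<mu> by (rule P)
  note ig = integrable_growth[OF \<mu>]
  have [measurable]: "W \<in> borel_measurable borel"
    using W by (rule measurable_lower_semicontinuous)
  have [measurable]: "reduced B W \<in> borel_measurable borel"
    by (rule measurable_lsc[OF lsc_reduced[OF W]])
  have "ereal_integral \<mu> W = enn2ereal (\<integral>\<^sup>+z. reduced B W z \<partial>\<mu>) - ereal (\<integral>z. B - 2 * growth z \<partial>\<mu>)"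
    unfolding reduced_def using ig
  proof (intro ereal_integral_shift AE_I2)
    fix z
    show "0 \<le> W z + ereal (B - 2 * growth z)"
      using lower[of z] by (cases "W z") auto
  qed auto
  also have "(\<integral>z. B - 2 * growth z \<partial>\<mu>) = B - 2 * (\<integral>z. growth z \<partial>\<mu>)"
    using ig by (simp add: prob_space)
  finally have W': "ereal_integral \<mu> W = enn2ereal (\<integral>\<^sup>+z. reduced B W z \<partial>\<mu>) - ereal (B - 2 * (\<integral>z. growth z \<partial>\<mu>))" .
  have "weighted_energy (reduced B W) \<mu> = (\<integral>\<^sup>+z. \<integral>\<^sup>+w. log_pair z w \<partial>\<mu> \<partial>\<mu>) + (\<integral>\<^sup>+z. reduced B W z \<partial>\<mu>)"
    by (rule weighted_energy_add[OF P s]) simp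
  then show ?thesis
    unfolding energy_def W' log_energy_eq[OF \<mu>]
    by (cases "\<integral>\<^sup>+z. \<integral>\<^sup>+w. log_pair z w \<partial>\<mu> \<partial>\<mu>"; cases "\<integral>\<^sup>+z. reduced B W z \<partial>\<mu>")
       (auto simp: ennreal_plus[symmetric] enn2ereal_ennreal simp del: ennreal_plus)
qed

section \<open>Positive definiteness of the logarithmic kernel on the line\<close>

definition mutual_energy :: "real measure \<Rightarrow> real measure \<Rightarrow> ennreal" where
  "mutual_energy \<mu> \<nu> = (\<integral>\<^sup>+x. \<integral>\<^sup>+y. log_pair (of_real x) (of_real y) \<partial>\<nu> \<partial>\<mu>)"

text \<open>
  A kernel that is a superposition of products \<open>\<phi> x * \<phi> y\<close> is positive semidefinite, and the
  quadratic form of a difference of two probability measures is an explicit integral of squares.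
\<close>

lemma gram_kernel_identity:
  fixes \<phi> :: "real \<Rightarrow> 'w \<Rightarrow> ennreal"
  assumes \<kappa>: "sigma_finite_measure \<kappa>" and \<mu>: "real_distribution \<mu>" and \<nu>: "real_distribution \<nu>"
    and m[measurable]: "(\<lambda>p. \<phi> (fst p) (snd p)) \<in> borel_measurable (borel \<Otimes>\<^sub>M \<kappa>)"
    and le1: "\<And>x \<omega>. \<phi> x \<omega> \<le> 1"
  defines "K \<equiv> \<lambda>\<alpha> \<beta>. \<integral>\<^sup>+x. \<integral>\<^sup>+y. \<integral>\<^sup>+\<omega>. \<phi> x \<omega> * \<phi> y \<omega> \<partial>\<kappa> \<partial>\<beta> \<partial>\<alpha>"
  shows "K \<mu> \<mu> + K \<nu> \<nu> = 2 * K \<mu> \<nu> +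
    (\<integral>\<^sup>+\<omega>. ennreal ((enn2real (\<integral>\<^sup>+x. \<phi> x \<omega> \<partial>\<mu>) - enn2real (\<integral>\<^sup>+x. \<phi> x \<omega> \<partial>\<nu>))\<^sup>2) \<partial>\<kappa>)"
proof -
  interpret \<kappa>: sigma_finite_measure \<kappa> by (rule \<kappa>)
  have [measurable]: "(\<lambda>\<omega>. \<phi> x \<omega>) \<in> borel_measurable \<kappa>" for x
    using measurable_compose[OF measurable_Pair1'[of x borel \<kappa>] m] by simp
  have m1: "(\<lambda>p. \<phi> (fst p) (snd p)) \<in> borel_measurable (\<alpha> \<Otimes>\<^sub>M \<kappa>)" if "real_distribution \<alpha>" for \<alpha>
    using m measurable_cong_sets[OF sets_pair_measure_cong[OF real_distribution.events_eq_borel[OF that] refl] refl]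
    by blast
  have m2: "(\<lambda>p. \<phi> (snd p) (fst p)) \<in> borel_measurable (\<kappa> \<Otimes>\<^sub>M \<alpha>)" if "real_distribution \<alpha>" for \<alpha>
    using measurable_compose[OF measurable_pair_swap' m1[OF that]] by (simp add: case_prod_unfold)
  have pm[measurable]: "(\<lambda>\<omega>. \<integral>\<^sup>+x. \<phi> x \<omega> \<partial>\<alpha>) \<in> borel_measurable \<kappa>" if "real_distribution \<alpha>" for \<alpha>
  proof -
    interpret real_distribution \<alpha> by (rule that)
    show ?thesis using borel_measurable_nn_integral_fst[OF m2[OF that]] by simp
  qed
  have K: "K \<alpha> \<beta> = (\<integral>\<^sup>+\<omega>. (\<integral>\<^sup>+x. \<phi> x \<omega> \<partial>\<alpha>) * (\<integral>\<^sup>+x. \<phi> x \<omega> \<partial>\<beta>) \<partial>\<kappa>)"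
    if a: "real_distribution \<alpha>" and b: "real_distribution \<beta>" for \<alpha> \<beta>
  proof -
    interpret A: real_distribution \<alpha> by (rule a)
    interpret B: real_distribution \<beta> by (rule b)
    interpret A\<kappa>: pair_sigma_finite \<alpha> \<kappa> ..
    interpret B\<kappa>: pair_sigma_finite \<beta> \<kappa> ..
    note [measurable] = m1[OF a] m1[OF b] pm[OF a] pm[OF b]
    have [measurable]: "(\<lambda>p. \<phi> x (snd p) * \<phi> (fst p) (snd p)) \<in> borel_measurable (\<beta> \<Otimes>\<^sub>M \<kappa>)" for x
      by measurable
    have [measurable]: "(\<lambda>y. \<phi> y \<omega>) \<in> borel_measurable borel" if "\<omega> \<in> space \<kappa>" for \<omega>
      using measurable_compose[OF _ m, of "\<lambda>x. (x, \<omega>)" borel] that by simp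
    have "K \<alpha> \<beta> = (\<integral>\<^sup>+x. \<integral>\<^sup>+\<omega>. \<integral>\<^sup>+y. \<phi> x \<omega> * \<phi> y \<omega> \<partial>\<beta> \<partial>\<kappa> \<partial>\<alpha>)"
      unfolding K_def
      by (intro nn_integral_cong B\<kappa>.Fubini'[symmetric]) (simp add: case_prod_unfold)
    also have "\<dots> = (\<integral>\<^sup>+x. \<integral>\<^sup>+\<omega>. \<phi> x \<omega> * (\<integral>\<^sup>+y. \<phi> y \<omega> \<partial>\<beta>) \<partial>\<kappa> \<partial>\<alpha>)"
      by (intro nn_integral_cong nn_integral_cmult) simp
    also have "\<dots> = (\<integral>\<^sup>+\<omega>. \<integral>\<^sup>+x. \<phi> x \<omega> * (\<integral>\<^sup>+y. \<phi> y \<omega> \<partial>\<beta>) \<partial>\<alpha> \<partial>\<kappa>)"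
      by (intro A\<kappa>.Fubini'[symmetric]) (simp add: case_prod_unfold)
    also have "\<dots> = (\<integral>\<^sup>+\<omega>. (\<integral>\<^sup>+x. \<phi> x \<omega> \<partial>\<alpha>) * (\<integral>\<^sup>+x. \<phi> x \<omega> \<partial>\<beta>) \<partial>\<kappa>)"
      by (intro nn_integral_cong nn_integral_multc) simp
    finally show ?thesis .
  qed
  have fin: "(\<integral>\<^sup>+x. \<phi> x \<omega> \<partial>\<alpha>) < \<top>" if "real_distribution \<alpha>" for \<alpha> \<omega>
  proof -
    interpret real_distribution \<alpha> by (rule that)
    have "(\<integral>\<^sup>+x. \<phi> x \<omega> \<partial>\<alpha>) \<le> (\<integral>\<^sup>+x. 1 \<partial>\<alpha>)" by (intro nn_integral_mono le1)
    also have "\<dots> = 1" using emeasure_space_1 by simp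
    finally show ?thesis using ennreal_one_less_top le_less_trans by blast
  qed
  have sq: "a * a + b * b = 2 * (a * b) + ennreal ((enn2real a - enn2real b)\<^sup>2)"
    if ab: "a < \<top>" "b < \<top>" for a b :: ennreal
  proof -
    obtain u v where uv: "a = ennreal u" "b = ennreal v" "u \<ge> 0" "v \<ge> 0"
      using ab by (cases a; cases b) auto
    have "a * a + b * b = ennreal (u * u + v * v)"
      using uv by (simp add: ennreal_mult)
    also have "u * u + v * v = 2 * (u * v) + (u - v)\<^sup>2" by (simp add: power2_eq_square algebra_simps)
    also have "ennreal \<dots> = ennreal (2 * (u * v)) + ennreal ((u - v)\<^sup>2)"
      using uv by (intro ennreal_plus) auto
    also have "ennreal (2 * (u * v)) = 2 * (a * b)" using uv by (simp add: ennreal_mult)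
    finally show ?thesis using uv by simp
  qed
  note [measurable] = pm[OF \<mu>] pm[OF \<nu>]
  have "K \<mu> \<mu> + K \<nu> \<nu> = (\<integral>\<^sup>+\<omega>. (\<integral>\<^sup>+x. \<phi> x \<omega> \<partial>\<mu>) * (\<integral>\<^sup>+x. \<phi> x \<omega> \<partial>\<mu>)
      + (\<integral>\<^sup>+x. \<phi> x \<omega> \<partial>\<nu>) * (\<integral>\<^sup>+x. \<phi> x \<omega> \<partial>\<nu>) \<partial>\<kappa>)"
    unfolding K[OF \<mu> \<mu>] K[OF \<nu> \<nu>] by (intro nn_integral_add[symmetric]) auto
  also have "\<dots> = (\<integral>\<^sup>+\<omega>. 2 * ((\<integral>\<^sup>+x. \<phi> x \<omega> \<partial>\<mu>) * (\<integral>\<^sup>+x. \<phi> x \<omega> \<partial>\<nu>))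
      + ennreal ((enn2real (\<integral>\<^sup>+x. \<phi> x \<omega> \<partial>\<mu>) - enn2real (\<integral>\<^sup>+x. \<phi> x \<omega> \<partial>\<nu>))\<^sup>2) \<partial>\<kappa>)"
    by (intro nn_integral_cong sq fin \<mu> \<nu>)
  also have "\<dots> = 2 * K \<mu> \<nu> +
    (\<integral>\<^sup>+\<omega>. ennreal ((enn2real (\<integral>\<^sup>+x. \<phi> x \<omega> \<partial>\<mu>) - enn2real (\<integral>\<^sup>+x. \<phi> x \<omega> \<partial>\<nu>))\<^sup>2) \<partial>\<kappa>)"
    unfolding K[OF \<mu> \<nu>] by (subst nn_integral_add) (auto simp: nn_integral_cmult)
  finally show ?thesis .
qed

lemma tent_kernel:
  fixes x y h :: real
  shows "(\<integral>\<^sup>+t. indicator {t - h..t} x * indicator {t - h..t} y \<partial>lborel) = ennreal (h - \<bar>x - y\<bar>)"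
proof -
  have "(\<integral>\<^sup>+t. indicator {t - h..t} x * indicator {t - h..t} y \<partial>lborel)
      = (\<integral>\<^sup>+t. indicator {max x y..min x y + h} t \<partial>lborel)"
    by (intro nn_integral_cong) (auto simp: indicator_def)
  also have "\<dots> = emeasure lborel {max x y..min x y + h}" by simp
  also have "\<dots> = ennreal (h - \<bar>x - y\<bar>)"
    by (auto simp: emeasure_lborel_Icc_eq max_def min_def ennreal_neg abs_if)
  finally show ?thesis .
qed

text \<open>
  For \<open>r \<le> R\<close> one has \<open>ln (R / r) = \<integral>\<^sub>0\<^sup>R (h - r)\<^sup>+ / h\<^sup>2 dh + (R - r) / R\<close>: the logarithm
  is a superposition of tents.
\<close>

lemma tent_mixture_pos:
  assumes r: "0 < r" "r \<le> R"
  shows "(\<integral>\<^sup>+h. ennreal (1 / h\<^sup>2) * indicator {0<..<R} h * ennreal (h - r) \<partial>lborel) = ennreal (ln (R / r) - 1 + r / R)"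
proof -
  have "(\<integral>\<^sup>+h. ennreal (1 / h\<^sup>2) * indicator {0<..<R} h * ennreal (h - r) \<partial>lborel)
     = (\<integral>\<^sup>+h. ennreal ((h - r) / h\<^sup>2) * indicator {r..R} h \<partial>lborel)"
  proof (rule nn_integral_cong_AE, use AE_lborel_singleton[of R] in eventually_elim)
    fix h assume "h \<noteq> R"
    then show "ennreal (1 / h\<^sup>2) * indicator {0<..<R} h * ennreal (h - r) = ennreal ((h - r) / h\<^sup>2) * indicator {r..R} h"
      using r by (auto simp: indicator_def ennreal_mult[symmetric] ennreal_neg)
  qed
  also have "\<dots> = ennreal ((ln R + r / R) - (ln r + r / r))"
  proof (rule nn_integral_FTC_Icc)
    fix h assume "h \<in> {r..R}"
    then have h: "h > 0" using r by auto
    then show "((\<lambda>h. ln h + r / h) has_real_derivative (h - r) / h\<^sup>2) (at h)"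
      by (auto intro!: derivative_eq_intros simp: field_simps power2_eq_square)
  qed (use r in auto)
  finally show ?thesis using r by (simp add: ln_div algebra_simps)
qed

lemma tent_mixture_zero:
  assumes R: "R > 0"
  shows "(\<integral>\<^sup>+h. ennreal (1 / h\<^sup>2) * indicator {0<..<R} h * ennreal h \<partial>lborel) = \<infinity>"
proof (rule ccontr)
  let ?I = "\<integral>\<^sup>+h. ennreal (1 / h\<^sup>2) * indicator {0<..<R} h * ennreal h \<partial>lborel"
  assume "?I \<noteq> \<infinity>"
  then obtain c where c: "?I = ennreal c" "c \<ge> 0" by (cases ?I) auto
  define r where "r = R / exp (c + 2)"
  have r: "0 < r" "r \<le> R" using R c by (auto simp: r_def divide_le_eq)
  have "ennreal (ln (R / r) - 1 + r / R) \<le> ?I"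
    unfolding tent_mixture_pos[OF r, symmetric] using r
    by (intro nn_integral_mono mult_left_mono ennreal_leI) auto
  moreover have "ln (R / r) = c + 2" using R by (simp add: r_def)
  ultimately have "ennreal (c + 1 + r / R) \<le> ennreal c" using c by (simp add: algebra_simps)
  moreover have "r / R > 0" using r R by simp
  ultimately show False using c by (simp add: ennreal_le_iff)
qed

lemma log_pair_tents:
  fixes x y R :: real
  assumes R: "R \<ge> 1" and xy: "\<bar>x - y\<bar> \<le> R"
  shows "log_pair x y + ennreal (ln R) = ennreal (growth x) + ennreal (growth y) +
    ((\<integral>\<^sup>+h. ennreal (1 / h\<^sup>2) * indicator {0<..<R} h * ennreal (h - \<bar>x - y\<bar>) \<partial>lborel) + ennreal (1 / R) * ennreal (R - \<bar>x - y\<bar>))"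
proof (cases "x = y")
  case True
  then show ?thesis using tent_mixture_zero[of R] R by simp
next
  case False
  define r where "r = \<bar>x - y\<bar>"
  have r: "0 < r" "r \<le> R" using False xy by (auto simp: r_def)
  have "ln r \<le> growth x + growth y"
    using log_kernel_growth_nonneg[of x y] False
    by (simp add: log_kernel_def r_def ln_div cmod_def flip: of_real_diff)
  then have lp: "log_pair x y = ennreal (growth x + growth y - ln r)" "growth x + growth y - ln r \<ge> 0"
    using False by (simp_all add: log_pair_off_diag r_def flip: of_real_diff)
  have nn: "ln (R / r) - 1 + r / R \<ge> 0"
    using r ln_le_minus_one[of "r / R"] by (simp add: ln_div)
  have "log_pair x y + ennreal (ln R) = ennreal (growth x + growth y - ln r + ln R)"
    using lp R by simp
  also have "growth x + growth y - ln r + ln R = growth x + growth y + ((ln (R / r) - 1 + r / R) + (1 / R) * (R - r))"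
    using r by (simp add: ln_div field_simps)
  also have "ennreal \<dots> = ennreal (growth x) + ennreal (growth y) + (ennreal (ln (R / r) - 1 + r / R) + ennreal (1 / R) * ennreal (R - r))"
    using nn r growth_nonneg[of x] growth_nonneg[of y]
    by (simp add: ennreal_mult[symmetric] ennreal_plus[symmetric] del: ennreal_plus)
  also have "ennreal (ln (R / r) - 1 + r / R) = (\<integral>\<^sup>+h. ennreal (1 / h\<^sup>2) * indicator {0<..<R} h * ennreal (h - r) \<partial>lborel)"
    by (rule tent_mixture_pos[OF r, symmetric])
  finally show ?thesis unfolding r_def .
qed

text \<open>
  A window of length \<open>2 M + 1\<close> whose right end is less than \<open>M + 1\<close> reaches beyond \<open>- M\<close>, so its mass
  is the value of the distribution function at that end. Right continuity removes the exceptional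
  null set.
\<close>

lemma real_distribution_eqI_windows:
  assumes \<mu>: "real_distribution \<mu>" and \<nu>: "real_distribution \<nu>"
    and supp: "AE x in \<mu>. \<bar>x\<bar> \<le> M" "AE x in \<nu>. \<bar>x\<bar> \<le> M"
    and win: "AE t in lborel. measure \<mu> {t - (2 * M + 1)..t} = measure \<nu> {t - (2 * M + 1)..t}"
  shows "\<mu> = \<nu>"
proof (rule cdf_unique[OF \<mu> \<nu>], rule ext)
  fix t
  interpret m: real_distribution \<mu> by (rule \<mu>)
  interpret n: real_distribution \<nu> by (rule \<nu>)
  have low: "cdf \<alpha> s = measure \<alpha> {s - (2 * M + 1)..s}"
    if a: "real_distribution \<alpha>" "AE x in \<alpha>. \<bar>x\<bar> \<le> M" and s: "s < M + 1" for \<alpha> s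
  proof -
    interpret a: real_distribution \<alpha> by (rule a)
    show ?thesis unfolding cdf_def
      by (rule a.finite_measure_eq_AE) (use a(2) s in \<open>auto elim!: eventually_mono\<close>)
  qed
  have high: "cdf \<alpha> s = 1" if a: "real_distribution \<alpha>" "AE x in \<alpha>. \<bar>x\<bar> \<le> M" and s: "M \<le> s" for \<alpha> s
  proof -
    interpret a: real_distribution \<alpha> by (rule a)
    show ?thesis unfolding cdf_def
      by (subst a.prob_eq_1) (use a(2) s in \<open>auto elim!: eventually_mono\<close>)
  qed
  show "cdf \<mu> t = cdf \<nu> t"
  proof (cases "M \<le> t")
    case True
    then show ?thesis using high \<mu> \<nu> supp by simp
  next
    case False
    have "\<exists>s. t < s \<and> s < t + inverse (real (Suc k)) \<and> measure \<mu> {s - (2 * M + 1)..s} = measure \<nu> {s - (2 * M + 1)..s}" for k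
    proof (rule ccontr)
      assume neg: "\<not> ?thesis"
      have "AE s in lborel. s \<notin> {t<..<t + inverse (real (Suc k))}"
        using win by eventually_elim (use neg in auto)
      then have "{t<..<t + inverse (real (Suc k))} \<in> null_sets lborel"
        by (subst AE_iff_null_sets) auto
      then show False by (auto simp: null_sets_def)
    qed
    then obtain s where s: "\<And>k. t < s k" "\<And>k. s k < t + inverse (real (Suc k))"
      "\<And>k. measure \<mu> {s k - (2 * M + 1)..s k} = measure \<nu> {s k - (2 * M + 1)..s k}"
      by metis
    have lim: "s \<longlonglongrightarrow> t"
    proof (rule tendsto_sandwich[of "\<lambda>_. t" _ _ "\<lambda>k. t + inverse (real (Suc k))"])
      show "(\<lambda>k. t + inverse (real (Suc k))) \<longlonglongrightarrow> t"
        using tendsto_add[OF tendsto_const LIMSEQ_inverse_real_of_nat, of t] by simp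
    qed (use s in \<open>auto intro!: always_eventually less_imp_le\<close>)
    have at: "filterlim s (at_right t) sequentially"
      using lim s by (intro filterlim_at_withinI) (auto simp: always_eventually)
    have lims: "(\<lambda>k. cdf \<mu> (s k)) \<longlonglongrightarrow> cdf \<mu> t" "(\<lambda>k. cdf \<nu> (s k)) \<longlonglongrightarrow> cdf \<nu> t"
      using m.cdf_is_right_cont[of t] n.cdf_is_right_cont[of t]
      unfolding continuous_within by (auto intro: filterlim_compose[OF _ at])
    have "eventually (\<lambda>k. s k < M + 1) sequentially"
      using False by (intro order_tendstoD(2)[OF lim]) simp
    then have "eventually (\<lambda>k. cdf \<mu> (s k) = cdf \<nu> (s k)) sequentially"
      by eventually_elim (simp add: low \<mu> \<nu> supp s(3))
    from LIMSEQ_unique[OF Lim_transform_eventually[OF lims(1) this] lims(2)] show ?thesis .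
  qed
qed

text \<open>
  The energy of the difference of two measures is an integral of squares, one of which compares
  the masses of all windows of length \<open>2 M + 1\<close>. These determine measures supported in \<open>[-M, M]\<close>.
\<close>

lemma mutual_energy_strict:
  assumes \<mu>: "real_distribution \<mu>" and \<nu>: "real_distribution \<nu>" and M: "M \<ge> 0"
    and supp: "AE x in \<mu>. \<bar>x\<bar> \<le> M" "AE x in \<nu>. \<bar>x\<bar> \<le> M"
    and fin: "mutual_energy \<mu> \<mu> < \<infinity>" "mutual_energy \<nu> \<nu> < \<infinity>"
    and le: "mutual_energy \<mu> \<mu> + mutual_energy \<nu> \<nu> \<le> 2 * mutual_energy \<mu> \<nu>"
  shows "\<mu> = \<nu>"
proof -
  \<comment> \<open>At least the diameter of the supports, so that the representation by tents applies throughout.\<close>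
  define R where "R = 2 * M + 1"
  have R: "R \<ge> 1" using M by (simp add: R_def)
  interpret m: real_distribution \<mu> by (rule \<mu>)
  interpret n: real_distribution \<nu> by (rule \<nu>)
  define \<kappa> where "\<kappa> = density (lborel \<Otimes>\<^sub>M lborel) (\<lambda>p::real\<times>real. ennreal (1 / (fst p)\<^sup>2) * indicator {0<..<R} (fst p))"
  have sk[measurable_cong]: "sets \<kappa> = sets (borel \<Otimes>\<^sub>M borel)" by (simp add: \<kappa>_def)
  have "sigma_finite_measure (lborel \<Otimes>\<^sub>M (lborel :: real measure) :: (real \<times> real) measure)"
    unfolding lborel_prod by (rule sigma_finite_lborel)
  moreover have "(\<lambda>p::real\<times>real. ennreal (1 / (fst p)\<^sup>2) * indicator {0<..<R} (fst p)) \<in> borel_measurable (lborel \<Otimes>\<^sub>M lborel)"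
    by measurable
  moreover have "ennreal (1 / (fst p)\<^sup>2) * indicator {0<..<R} (fst p) \<noteq> \<infinity>" for p :: "real \<times> real"
    by (simp add: indicator_def)
  ultimately have \<kappa>: "sigma_finite_measure \<kappa>"
    unfolding \<kappa>_def by (subst sigma_finite_measure.sigma_finite_iff_density_finite) (auto intro!: AE_I2)
  \<comment> \<open>A pair \<open>(h, t)\<close> stands for the window \<open>[t - h, t]\<close>; the second family consists of the windows of
    length \<open>R\<close>.\<close>
  define \<phi> :: "real \<Rightarrow> real \<times> real \<Rightarrow> ennreal" where "\<phi> x p = indicator {snd p - fst p..snd p} x" for x p
  define \<psi> :: "real \<Rightarrow> real \<Rightarrow> ennreal" where "\<psi> x t = indicator {t - R..t} x" for x t
  have m\<phi>[measurable]: "(\<lambda>p. \<phi> (fst p) (snd p)) \<in> borel_measurable (borel \<Otimes>\<^sub>M \<kappa>)"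
    unfolding \<phi>_def indicator_def atLeastAtMost_iff by measurable
  have m\<psi>[measurable]: "(\<lambda>p. \<psi> (fst p) (snd p)) \<in> borel_measurable (borel \<Otimes>\<^sub>M lborel)"
    unfolding \<psi>_def indicator_def atLeastAtMost_iff by measurable
  have le1: "\<phi> x p \<le> 1" "\<psi> x t \<le> 1" for x p t
    by (simp_all add: \<phi>_def \<psi>_def indicator_def)
  have [measurable]: "(\<lambda>t. indicator {t - h..t} x :: ennreal) \<in> borel_measurable borel" for h x :: real
    unfolding indicator_def atLeastAtMost_iff by measurable
  have A: "(\<integral>\<^sup>+p. \<phi> x p * \<phi> y p \<partial>\<kappa>) = (\<integral>\<^sup>+h. ennreal (1 / h\<^sup>2) * indicator {0<..<R} h * ennreal (h - \<bar>x - y\<bar>) \<partial>lborel)" for x y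
  proof -
    have [measurable]: "(\<lambda>p. \<phi> x p) \<in> borel_measurable (borel \<Otimes>\<^sub>M borel)" for x
      unfolding \<phi>_def indicator_def atLeastAtMost_iff by measurable
    have "(\<integral>\<^sup>+p. \<phi> x p * \<phi> y p \<partial>\<kappa>)
      = (\<integral>\<^sup>+p. ennreal (1 / (fst p)\<^sup>2) * indicator {0<..<R} (fst p) * (\<phi> x p * \<phi> y p) \<partial>(lborel \<Otimes>\<^sub>M lborel))"
      unfolding \<kappa>_def by (subst nn_integral_density) auto
    also have "\<dots> = (\<integral>\<^sup>+h. \<integral>\<^sup>+t. ennreal (1 / h\<^sup>2) * indicator {0<..<R} h * (\<phi> x (h, t) * \<phi> y (h, t)) \<partial>lborel \<partial>lborel)"
      by (subst lborel.nn_integral_fst[symmetric]) auto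
    also have "\<dots> = (\<integral>\<^sup>+h. ennreal (1 / h\<^sup>2) * indicator {0<..<R} h * ennreal (h - \<bar>x - y\<bar>) \<partial>lborel)"
      by (intro nn_integral_cong, subst nn_integral_cmult) (auto simp: tent_kernel \<phi>_def)
    finally show ?thesis .
  qed
  have B: "(\<integral>\<^sup>+t. \<psi> x t * \<psi> y t \<partial>lborel) = ennreal (R - \<bar>x - y\<bar>)" for x y
    unfolding \<psi>_def by (rule tent_kernel)
  define KA where "KA \<alpha> \<beta> = (\<integral>\<^sup>+x. \<integral>\<^sup>+y. \<integral>\<^sup>+p. \<phi> x p * \<phi> y p \<partial>\<kappa> \<partial>\<beta> \<partial>\<alpha>)" for \<alpha> \<beta> :: "real measure"
  define KB where "KB \<alpha> \<beta> = (\<integral>\<^sup>+x. \<integral>\<^sup>+y. \<integral>\<^sup>+t. \<psi> x t * \<psi> y t \<partial>lborel \<partial>\<beta> \<partial>\<alpha>)" for \<alpha> \<beta> :: "real measure"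
  obtain DA where DA: "KA \<mu> \<mu> + KA \<nu> \<nu> = 2 * KA \<mu> \<nu> + DA"
    using gram_kernel_identity[OF \<kappa> \<mu> \<nu> m\<phi> le1(1)] unfolding KA_def by blast
  define DB where "DB = (\<integral>\<^sup>+t. ennreal ((measure \<mu> {t - R..t} - measure \<nu> {t - R..t})\<^sup>2) \<partial>lborel)"
  have DB: "KB \<mu> \<mu> + KB \<nu> \<nu> = 2 * KB \<mu> \<nu> + DB"
  proof -
    have "enn2real (\<integral>\<^sup>+x. \<psi> x t \<partial>\<mu>) = measure \<mu> {t - R..t}" "enn2real (\<integral>\<^sup>+x. \<psi> x t \<partial>\<nu>) = measure \<nu> {t - R..t}" for t
      by (simp_all add: \<psi>_def measure_def)
    then show ?thesis
      using gram_kernel_identity[OF sigma_finite_lborel \<mu> \<nu> m\<psi> le1(2)] by (simp only: KB_def DB_def)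
  qed
  define G where "G \<alpha> = (\<integral>\<^sup>+x. ennreal (growth (of_real x)) \<partial>\<alpha>)" for \<alpha> :: "real measure"
  have G: "G \<alpha> < \<top>" if a: "real_distribution \<alpha>" "AE x in \<alpha>. \<bar>x\<bar> \<le> M" for \<alpha>
  proof -
    interpret a: real_distribution \<alpha> by (rule a)
    have "G \<alpha> \<le> (\<integral>\<^sup>+x. ennreal (ln (1 + M)) \<partial>\<alpha>)"
      unfolding G_def
    proof (rule nn_integral_mono_AE, use a(2) in eventually_elim)
      fix x assume "\<bar>x\<bar> \<le> M"
      then show "ennreal (growth (of_real x)) \<le> ennreal (ln (1 + M))"
        unfolding growth_def by (intro ennreal_leI ln_mono) auto
    qed
    also have "\<dots> < \<top>" using a.emeasure_space_1 by simp
    finally show ?thesis .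
  qed
  have L: "mutual_energy \<alpha> \<beta> + ennreal (ln R) = G \<alpha> + G \<beta> + (KA \<alpha> \<beta> + ennreal (1 / R) * KB \<alpha> \<beta>)"
    if a: "real_distribution \<alpha>" "AE x in \<alpha>. \<bar>x\<bar> \<le> M" and b: "real_distribution \<beta>" "AE x in \<beta>. \<bar>x\<bar> \<le> M" for \<alpha> \<beta>
  proof -
    interpret a: real_distribution \<alpha> by (rule a)
    interpret b: real_distribution \<beta> by (rule b)
    have sa[measurable_cong]: "sets \<alpha> = sets borel" "sets \<beta> = sets borel" by auto
    define tA where "tA x y = (\<integral>\<^sup>+p. \<phi> x p * \<phi> y p \<partial>\<kappa>)" for x y
    define tB where "tB x y = (\<integral>\<^sup>+t. \<psi> x t * \<psi> y t \<partial>lborel)" for x y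
    have mA[measurable]: "(\<lambda>p. tA (fst p) (snd p)) \<in> borel_measurable (borel \<Otimes>\<^sub>M borel)"
    proof -
      interpret sigma_finite_measure \<kappa> by (rule \<kappa>)
      have "(\<lambda>q. \<phi> (fst (fst q)) (snd q) * \<phi> (snd (fst q)) (snd q)) \<in> borel_measurable ((borel \<Otimes>\<^sub>M borel) \<Otimes>\<^sub>M \<kappa>)"
        unfolding \<phi>_def indicator_def atLeastAtMost_iff by measurable
      from borel_measurable_nn_integral_fst[OF this] show ?thesis by (simp add: tA_def)
    qed
    have mB[measurable]: "(\<lambda>p. tB (fst p) (snd p)) \<in> borel_measurable (borel \<Otimes>\<^sub>M borel)"
      unfolding tB_def B by measurable
    have [measurable]: "(\<lambda>y. tA x y) \<in> borel_measurable borel" "(\<lambda>y. tB x y) \<in> borel_measurable borel" for x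
      using measurable_compose[OF _ mA, of "\<lambda>y. (x, y)" borel] measurable_compose[OF _ mB, of "\<lambda>y. (x, y)" borel] by simp_all
    have [measurable]: "(\<lambda>x. \<integral>\<^sup>+y. tA x y \<partial>\<beta>) \<in> borel_measurable borel" "(\<lambda>x. \<integral>\<^sup>+y. tB x y \<partial>\<beta>) \<in> borel_measurable borel"
      using b.borel_measurable_nn_integral_fst[of "\<lambda>p. tA (fst p) (snd p)" borel]
        b.borel_measurable_nn_integral_fst[of "\<lambda>p. tB (fst p) (snd p)" borel] mA mB
        measurable_cong_sets[OF sets_pair_measure_cong[OF refl sa(2)] refl, of borel]
      by auto
    have "mutual_energy \<alpha> \<beta> + ennreal (ln R) = (\<integral>\<^sup>+x. \<integral>\<^sup>+y. log_pair (of_real x) (of_real y) + ennreal (ln R) \<partial>\<beta> \<partial>\<alpha>)"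
      unfolding mutual_energy_def using a.emeasure_space_1 b.emeasure_space_1
      by (simp add: nn_integral_add)
    also have "\<dots> = (\<integral>\<^sup>+x. \<integral>\<^sup>+y. ennreal (growth (of_real x)) + ennreal (growth (of_real y)) + (tA x y + ennreal (1 / R) * tB x y) \<partial>\<beta> \<partial>\<alpha>)"
    proof (rule nn_integral_cong_AE, use a(2) in eventually_elim)
      case (elim x)
      show ?case
      proof (rule nn_integral_cong_AE, use b(2) in eventually_elim)
        fix y :: real assume "\<bar>y\<bar> \<le> M"
        then have "\<bar>x - y\<bar> \<le> R" using elim by (auto simp: R_def)
        then show "log_pair (of_real x) (of_real y) + ennreal (ln R) = ennreal (growth (of_real x)) + ennreal (growth (of_real y)) + (tA x y + ennreal (1 / R) * tB x y)"
          unfolding tA_def tB_def A B by (rule log_pair_tents[OF R])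
      qed
    qed
    also have "\<dots> = G \<alpha> + G \<beta> + (KA \<alpha> \<beta> + ennreal (1 / R) * KB \<alpha> \<beta>)"
      using a.emeasure_space_1 b.emeasure_space_1
      by (simp add: nn_integral_add nn_integral_cmult G_def KA_def KB_def flip: tA_def tB_def)
    finally show ?thesis .
  qed
  have l1: "mutual_energy \<mu> \<mu> + ennreal (ln R) < \<top>" "mutual_energy \<nu> \<nu> + ennreal (ln R) < \<top>"
    using fin by auto
  have K1: "KA \<mu> \<mu> < \<top>" "KA \<nu> \<nu> < \<top>" "KB \<mu> \<mu> < \<top>" "KB \<nu> \<nu> < \<top>"
    using l1 R unfolding L[OF \<mu> supp(1) \<mu> supp(1)] L[OF \<nu> supp(2) \<nu> supp(2)]
    by (auto simp: ennreal_mult_less_top)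
  have K2: "2 * KA \<mu> \<nu> + DA < \<top>" "2 * KB \<mu> \<nu> + DB < \<top>"
    using K1 unfolding DA[symmetric] DB[symmetric] by auto
  obtain lm ln' where l: "mutual_energy \<mu> \<mu> = ennreal lm" "lm \<ge> 0" "mutual_energy \<nu> \<nu> = ennreal ln'" "ln' \<ge> 0"
    using fin by (metis ennreal_cases infinity_ennreal_def less_irrefl)
  obtain gm gn where g: "G \<mu> = ennreal gm" "gm \<ge> 0" "G \<nu> = ennreal gn" "gn \<ge> 0"
    using G[OF \<mu> supp(1)] G[OF \<nu> supp(2)] by (metis ennreal_cases less_irrefl)
  obtain a1 a2 a3 a4 where a: "KA \<mu> \<mu> = ennreal a1" "a1 \<ge> 0" "KA \<nu> \<nu> = ennreal a2" "a2 \<ge> 0"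
     "KA \<mu> \<nu> = ennreal a3" "a3 \<ge> 0" "DA = ennreal a4" "a4 \<ge> 0"
    using K1 K2 by (metis ennreal_cases less_irrefl ennreal_add_less_top ennreal_mult_less_top ennreal_top_mult top_neq_numeral zero_neq_numeral)
  obtain b1 b2 b3 b4 where b: "KB \<mu> \<mu> = ennreal b1" "b1 \<ge> 0" "KB \<nu> \<nu> = ennreal b2" "b2 \<ge> 0"
     "KB \<mu> \<nu> = ennreal b3" "b3 \<ge> 0" "DB = ennreal b4" "b4 \<ge> 0"
    using K1 K2 by (metis ennreal_cases less_irrefl ennreal_add_less_top ennreal_mult_less_top ennreal_top_mult top_neq_numeral zero_neq_numeral)
  have lR: "ln R \<ge> 0" "1 / R \<ge> 0" using R by auto
  note pl = ennreal_plus[symmetric] ennreal_mult[symmetric]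
  have "mutual_energy \<mu> \<nu> + ennreal (ln R) < \<top>"
    unfolding L[OF \<mu> supp(1) \<nu> supp(2)] a b g by (simp add: ennreal_mult_less_top)
  then obtain lmn where lmn: "mutual_energy \<mu> \<nu> = ennreal lmn" "lmn \<ge> 0"
    by (metis ennreal_add_less_top ennreal_cases less_irrefl)
  have numeral: "2 * ennreal u = ennreal (2 * u)" if "u \<ge> 0" for u using that by (simp add: ennreal_mult)
  have e1: "lm + ln R = gm + gm + (a1 + (1 / R) * b1)"
    using L[OF \<mu> supp(1) \<mu> supp(1)] l g a b lR by (simp add: pl del: ennreal_plus)
  have e2: "ln' + ln R = gn + gn + (a2 + (1 / R) * b2)"
    using L[OF \<nu> supp(2) \<nu> supp(2)] l g a b lR by (simp add: pl del: ennreal_plus)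
  have e3: "lmn + ln R = gm + gn + (a3 + (1 / R) * b3)"
    using L[OF \<mu> supp(1) \<nu> supp(2)] lmn g a b lR by (simp add: pl del: ennreal_plus)
  have e4: "a1 + a2 = 2 * a3 + a4" "b1 + b2 = 2 * b3 + b4"
    using DA DB a b by (simp_all add: pl numeral del: ennreal_plus)
  have e5: "lm + ln' \<le> 2 * lmn"
    using le l lmn by (simp add: pl numeral del: ennreal_plus)
  have "(1 / R) * (b1 + b2) + (a1 + a2) \<le> (1 / R) * (2 * b3) + 2 * a3"
  proof -
    have "c * b1 + c * b2 + (a1 + a2) \<le> 2 * (c * b3) + 2 * a3" if "c = 1 / R" for c
      using e1 e2 e3 e5 unfolding that[symmetric] by linarith
    then show ?thesis by (simp add: algebra_simps add_divide_distrib)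
  qed
  then have "(1 / R) * b4 + a4 \<le> 0" unfolding e4 by (simp add: algebra_simps)
  then have "(1 / R) * b4 \<le> 0" using a by simp
  then have "b4 = 0" using b R by (simp add: divide_le_0_iff)
  then have "DB = 0" using b by simp
  then have "AE t in lborel. ennreal ((measure \<mu> {t - R..t} - measure \<nu> {t - R..t})\<^sup>2) = 0"
  proof -
    have "(\<lambda>t. measure \<alpha> {t - R..t}) \<in> borel_measurable borel" if "real_distribution \<alpha>" for \<alpha>
    proof -
      interpret a: real_distribution \<alpha> by (rule that)
      have "(\<lambda>q. \<psi> (snd q) (fst q)) \<in> borel_measurable (borel \<Otimes>\<^sub>M \<alpha>)"
        unfolding \<psi>_def indicator_def atLeastAtMost_iff by measurable
      from a.borel_measurable_nn_integral_fst[OF this]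
      show ?thesis by (simp add: \<psi>_def measure_def)
    qed
    from this[OF \<mu>] this[OF \<nu>] show ?thesis
      using \<open>DB = 0\<close> unfolding DB_def by (subst (asm) nn_integral_0_iff_AE) auto
  qed
  then have "AE t in lborel. measure \<mu> {t - R..t} = measure \<nu> {t - R..t}"
    by eventually_elim (simp add: ennreal_eq_0_iff)
  then show ?thesis
    unfolding R_def by (rule real_distribution_eqI_windows[OF \<mu> \<nu> supp])
qed

section \<open>Compactness on the line\<close>

lemma liminf_add_le:
  fixes a b :: "nat \<Rightarrow> ennreal"
  shows "liminf a + liminf b \<le> liminf (\<lambda>n. a n + b n)"
proof -
  have "liminf a + liminf b = (SUP n. (INF m\<in>{n..}. a m) + (INF m\<in>{n..}. b m))"
    unfolding liminf_SUP_INF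
    by (intro ennreal_SUP_add[symmetric]) (auto simp: incseq_def intro!: INF_superset_mono)
  also have "\<dots> \<le> (SUP n. (INF m\<in>{n..}. a m + b m))"
    by (intro SUP_mono' INF_greatest add_mono INF_lower) auto
  finally show ?thesis unfolding liminf_SUP_INF .
qed

definition line_energy :: "(complex \<Rightarrow> ennreal) \<Rightarrow> real measure \<Rightarrow> ennreal" where
  "line_energy q \<mu> = (\<integral>\<^sup>+x. \<integral>\<^sup>+y. log_pair (of_real x) (of_real y) + q (of_real x) \<partial>\<mu> \<partial>\<mu>)"

definition confining :: "real \<Rightarrow> (complex \<Rightarrow> ennreal) \<Rightarrow> bool" where
  "confining \<delta> q \<longleftrightarrow> \<delta> > 0 \<and> lsc q \<and> (\<forall>z. ennreal (2 * \<delta> * growth z) \<le> q z)"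

lemma confining_measurable: "confining \<delta> q \<Longrightarrow> q \<in> borel_measurable borel"
  by (simp add: confining_def measurable_lsc)

lemma line_energy_add:
  assumes \<mu>: "real_distribution \<mu>" and q[measurable]: "q \<in> borel_measurable borel"
  shows "line_energy q \<mu> = mutual_energy \<mu> \<mu> + (\<integral>\<^sup>+x. q (of_real x) \<partial>\<mu>)"
proof -
  interpret real_distribution \<mu> by (rule \<mu>)
  have "line_energy q \<mu> = (\<integral>\<^sup>+x. (\<integral>\<^sup>+y. log_pair (of_real x) (of_real y) \<partial>\<mu>) + q (of_real x) \<partial>\<mu>)"
    unfolding line_energy_def using emeasure_space_1
    by (intro nn_integral_cong) (subst nn_integral_add, auto)
  also have "\<dots> = mutual_energy \<mu> \<mu> + (\<integral>\<^sup>+x. q (of_real x) \<partial>\<mu>)"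
    unfolding mutual_energy_def by (intro nn_integral_add) auto
  finally show ?thesis .
qed

lemma tight_of_growth:
  assumes \<mu>: "\<And>n. real_distribution (\<mu> n)"
    and bd: "\<And>n. (\<integral>\<^sup>+x. ennreal (growth (of_real x)) \<partial>\<mu> n) \<le> ennreal C"
  shows "tight \<mu>"
  unfolding tight_def
proof (intro conjI allI impI \<mu>)
  fix \<epsilon> :: real assume \<epsilon>: "\<epsilon> > 0"
  define L where "L = \<bar>C\<bar> / \<epsilon> + 1"
  define r where "r = exp L - 1"
  have L: "L > 0" using \<epsilon> by (auto simp: L_def add_nonneg_pos)
  have r: "r > 0" using L by (simp add: r_def)
  have "measure (\<mu> n) {- r<..r} > 1 - \<epsilon>" for n
  proof -
    interpret real_distribution "\<mu> n" by (rule \<mu>)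
    have "emeasure (\<mu> n) {x\<in>UNIV. 1 \<le> ennreal (1 / L) * ennreal (growth (of_real x))}
      \<le> ennreal (1 / L) * (\<integral>\<^sup>+x. ennreal (growth (of_real x)) * indicator UNIV x \<partial>\<mu> n)"
      by (rule nn_integral_Markov_inequality) auto
    also have "\<dots> \<le> ennreal (1 / L) * ennreal C"
      using bd[of n] by (intro mult_left_mono) auto
    also have "\<dots> \<le> ennreal (\<bar>C\<bar> / L)"
      using L by (simp add: ennreal_mult'[symmetric]) (intro ennreal_leI divide_right_mono, auto)
    finally have m: "measure (\<mu> n) {x. 1 \<le> ennreal (1 / L) * ennreal (growth (of_real x))} \<le> \<bar>C\<bar> / L"
      using L by (simp add: emeasure_eq_measure ennreal_le_iff)
    have "- {- r<..r} \<subseteq> {x. 1 \<le> ennreal (1 / L) * ennreal (growth (of_real x))}"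
    proof
      fix x assume "x \<in> - {- r<..r}"
      then have "exp L \<le> 1 + \<bar>x\<bar>" by (auto simp: r_def)
      then have "ln (exp L) \<le> ln (1 + \<bar>x\<bar>)" by (intro ln_mono) auto
      then have "1 \<le> (1 / L) * growth (of_real x)" using L by (simp add: growth_def field_simps)
      then show "x \<in> {x. 1 \<le> ennreal (1 / L) * ennreal (growth (of_real x))}"
        using L growth_nonneg[of "of_real x"]
        by (simp add: ennreal_mult[symmetric] ennreal_1[symmetric] del: ennreal_1)
    qed
    then have "measure (\<mu> n) (- {- r<..r}) \<le> measure (\<mu> n) {x. 1 \<le> ennreal (1 / L) * ennreal (growth (of_real x))}"
      by (intro finite_measure_mono) auto
    with m have "measure (\<mu> n) (- {- r<..r}) \<le> \<bar>C\<bar> / L" by linarith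
    also have "\<bar>C\<bar> / L < \<epsilon>"
      using L \<epsilon> by (simp add: L_def divide_less_eq field_simps)
    finally show ?thesis
      using prob_compl[of "{- r<..r}"] by (simp add: Compl_eq_Diff_UNIV)
  qed
  then show "\<exists>a b. a < b \<and> (\<forall>n. 1 - \<epsilon> < measure (\<mu> n) {a<..b})"
    using r by (intro exI[of _ "- r"] exI[of _ r]) auto
qed

text \<open>
  Skorohod's coupling turns weak convergence into pointwise convergence, after which lower
  semicontinuity of a double integral is Fatou's lemma, applied to each variable.
\<close>

lemma weak_conv_double_liminf:
  fixes G :: "nat \<Rightarrow> real \<Rightarrow> real \<Rightarrow> ennreal"
  assumes \<mu>: "\<And>n. real_distribution (\<mu> n)" and M: "real_distribution M" and wc: "weak_conv_m \<mu> M"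
    and mG: "\<And>n. (\<lambda>p. G n (fst p) (snd p)) \<in> borel_measurable (borel \<Otimes>\<^sub>M borel)"
    and mH: "(\<lambda>p. H (fst p) (snd p)) \<in> borel_measurable (borel \<Otimes>\<^sub>M borel)"
    and low: "\<And>x y u v. x \<longlonglongrightarrow> u \<Longrightarrow> y \<longlonglongrightarrow> v \<Longrightarrow> H u v \<le> liminf (\<lambda>n. G n (x n) (y n))"
  shows "(\<integral>\<^sup>+x. \<integral>\<^sup>+y. H x y \<partial>M \<partial>M) \<le> liminf (\<lambda>n. \<integral>\<^sup>+x. \<integral>\<^sup>+y. G n x y \<partial>\<mu> n \<partial>\<mu> n)"
proof -
  obtain \<Omega> :: "real measure" and Ys Y where \<Omega>: "prob_space \<Omega>"
    and Ys[measurable]: "\<And>n. Ys n \<in> borel_measurable \<Omega>" and dYs: "\<And>n. distr \<Omega> borel (Ys n) = \<mu> n"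
    and Y[measurable]: "Y \<in> borel_measurable \<Omega>" and dY: "distr \<Omega> borel Y = M"
    and lim: "\<And>s. s \<in> space \<Omega> \<Longrightarrow> (\<lambda>n. Ys n s) \<longlonglongrightarrow> Y s"
    using Skorohod[OF \<mu> M wc] by force
  interpret prob_space \<Omega> by (rule \<Omega>)
  have dist: "(\<integral>\<^sup>+x. \<integral>\<^sup>+y. K x y \<partial>distr \<Omega> borel X \<partial>distr \<Omega> borel X) = (\<integral>\<^sup>+s. \<integral>\<^sup>+t. K (X s) (X t) \<partial>\<Omega> \<partial>\<Omega>)"
    if K: "(\<lambda>p. K (fst p) (snd p)) \<in> borel_measurable (borel \<Otimes>\<^sub>M borel)" and X[measurable]: "X \<in> borel_measurable \<Omega>"
    for K :: "real \<Rightarrow> real \<Rightarrow> ennreal" and X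
  proof -
    interpret D: prob_space "distr \<Omega> borel X" by (rule prob_space_distr) simp
    have K1: "(\<lambda>y. K x y) \<in> borel_measurable borel" for x
      using measurable_compose[OF measurable_Pair1'[of x borel borel] K] by simp
    have "(\<lambda>p. K (fst p) (snd p)) \<in> borel_measurable (borel \<Otimes>\<^sub>M distr \<Omega> borel X)"
      using K measurable_cong_sets[OF sets_pair_measure_cong[OF refl sets_distr] refl, of borel \<Omega> borel X] by blast
    from D.borel_measurable_nn_integral_fst[OF this]
    have "(\<lambda>x. \<integral>\<^sup>+y. K x y \<partial>distr \<Omega> borel X) \<in> borel_measurable borel" by simp
    then show ?thesis
      using K1 by (subst nn_integral_distr) (auto intro!: nn_integral_cong nn_integral_distr)
  qed
  have GY: "(\<lambda>p. G n (Ys n (fst p)) (Ys n (snd p))) \<in> borel_measurable (\<Omega> \<Otimes>\<^sub>M \<Omega>)" for n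
    using measurable_compose[OF _ mG[of n], of "\<lambda>p. (Ys n (fst p), Ys n (snd p))" "\<Omega> \<Otimes>\<^sub>M \<Omega>"] by simp
  have GY1: "(\<lambda>t. G n (Ys n s) (Ys n t)) \<in> borel_measurable \<Omega>" if "s \<in> space \<Omega>" for n s
    using measurable_compose[OF measurable_Pair1'[OF that] GY] by simp
  have GY2: "(\<lambda>s. \<integral>\<^sup>+t. G n (Ys n s) (Ys n t) \<partial>\<Omega>) \<in> borel_measurable \<Omega>" for n
    using borel_measurable_nn_integral_fst[OF GY] by simp
  have "(\<integral>\<^sup>+x. \<integral>\<^sup>+y. H x y \<partial>M \<partial>M) = (\<integral>\<^sup>+s. \<integral>\<^sup>+t. H (Y s) (Y t) \<partial>\<Omega> \<partial>\<Omega>)"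
    unfolding dY[symmetric] by (rule dist[OF mH]) simp
  also have "\<dots> \<le> (\<integral>\<^sup>+s. \<integral>\<^sup>+t. liminf (\<lambda>n. G n (Ys n s) (Ys n t)) \<partial>\<Omega> \<partial>\<Omega>)"
    by (intro nn_integral_mono low lim)
  also have "\<dots> \<le> (\<integral>\<^sup>+s. liminf (\<lambda>n. \<integral>\<^sup>+t. G n (Ys n s) (Ys n t) \<partial>\<Omega>) \<partial>\<Omega>)"
    by (intro nn_integral_mono nn_integral_liminf GY1)
  also have "\<dots> \<le> liminf (\<lambda>n. \<integral>\<^sup>+s. \<integral>\<^sup>+t. G n (Ys n s) (Ys n t) \<partial>\<Omega> \<partial>\<Omega>)"
    by (intro nn_integral_liminf GY2)
  also have "\<dots> = liminf (\<lambda>n. \<integral>\<^sup>+x. \<integral>\<^sup>+y. G n x y \<partial>\<mu> n \<partial>\<mu> n)"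
    unfolding dYs[symmetric] by (subst dist[OF mG]) auto
  finally show ?thesis .
qed

text \<open>
  The kernel is truncated so that the statement also applies to discrete measures, whose energy
  is infinite.
\<close>

lemma energy_compactness:
  assumes q: "confining \<delta> q" and \<mu>: "\<And>n. real_distribution (\<mu> n)"
    and gr: "\<And>n. (\<integral>\<^sup>+x. ennreal (growth (of_real x)) \<partial>\<mu> n) \<le> ennreal C"
    and L: "L \<longlonglongrightarrow> \<infinity>" and e: "e \<longlonglongrightarrow> e'"
    and le: "\<And>n. (\<integral>\<^sup>+x. \<integral>\<^sup>+y. min (log_pair (of_real x) (of_real y)) (L n) + q (of_real x) \<partial>\<mu> n \<partial>\<mu> n) \<le> e n"
  obtains r M where "strict_mono (r :: nat \<Rightarrow> nat)" "real_distribution M" "weak_conv_m (\<mu> \<circ> r) M" "line_energy q M \<le> e'"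
proof -
  have [measurable]: "q \<in> borel_measurable borel" using q by (rule confining_measurable)
  have t: "tight \<mu>" by (rule tight_of_growth[OF \<mu> gr])
  obtain r M where r: "strict_mono (r :: nat \<Rightarrow> nat)" and M: "real_distribution M" and wc: "weak_conv_m (\<mu> \<circ> r) M"
    using tight_imp_convergent_subsubsequence[OF t strict_mono_id] by auto
  have "line_energy q M \<le> liminf (\<lambda>n. \<integral>\<^sup>+x. \<integral>\<^sup>+y. min (log_pair (of_real x) (of_real y)) (L (r n)) + q (of_real x) \<partial>(\<mu> \<circ> r) n \<partial>(\<mu> \<circ> r) n)"
    unfolding line_energy_def
  proof (rule weak_conv_double_liminf[OF _ M wc])
    fix x y u v assume x: "x \<longlonglongrightarrow> (u::real)" and y: "y \<longlonglongrightarrow> (v::real)"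
    have "(\<lambda>n. min (log_pair (of_real (x n)) (of_real (y n))) (L (r n))) \<longlonglongrightarrow> min (log_pair (of_real u) (of_real v)) \<infinity>"
      using LIMSEQ_subseq_LIMSEQ[OF L r] by (intro tendsto_min log_pair_tendsto tendsto_of_real x y) (simp add: comp_def)
    then have "log_pair (of_real u) (of_real v) = liminf (\<lambda>n. min (log_pair (of_real (x n)) (of_real (y n))) (L (r n)))"
      by (subst lim_imp_Liminf) (auto simp: min_def)
    moreover have "q (of_real u) \<le> liminf (\<lambda>n. q (of_real (x n)))"
      using q tendsto_of_real[OF x, where 'a=complex] by (auto simp: confining_def lsc_def)
    ultimately have "log_pair (of_real u) (of_real v) + q (of_real u)
      \<le> liminf (\<lambda>n. min (log_pair (of_real (x n)) (of_real (y n))) (L (r n))) + liminf (\<lambda>n. q (of_real (x n)))"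
      by (intro add_mono) auto
    also have "\<dots> \<le> liminf (\<lambda>n. min (log_pair (of_real (x n)) (of_real (y n))) (L (r n)) + q (of_real (x n)))"
      by (rule liminf_add_le)
    finally show "log_pair (of_real u) (of_real v) + q (of_real u)
      \<le> liminf (\<lambda>n. min (log_pair (of_real (x n)) (of_real (y n))) (L (r n)) + q (of_real (x n)))" .
  qed (use \<mu> in auto)
  also have "\<dots> \<le> liminf (\<lambda>n. e (r n))"
    by (intro Liminf_mono always_eventually allI) (use le in simp)
  also have "\<dots> = e'"
    using LIMSEQ_subseq_LIMSEQ[OF e r] by (intro lim_imp_Liminf) (auto simp: comp_def)
  finally show ?thesis using that r M wc by blast
qed

lemma growth_le_line_energy:
  assumes q: "confining \<delta> q" and \<mu>: "real_distribution \<mu>" and le: "line_energy q \<mu> \<le> ennreal c"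
  shows "(\<integral>\<^sup>+x. ennreal (growth (of_real x)) \<partial>\<mu>) \<le> ennreal (c / (2 * \<delta>))"
proof -
  interpret real_distribution \<mu> by (rule \<mu>)
  have [measurable]: "q \<in> borel_measurable borel" using q by (rule confining_measurable)
  have d: "\<delta> > 0" using q by (simp add: confining_def)
  have "(\<integral>\<^sup>+x. ennreal (growth (of_real x)) \<partial>\<mu>) \<le> (\<integral>\<^sup>+x. ennreal (1 / (2 * \<delta>)) * q (of_real x) \<partial>\<mu>)"
  proof (rule nn_integral_mono)
    fix x :: real
    have "ennreal (1 / (2 * \<delta>)) * ennreal (2 * \<delta> * growth (of_real x)) \<le> ennreal (1 / (2 * \<delta>)) * q (of_real x)"
      using q by (intro mult_left_mono) (auto simp: confining_def)
    then show "ennreal (growth (of_real x)) \<le> ennreal (1 / (2 * \<delta>)) * q (of_real x)"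
      using d growth_nonneg[of "of_real x"] by (simp add: ennreal_mult[symmetric])
  qed
  also have "\<dots> = ennreal (1 / (2 * \<delta>)) * (\<integral>\<^sup>+x. q (of_real x) \<partial>\<mu>)"
    by (rule nn_integral_cmult) simp
  also have "\<dots> \<le> ennreal (1 / (2 * \<delta>)) * ennreal c"
    using le unfolding line_energy_add[OF \<mu> \<open>q \<in> borel_measurable borel\<close>]
    by (intro mult_left_mono) (auto intro: order.trans[rotated])
  also have "\<dots> = ennreal (c / (2 * \<delta>))"
    using d by (simp add: ennreal_mult'[symmetric])
  finally show ?thesis .
qed

section \<open>Existence and uniqueness of the equilibrium measure on the line\<close>

lemma line_minimizer_exists:
  assumes q: "confining \<delta> q" and \<nu>: "real_distribution \<nu>" "line_energy q \<nu> < \<infinity>"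
  obtains \<sigma> where "real_distribution \<sigma>" "\<And>\<mu>. real_distribution \<mu> \<Longrightarrow> line_energy q \<sigma> \<le> line_energy q \<mu>"
proof -
  have [measurable]: "q \<in> borel_measurable borel" using q by (rule confining_measurable)
  define I where "I = (INF \<mu>\<in>{\<mu>. real_distribution \<mu>}. line_energy q \<mu>)"
  have "I \<le> line_energy q \<nu>" unfolding I_def using \<nu> by (intro INF_lower) simp
  then obtain c where c: "I = ennreal c" "c \<ge> 0" using \<nu>(2) by (cases I) auto
  have "\<exists>\<mu>. real_distribution \<mu> \<and> line_energy q \<mu> < ennreal (c + 1 / real (Suc n))" for n
  proof -
    have "I < ennreal (c + 1 / real (Suc n))" using c by (simp add: ennreal_less_iff)
    then show ?thesis unfolding I_def by (auto simp: INF_less_iff)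
  qed
  then obtain \<mu> where \<mu>: "\<And>n. real_distribution (\<mu> n)" "\<And>n. line_energy q (\<mu> n) < ennreal (c + 1 / real (Suc n))"
    by metis
  have gr: "(\<integral>\<^sup>+x. ennreal (growth (of_real x)) \<partial>\<mu> n) \<le> ennreal ((c + 1) / (2 * \<delta>))" for n
  proof (rule growth_le_line_energy[OF q \<mu>(1)])
    have "line_energy q (\<mu> n) \<le> ennreal (c + 1 / real (Suc n))" using \<mu>(2)[of n] by simp
    also have "\<dots> \<le> ennreal (c + 1)" by (intro ennreal_leI) (simp add: divide_le_eq)
    finally show "line_energy q (\<mu> n) \<le> ennreal (c + 1)" .
  qed
  have L: "(\<lambda>n. \<infinity>::ennreal) \<longlonglongrightarrow> \<infinity>" by simp
  have e: "(\<lambda>n. ennreal (c + 1 / real (Suc n))) \<longlonglongrightarrow> ennreal (c + 0)"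
    by (intro tendsto_ennrealI tendsto_intros LIMSEQ_inverse_real_of_nat[unfolded inverse_eq_divide])
  have le: "(\<integral>\<^sup>+x. \<integral>\<^sup>+y. min (log_pair (of_real x) (of_real y)) \<infinity> + q (of_real x) \<partial>\<mu> n \<partial>\<mu> n) \<le> ennreal (c + 1 / real (Suc n))" for n
    using \<mu>(2)[of n] by (simp add: line_energy_def min_def)
  obtain r M where "strict_mono (r :: nat \<Rightarrow> nat)" "real_distribution M" "line_energy q M \<le> ennreal (c + 0)"
    using energy_compactness[OF q \<mu>(1) gr L e le] by blast
  moreover have "ennreal (c + 0) \<le> line_energy q \<mu>'" if "real_distribution \<mu>'" for \<mu>'
    using that c unfolding I_def by (metis INF_lower add.right_neutral mem_Collect_eq)
  ultimately show ?thesis using that order.trans by meson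
qed

text \<open>
  Far away the potential exceeds twice the minimal energy, so that conditioning a minimizer on a
  large interval would decrease its energy, were there any mass outside.
\<close>

lemma line_minimizer_compact_support:
  assumes q: "confining \<delta> q" and \<sigma>: "real_distribution \<sigma>" and fin: "line_energy q \<sigma> < \<infinity>"
    and min: "\<And>\<mu>. real_distribution \<mu> \<Longrightarrow> line_energy q \<sigma> \<le> line_energy q \<mu>"
  obtains M where "M \<ge> 0" "AE x in \<sigma>. \<bar>x\<bar> \<le> M"
proof -
  interpret real_distribution \<sigma> by (rule \<sigma>)
  have qm[measurable]: "q \<in> borel_measurable borel" using q by (rule confining_measurable)
  have d: "\<delta> > 0" using q by (simp add: confining_def)
  obtain \<gamma> where \<gamma>: "line_energy q \<sigma> = ennreal \<gamma>" "\<gamma> \<ge> 0" using fin by (cases "line_energy q \<sigma>") auto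
  \<comment> \<open>A mass \<open>1 - p\<close> outside contributes at most \<open>\<gamma> (1 - p\<^sup>2) \<le> 2 \<gamma> (1 - p)\<close> to the energy, since the
    rest, when normalized, has energy at least \<open>\<gamma>\<close>.\<close>
  define K where "K = 2 * \<gamma> + 1"
  define M where "M = exp (K / (2 * \<delta>))"
  define A where "A = {x::real. \<bar>x\<bar> \<le> M}"
  have A[measurable]: "A \<in> sets borel" unfolding A_def by measurable
  define p where "p = measure \<sigma> A"
  have far: "ennreal K \<le> q (of_real x)" if "x \<notin> A" for x
  proof -
    have "exp (K / (2 * \<delta>)) \<le> 1 + \<bar>x\<bar>" using that by (simp add: A_def M_def)
    then have "ln (exp (K / (2 * \<delta>))) \<le> ln (1 + \<bar>x\<bar>)" by (intro ln_mono) auto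
    then have "K \<le> 2 * \<delta> * growth (of_real x)" using d by (simp add: growth_def field_simps)
    then have "ennreal K \<le> ennreal (2 * \<delta> * growth (of_real x))" by (rule ennreal_leI)
    also have "\<dots> \<le> q (of_real x)" using q by (auto simp: confining_def)
    finally show ?thesis .
  qed
  let ?k = "\<lambda>x y. log_pair (complex_of_real x) (complex_of_real y)"
  define a where "a = (\<integral>\<^sup>+x. (\<integral>\<^sup>+y. ?k x y * indicator A y \<partial>\<sigma>) * indicator A x \<partial>\<sigma>)"
  define b where "b = (\<integral>\<^sup>+x. q (of_real x) * indicator A x \<partial>\<sigma>)"
  have low: "a + b + ennreal (K * (1 - p)) \<le> ennreal \<gamma>"
  proof -
    have "a \<le> mutual_energy \<sigma> \<sigma>"
      unfolding a_def mutual_energy_def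
    proof (rule nn_integral_mono)
      fix x
      have "(\<integral>\<^sup>+y. ?k x y * indicator A y \<partial>\<sigma>) * indicator A x \<le> (\<integral>\<^sup>+y. ?k x y * indicator A y \<partial>\<sigma>)"
        by (simp add: indicator_def)
      also have "\<dots> \<le> (\<integral>\<^sup>+y. ?k x y \<partial>\<sigma>)" by (intro nn_integral_mono) (simp add: indicator_def)
      finally show "(\<integral>\<^sup>+y. ?k x y * indicator A y \<partial>\<sigma>) * indicator A x \<le> (\<integral>\<^sup>+y. ?k x y \<partial>\<sigma>)" .
    qed
    moreover have "b + ennreal (K * (1 - p)) \<le> (\<integral>\<^sup>+x. q (of_real x) \<partial>\<sigma>)"
    proof -
      have "ennreal (K * (1 - p)) = (\<integral>\<^sup>+x. ennreal K * indicator (- A) x \<partial>\<sigma>)"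
        using prob_compl[of A] \<gamma>(2)
        by (simp add: nn_integral_cmult_indicator emeasure_eq_measure p_def ennreal_mult K_def Compl_eq_Diff_UNIV)
      then have "b + ennreal (K * (1 - p)) = (\<integral>\<^sup>+x. q (of_real x) * indicator A x + ennreal K * indicator (- A) x \<partial>\<sigma>)"
        unfolding b_def by (simp add: nn_integral_add)
      also have "\<dots> \<le> (\<integral>\<^sup>+x. q (of_real x) \<partial>\<sigma>)"
        by (intro nn_integral_mono) (auto simp: indicator_def far)
      finally show ?thesis .
    qed
    ultimately have "a + (b + ennreal (K * (1 - p))) \<le> ennreal \<gamma>"
      unfolding \<gamma>(1)[symmetric] line_energy_add[OF \<sigma> qm] by (rule add_mono)
    then show ?thesis by (simp add: add.assoc)
  qed
  have p1: "0 \<le> p" "p \<le> 1" by (auto simp: p_def)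
  obtain a' b' where ab: "a = ennreal a'" "a' \<ge> 0" "b = ennreal b'" "b' \<ge> 0"
    using low by (cases a; cases b) (auto simp: top_unique)
  have low': "a' + b' + K * (1 - p) \<le> \<gamma>"
    using low ab p1 \<gamma>(2) by (simp add: K_def ennreal_plus[symmetric] del: ennreal_plus)
  have "p = 1"
  proof (rule ccontr)
    assume np: "p \<noteq> 1"
    have "p \<noteq> 0" using low' ab \<gamma>(2) by (auto simp: K_def)
    then have pp: "p > 0" using p1 by simp
    define \<tau> where "\<tau> = uniform_measure \<sigma> A"
    have eA: "emeasure \<sigma> A = ennreal p" by (simp add: p_def emeasure_eq_measure)
    have "real_distribution \<tau>"
      unfolding \<tau>_def real_distribution_def real_distribution_axioms_def
      using pp eA by (auto intro!: prob_space_uniform_measure)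
    then have "ennreal \<gamma> \<le> line_energy q \<tau>" using min \<gamma> by metis
    also have "line_energy q \<tau> = mutual_energy \<tau> \<tau> + (\<integral>\<^sup>+x. q (of_real x) \<partial>\<tau>)"
      by (rule line_energy_add[OF \<open>real_distribution \<tau>\<close> qm])
    also have "(\<integral>\<^sup>+x. q (of_real x) \<partial>\<tau>) = b / ennreal p"
      unfolding \<tau>_def b_def by (subst nn_integral_uniform_measure) (auto simp: eA)
    also have "mutual_energy \<tau> \<tau> = a / ennreal p / ennreal p"
    proof -
      have "mutual_energy \<tau> \<tau> = (\<integral>\<^sup>+x. (\<integral>\<^sup>+y. ?k x y * indicator A y \<partial>\<sigma>) / ennreal p \<partial>\<tau>)"
        unfolding mutual_energy_def \<tau>_def by (subst nn_integral_uniform_measure) (auto simp: eA)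
      also have "\<dots> = (\<integral>\<^sup>+x. (\<integral>\<^sup>+y. ?k x y * indicator A y \<partial>\<sigma>) / ennreal p * indicator A x \<partial>\<sigma>) / ennreal p"
        unfolding \<tau>_def by (subst nn_integral_uniform_measure) (auto simp: eA)
      also have "(\<integral>\<^sup>+x. (\<integral>\<^sup>+y. ?k x y * indicator A y \<partial>\<sigma>) / ennreal p * indicator A x \<partial>\<sigma>) = a / ennreal p"
        unfolding a_def by (subst nn_integral_divide[symmetric]) (auto intro!: nn_integral_cong simp: indicator_def)
      finally show ?thesis .
    qed
    also have "a / ennreal p / ennreal p + b / ennreal p = ennreal (a' / p / p + b' / p)"
      using ab pp by (simp add: divide_ennreal)
    finally have "\<gamma> \<le> a' / p / p + b' / p" using ab pp by (simp add: ennreal_plus[symmetric] del: ennreal_plus)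
    then have "\<gamma> * p * p \<le> a' + b' * p" using pp by (simp add: field_simps)
    also have "\<dots> \<le> a' + b'" using ab p1 by (simp add: mult_left_le)
    finally have "\<gamma> * p * p + K * (1 - p) \<le> \<gamma>" using low' by linarith
    then have "K * (1 - p) \<le> \<gamma> * (1 + p) * (1 - p)" by (simp add: algebra_simps)
    then have "K \<le> \<gamma> * (1 + p)" using np p1 by (simp add: mult_le_cancel_right)
    also have "\<dots> \<le> \<gamma> * 2" using p1 \<gamma>(2) by (intro mult_left_mono) auto
    finally show False by (simp add: K_def)
  qed
  then have "AE x in \<sigma>. x \<in> A" unfolding p_def by (subst (asm) prob_eq_1) auto
  then show ?thesis using that[of M] by (simp add: A_def M_def)
qed

text \<open>
  The midpoint of two minimizers has at least their energy. As the potential enters linearly, this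
  is a reverse of the inequality expressing positive definiteness.
\<close>

lemma line_minimizer_unique:
  assumes q: "confining \<delta> q"
    and s: "real_distribution \<sigma>" "line_energy q \<sigma> < \<infinity>" "\<And>\<mu>. real_distribution \<mu> \<Longrightarrow> line_energy q \<sigma> \<le> line_energy q \<mu>"
    and t: "real_distribution \<tau>" "line_energy q \<tau> \<le> line_energy q \<sigma>"
  shows "\<sigma> = \<tau>"
proof -
  interpret S: real_distribution \<sigma> by (rule s)
  interpret T: real_distribution \<tau> by (rule t)
  have qm[measurable]: "q \<in> borel_measurable borel" using q by (rule confining_measurable)
  have tmin: "line_energy q \<tau> \<le> line_energy q \<mu>" if "real_distribution \<mu>" for \<mu>
    using t(2) s(3)[OF that] by (rule order.trans)
  have tfin: "line_energy q \<tau> < \<infinity>" using t(2) s(2) by (rule le_less_trans)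
  obtain M1 where M1: "M1 \<ge> 0" "AE x in \<sigma>. \<bar>x\<bar> \<le> M1"
    using line_minimizer_compact_support[OF q s] by blast
  obtain M2 where M2: "M2 \<ge> 0" "AE x in \<tau>. \<bar>x\<bar> \<le> M2"
    using line_minimizer_compact_support[OF q t(1) tfin tmin] by blast
  define N where "N b = (if b then \<sigma> else \<tau>)" for b
  define \<omega> where "\<omega> = measure_pmf (bernoulli_pmf (1/2)) \<bind> N"
  have N: "N \<in> measurable (measure_pmf (bernoulli_pmf (1/2))) (subprob_algebra borel)"
    by (auto simp: N_def space_subprob_algebra S.subprob_space_axioms T.subprob_space_axioms)
  have so: "sets \<omega> = sets borel"
    unfolding \<omega>_def by (rule sets_bind) (auto simp: N_def)
  have "prob_space \<omega>"
    unfolding \<omega>_def by (rule measure_pmf.prob_space_bind[OF _ N]) (auto simp: N_def S.prob_space_axioms T.prob_space_axioms)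
  then have \<omega>: "real_distribution \<omega>"
    using so by (simp add: real_distribution_def real_distribution_axioms_def)
  have int: "(\<integral>\<^sup>+x. f x \<partial>\<omega>) = ((\<integral>\<^sup>+x. f x \<partial>\<sigma>) + (\<integral>\<^sup>+x. f x \<partial>\<tau>)) / 2"
    if "f \<in> borel_measurable borel" for f
    unfolding \<omega>_def using that
    by (subst nn_integral_bind[OF _ N]) (auto simp: N_def divide_ennreal_def distrib_right inverse_ennreal[symmetric])
  let ?k = "\<lambda>x y. log_pair (complex_of_real x) (complex_of_real y)"
  interpret ST: pair_sigma_finite \<sigma> \<tau> ..
  have sym: "mutual_energy \<tau> \<sigma> = mutual_energy \<sigma> \<tau>"
  proof -
    have "mutual_energy \<sigma> \<tau> = (\<integral>\<^sup>+y. \<integral>\<^sup>+x. ?k x y \<partial>\<sigma> \<partial>\<tau>)"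
      unfolding mutual_energy_def by (intro ST.Fubini'[symmetric]) (simp add: case_prod_unfold)
    then show ?thesis unfolding mutual_energy_def by (subst log_pair_commute) simp
  qed
  have g[measurable]: "(\<lambda>x. \<integral>\<^sup>+y. ?k x y \<partial>\<sigma>) \<in> borel_measurable borel" "(\<lambda>x. \<integral>\<^sup>+y. ?k x y \<partial>\<tau>) \<in> borel_measurable borel"
    by measurable
  have mm: "mutual_energy \<omega> \<omega> = ((mutual_energy \<sigma> \<sigma> + mutual_energy \<sigma> \<tau>) / 2 + (mutual_energy \<sigma> \<tau> + mutual_energy \<tau> \<tau>) / 2) / 2"
  proof -
    have "mutual_energy \<omega> \<omega> = (\<integral>\<^sup>+x. ((\<integral>\<^sup>+y. ?k x y \<partial>\<sigma>) + (\<integral>\<^sup>+y. ?k x y \<partial>\<tau>)) / 2 \<partial>\<omega>)"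
      unfolding mutual_energy_def by (intro nn_integral_cong int) measurable
    also have "\<dots> = ((\<integral>\<^sup>+x. ((\<integral>\<^sup>+y. ?k x y \<partial>\<sigma>) + (\<integral>\<^sup>+y. ?k x y \<partial>\<tau>)) / 2 \<partial>\<sigma>)
        + (\<integral>\<^sup>+x. ((\<integral>\<^sup>+y. ?k x y \<partial>\<sigma>) + (\<integral>\<^sup>+y. ?k x y \<partial>\<tau>)) / 2 \<partial>\<tau>)) / 2"
      by (rule int) measurable
    also have "\<dots> = ((mutual_energy \<sigma> \<sigma> + mutual_energy \<sigma> \<tau>) / 2 + (mutual_energy \<tau> \<sigma> + mutual_energy \<tau> \<tau>) / 2) / 2"
      unfolding mutual_energy_def by (simp add: nn_integral_divide nn_integral_add)
    finally show ?thesis unfolding sym .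
  qed
  have "line_energy q \<omega> = mutual_energy \<omega> \<omega> + ((\<integral>\<^sup>+x. q (of_real x) \<partial>\<sigma>) + (\<integral>\<^sup>+x. q (of_real x) \<partial>\<tau>)) / 2"
    unfolding line_energy_add[OF \<omega> qm] by (subst int) auto
  then have le: "line_energy q \<sigma> \<le> mutual_energy \<omega> \<omega> + ((\<integral>\<^sup>+x. q (of_real x) \<partial>\<sigma>) + (\<integral>\<^sup>+x. q (of_real x) \<partial>\<tau>)) / 2"
    "line_energy q \<tau> \<le> mutual_energy \<omega> \<omega> + ((\<integral>\<^sup>+x. q (of_real x) \<partial>\<sigma>) + (\<integral>\<^sup>+x. q (of_real x) \<partial>\<tau>)) / 2"
    using s(3)[OF \<omega>] tmin[OF \<omega>] by auto
  have fin: "mutual_energy \<sigma> \<sigma> < \<infinity>" "(\<integral>\<^sup>+x. q (of_real x) \<partial>\<sigma>) < \<infinity>" "mutual_energy \<tau> \<tau> < \<infinity>" "(\<integral>\<^sup>+x. q (of_real x) \<partial>\<tau>) < \<infinity>"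
    using s(2) tfin unfolding line_energy_add[OF s(1) qm] line_energy_add[OF t(1) qm] by auto
  have "mutual_energy \<sigma> \<sigma> + mutual_energy \<tau> \<tau> \<le> 2 * mutual_energy \<sigma> \<tau>"
  proof (cases "mutual_energy \<sigma> \<tau>")
    case (real c)
    obtain a a' b b' where ab: "mutual_energy \<sigma> \<sigma> = ennreal a" "a \<ge> 0" "(\<integral>\<^sup>+x. q (of_real x) \<partial>\<sigma>) = ennreal b" "b \<ge> 0"
      "mutual_energy \<tau> \<tau> = ennreal a'" "a' \<ge> 0" "(\<integral>\<^sup>+x. q (of_real x) \<partial>\<tau>) = ennreal b'" "b' \<ge> 0"
      using fin unfolding infinity_ennreal_def less_top_ennreal by blast
    have half: "ennreal u / 2 = ennreal (u / 2)" if "u \<ge> 0" for u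
      using that divide_ennreal[of u 2] by simp
    have "a + b \<le> ((a + c) / 2 + (c + a') / 2) / 2 + (b + b') / 2"
      using le(1) ab real unfolding mm line_energy_add[OF s(1) qm]
      by (simp add: half ennreal_plus[symmetric] del: ennreal_plus)
    moreover have "a' + b' \<le> ((a + c) / 2 + (c + a') / 2) / 2 + (b + b') / 2"
      using le(2) ab real unfolding mm line_energy_add[OF t(1) qm]
      by (simp add: half ennreal_plus[symmetric] del: ennreal_plus)
    ultimately have "a + a' \<le> 2 * c" by (simp add: field_simps)
    then have "ennreal (a + a') \<le> ennreal (2 * c)" by (rule ennreal_leI)
    then show ?thesis using ab real by (simp add: ennreal_mult)
  qed (simp add: ennreal_mult_top)
  moreover have "AE x in \<sigma>. \<bar>x\<bar> \<le> max M1 M2" "AE x in \<tau>. \<bar>x\<bar> \<le> max M1 M2"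
    using M1(2) M2(2) by (auto elim!: eventually_mono)
  ultimately show ?thesis
    using fin M1(1) by (intro mutual_energy_strict[OF s(1) t(1), of "max M1 M2"]) auto
qed

section \<open>The equilibrium measure of a potential carried by the line\<close>

lemma confining_reduced:
  assumes "\<delta> > 0" "lower_semicontinuous W" and lower: "\<And>z. ereal (2 * (1 + \<delta>) * growth z - B) \<le> W z"
  shows "confining \<delta> (reduced B W)"
  unfolding confining_def
proof (intro conjI allI)
  fix z
  have "ereal (2 * \<delta> * growth z) \<le> W z + ereal (B - 2 * growth z)"
    using lower[of z] by (cases "W z") (auto simp: algebra_simps)
  then have "e2ennreal (ereal (2 * \<delta> * growth z)) \<le> reduced B W z"
    unfolding reduced_def by (rule e2ennreal_mono)
  then show "ennreal (2 * \<delta> * growth z) \<le> reduced B W z" by (simp add: e2ennreal_ereal)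
qed (use assms lsc_reduced in auto)

lemma measure_support_subset_closed:
  assumes "closed C" and ae: "AE z in \<mu>. z \<in> C" and s: "sets \<mu> = sets borel"
  shows "measure_support \<mu> \<subseteq> C"
proof
  fix z assume z: "z \<in> measure_support \<mu>"
  show "z \<in> C"
  proof (rule ccontr)
    assume "z \<notin> C"
    then have "emeasure \<mu> (- C) > 0" using z \<open>closed C\<close> by (auto simp: measure_support_def)
    moreover have "emeasure \<mu> (- C) = 0"
      using ae \<open>closed C\<close> s AE_iff_null_sets[of "- C" \<mu>] by (auto simp: null_sets_def)
    ultimately show False by simp
  qed
qed

lemma closed_measure_support: "closed (measure_support \<mu>)"
proof -
  have "- measure_support \<mu> = \<Union>{U. open U \<and> \<not> emeasure \<mu> U > 0}"
    by (auto simp: measure_support_def)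
  then show ?thesis unfolding closed_def by (metis (no_types, lifting) mem_Collect_eq open_Union)
qed

lemma embed_compact_prob:
  assumes \<nu>: "real_distribution \<nu>" and M: "AE x in \<nu>. \<bar>x\<bar> \<le> M"
  shows "distr \<nu> borel complex_of_real \<in> compact_prob_measures"
proof -
  interpret real_distribution \<nu> by (rule \<nu>)
  have "AE z in distr \<nu> borel complex_of_real. z \<in> cball 0 M"
    using M by (subst AE_distr_iff) (auto simp: dist_norm)
  then have "measure_support (distr \<nu> borel complex_of_real) \<subseteq> cball 0 M"
    by (intro measure_support_subset_closed) auto
  then have "compact (measure_support (distr \<nu> borel complex_of_real))"
    using closed_measure_support bounded_subset[OF bounded_cball] by (auto simp: compact_eq_bounded_closed)
  moreover have "prob_space (distr \<nu> borel complex_of_real)" by (rule prob_space_distr) simp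
  ultimately show ?thesis by (simp add: compact_prob_measures_def)
qed

lemma weighted_energy_embed:
  assumes \<nu>: "real_distribution \<nu>" and q[measurable]: "q \<in> borel_measurable borel"
  shows "weighted_energy q (distr \<nu> borel complex_of_real) = line_energy q \<nu>"
proof -
  interpret real_distribution \<nu> by (rule \<nu>)
  interpret D: prob_space "distr \<nu> borel complex_of_real" by (rule prob_space_distr) simp
  show ?thesis
    unfolding weighted_energy_def line_energy_def
    by (subst nn_integral_distr) (auto intro!: nn_integral_cong nn_integral_distr)
qed

text \<open>Finite energy forces the measure onto the line, where the potential is finite.\<close>

lemma finite_energy_on_line:
  assumes P: "prob_space \<mu>" and s: "sets \<mu> = sets borel" and q[measurable]: "q \<in> borel_measurable borel"
    and off: "\<And>z. z \<notin> \<real> \<Longrightarrow> q z = \<infinity>" and fin: "weighted_energy q \<mu> < \<infinity>"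
  shows "real_distribution (distr \<mu> borel Re)" "\<mu> = distr (distr \<mu> borel Re) borel complex_of_real"
    "line_energy q (distr \<mu> borel Re) = weighted_energy q \<mu>"
proof -
  interpret prob_space \<mu> by (rule P)
  note s[measurable_cong]
  show rd: "real_distribution (distr \<mu> borel Re)" by (rule real_distribution_distr) simp
  have "(\<integral>\<^sup>+z. q z \<partial>\<mu>) \<noteq> \<infinity>" using fin unfolding weighted_energy_add[OF P s q] by auto
  then have "AE z in \<mu>. q z \<noteq> \<infinity>" by (intro nn_integral_PInf_AE) auto
  then have "AE z in \<mu>. complex_of_real (Re z) = z"
    by eventually_elim (use off of_real_Re in blast)
  then have "distr \<mu> borel (\<lambda>z. complex_of_real (Re z)) = distr \<mu> borel (\<lambda>z. z)"
    by (intro distr_cong_AE) auto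
  also have "\<dots> = \<mu>" using s by (intro distr_id2) simp
  finally show eq: "\<mu> = distr (distr \<mu> borel Re) borel complex_of_real"
    by (simp add: distr_distr comp_def)
  show "line_energy q (distr \<mu> borel Re) = weighted_energy q \<mu>"
    using weighted_energy_embed[OF rd q] eq by simp
qed

text \<open>
  A measure of finite logarithmic energy on a set where the potential is finite has finite
  weighted energy after restriction to a set where the potential is bounded.
\<close>

lemma finite_energy_exists:
  assumes V: "external_potential k V" and lower: "\<And>z. ereal (2 * growth z - B) \<le> V z"
  obtains \<mu> where "prob_space \<mu>" "sets \<mu> = sets borel" "weighted_energy (reduced B V) \<mu> < \<infinity>"
proof -
  have lsc: "lower_semicontinuous V" using V by (simp add: external_potential_def)
  have [measurable]: "reduced B V \<in> borel_measurable borel"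
    by (rule measurable_lsc[OF lsc_reduced[OF lsc]])
  obtain E where E: "log_capacity E > 0" "\<forall>z\<in>E. V z < \<infinity>"
    using V by (auto simp: external_potential_def)
  obtain \<mu> where \<mu>: "\<mu> \<in> compact_prob_measures" "measure_support \<mu> \<subseteq> E" "ennexp (- log_energy \<mu>) > 0"
    using E(1) unfolding log_capacity_def by (auto simp: less_SUP_iff)
  have s[measurable_cong]: "sets \<mu> = sets borel" and P: "prob_space \<mu>"
    using \<mu> by (auto simp: compact_prob_measures_def)
  interpret prob_space \<mu> by (rule P)
  have "log_energy \<mu> \<noteq> \<infinity>" using \<mu>(3) by (auto simp: ennexp_def)
  then have fin: "(\<integral>\<^sup>+z. \<integral>\<^sup>+w. log_pair z w \<partial>\<mu> \<partial>\<mu>) \<noteq> \<infinity>"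
    unfolding log_energy_eq[OF \<mu>(1)] by auto
  define A where "A n = {z. reduced B V z \<le> ennreal (real n)}" for n :: nat
  have A[measurable]: "A n \<in> sets borel" for n unfolding A_def by measurable
  have "\<exists>n. emeasure \<mu> (A n) \<noteq> 0"
  proof (rule ccontr)
    assume "\<not> ?thesis"
    then have "AE z in \<mu>. \<forall>n. z \<notin> A n"
      unfolding AE_all_countable using s by (intro allI AE_not_in) (auto simp: null_sets_def)
    then have "AE z in \<mu>. False"
      using AE_measure_support[OF s]
    proof eventually_elim
      case (elim z)
      have "V z < \<infinity>" using elim E(2) \<mu>(2) by auto
      then have "reduced B V z < \<infinity>"
        unfolding reduced_def using lower[of z] by (cases "V z") (auto simp: e2ennreal_ereal)
      then obtain r where r: "reduced B V z = ennreal r" "r \<ge> 0" by (cases "reduced B V z") auto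
      obtain n :: nat where "r \<le> n" using real_arch_simple by blast
      then have "z \<in> A n" using r by (simp add: A_def ennreal_leI)
      then show ?case using elim by blast
    qed
    then show False by (simp add: AE_False)
  qed
  then obtain n where n: "emeasure \<mu> (A n) \<noteq> 0" by blast
  define p where "p = measure \<mu> (A n)"
  have p: "emeasure \<mu> (A n) = ennreal p" "p > 0"
    using n by (auto simp: p_def emeasure_eq_measure zero_less_measure_iff)
  define \<nu> where "\<nu> = uniform_measure \<mu> (A n)"
  have \<nu>: "prob_space \<nu>" "sets \<nu> = sets borel"
    unfolding \<nu>_def using n s by (auto intro!: prob_space_uniform_measure)
  have mono: "(\<integral>\<^sup>+z. f z \<partial>\<nu>) \<le> (\<integral>\<^sup>+z. f z \<partial>\<mu>) / ennreal p" if [measurable]: "f \<in> borel_measurable borel" for f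
    unfolding \<nu>_def by (subst nn_integral_uniform_measure)
      (auto simp: p indicator_def intro!: divide_right_mono_ennreal nn_integral_mono)
  have "(\<integral>\<^sup>+z. \<integral>\<^sup>+w. log_pair z w \<partial>\<nu> \<partial>\<nu>) \<le> (\<integral>\<^sup>+z. (\<integral>\<^sup>+w. log_pair z w \<partial>\<mu>) / ennreal p \<partial>\<nu>)"
    by (intro nn_integral_mono mono) measurable
  also have "\<dots> \<le> (\<integral>\<^sup>+z. (\<integral>\<^sup>+w. log_pair z w \<partial>\<mu>) / ennreal p \<partial>\<mu>) / ennreal p"
    by (rule mono) measurable
  also have "\<dots> = (\<integral>\<^sup>+z. (\<integral>\<^sup>+w. log_pair z w \<partial>\<mu>) \<partial>\<mu>) / ennreal p / ennreal p"
    by (subst nn_integral_divide) auto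
  also have "\<dots> < \<infinity>"
    using fin p(2) by (cases "\<integral>\<^sup>+z. \<integral>\<^sup>+w. log_pair z w \<partial>\<mu> \<partial>\<mu>") (auto simp: divide_ennreal)
  finally have 1: "(\<integral>\<^sup>+z. \<integral>\<^sup>+w. log_pair z w \<partial>\<nu> \<partial>\<nu>) < \<infinity>" .
  interpret N: prob_space \<nu> by (rule \<nu>)
  have "AE z in \<nu>. z \<in> A n"
    unfolding \<nu>_def by (rule AE_uniform_measureI) auto
  then have "(\<integral>\<^sup>+z. reduced B V z \<partial>\<nu>) \<le> (\<integral>\<^sup>+z. ennreal (real n) \<partial>\<nu>)"
    by (intro nn_integral_mono_AE) (auto simp: A_def elim!: eventually_mono)
  also have "\<dots> < \<infinity>" using N.emeasure_space_1 by (simp add: ennreal_mult_less_top)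
  finally have 2: "(\<integral>\<^sup>+z. reduced B V z \<partial>\<nu>) < \<infinity>" .
  show ?thesis
    using that[OF \<nu>] 1 2 weighted_energy_add[OF \<nu>, of "reduced B V"] by simp
qed

text \<open>
  The competitors for the equilibrium measure may be taken on the line. A minimizer among all
  probability measures there has compact support, hence is admitted in the definition.
\<close>

lemma equilibrium_measure_on_line:
  assumes V: "external_potential k V" and off: "\<And>z. z \<notin> \<real> \<Longrightarrow> V z = \<infinity>"
    and \<delta>: "\<delta> > 0" and lower: "\<And>z. ereal (2 * (1 + \<delta>) * growth z - B) \<le> V z"
  obtains \<sigma> where "real_distribution \<sigma>" "line_energy (reduced B V) \<sigma> < \<infinity>"
    "\<And>\<mu>. real_distribution \<mu> \<Longrightarrow> line_energy (reduced B V) \<sigma> \<le> line_energy (reduced B V) \<mu>"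
    "equilibrium_measure V = distr \<sigma> borel complex_of_real"
    "robin_constant V = enn2ereal (line_energy (reduced B V) \<sigma>) - ereal B"
proof -
  define q where "q = reduced B V"
  have lsc: "lower_semicontinuous V" using V by (simp add: external_potential_def)
  have lower': "ereal (2 * growth z - B) \<le> V z" for z
    by (rule growth_bound_weaken[OF \<delta> lower])
  have q: "confining \<delta> q" unfolding q_def by (rule confining_reduced[OF \<delta> lsc lower])
  then have qm[measurable]: "q \<in> borel_measurable borel" by (rule confining_measurable)
  have offq: "q z = \<infinity>" if "z \<notin> \<real>" for z using off[OF that] by (simp add: q_def reduced_def)
  obtain \<mu>0 where \<mu>0: "prob_space \<mu>0" "sets \<mu>0 = sets borel" "weighted_energy q \<mu>0 < \<infinity>"
    using finite_energy_exists[OF V lower'] unfolding q_def by blast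
  note f0 = finite_energy_on_line[OF \<mu>0(1,2) qm offq \<mu>0(3)]
  have fin0: "line_energy q (distr \<mu>0 borel Re) < \<infinity>" using f0(3) \<mu>0(3) by simp
  obtain \<sigma> where \<sigma>: "real_distribution \<sigma>" "\<And>\<mu>. real_distribution \<mu> \<Longrightarrow> line_energy q \<sigma> \<le> line_energy q \<mu>"
    using line_minimizer_exists[OF q f0(1) fin0] by blast
  have fin: "line_energy q \<sigma> < \<infinity>" using \<sigma>(2)[OF f0(1)] fin0 by (rule le_less_trans)
  obtain M where M: "AE x in \<sigma>. \<bar>x\<bar> \<le> M" using line_minimizer_compact_support[OF q \<sigma>(1) fin \<sigma>(2)] by blast
  define \<Sigma> where "\<Sigma> = distr \<sigma> borel complex_of_real"
  have \<Sigma>c: "\<Sigma> \<in> compact_prob_measures" unfolding \<Sigma>_def by (rule embed_compact_prob[OF \<sigma>(1) M])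
  have en: "energy V \<mu> = enn2ereal (weighted_energy q \<mu>) - ereal B" if "\<mu> \<in> compact_prob_measures" for \<mu>
    unfolding q_def by (rule energy_eq_weighted_energy[OF that lsc lower'])
  have w\<Sigma>: "weighted_energy q \<Sigma> = line_energy q \<sigma>" unfolding \<Sigma>_def by (rule weighted_energy_embed[OF \<sigma>(1) qm])
  have min: "energy V \<Sigma> \<le> energy V \<nu>" if \<nu>: "\<nu> \<in> compact_prob_measures" for \<nu>
  proof -
    have \<nu>': "prob_space \<nu>" "sets \<nu> = sets borel" using \<nu> by (auto simp: compact_prob_measures_def)
    have "weighted_energy q \<Sigma> \<le> weighted_energy q \<nu>"
    proof (cases "weighted_energy q \<nu> < \<infinity>")
      case True
      note f = finite_energy_on_line[OF \<nu>' qm offq True]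
      show ?thesis using \<sigma>(2)[OF f(1)] f(3) by (simp add: w\<Sigma>)
    qed (simp add: not_less top_unique)
    then show ?thesis unfolding en[OF \<Sigma>c] en[OF \<nu>]
      by (intro ereal_minus_mono) (auto simp: less_eq_ennreal.rep_eq)
  qed
  have eq: "equilibrium_measure V = \<Sigma>"
    unfolding equilibrium_measure_def
  proof (rule the_equality)
    show "\<Sigma> \<in> compact_prob_measures \<and> (\<forall>\<nu>\<in>compact_prob_measures. energy V \<Sigma> \<le> energy V \<nu>)"
      using \<Sigma>c min by blast
  next
    fix \<mu> assume \<mu>: "\<mu> \<in> compact_prob_measures \<and> (\<forall>\<nu>\<in>compact_prob_measures. energy V \<mu> \<le> energy V \<nu>)"
    then have \<mu>': "prob_space \<mu>" "sets \<mu> = sets borel" by (auto simp: compact_prob_measures_def)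
    have "energy V \<mu> \<le> energy V \<Sigma>" using \<mu> \<Sigma>c by blast
    then have le: "weighted_energy q \<mu> \<le> line_energy q \<sigma>"
      using \<mu> fin unfolding en[OF \<Sigma>c] en[OF conjunct1[OF \<mu>]] w\<Sigma>
      by (cases "weighted_energy q \<mu>"; cases "line_energy q \<sigma>") (auto simp: enn2ereal_ennreal ennreal_leI)
    then have fin': "weighted_energy q \<mu> < \<infinity>" using fin by (rule le_less_trans)
    note f = finite_energy_on_line[OF \<mu>' qm offq fin']
    have "\<sigma> = distr \<mu> borel Re"
      by (rule line_minimizer_unique[OF q \<sigma>(1) fin \<sigma>(2) f(1)]) (use le f(3) in simp_all)
    then show "\<mu> = \<Sigma>" unfolding \<Sigma>_def using f(2) by simp
  qed
  have "robin_constant V = enn2ereal (line_energy q \<sigma>) - ereal B"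
    unfolding robin_constant_def eq en[OF \<Sigma>c] w\<Sigma> ..
  then show ?thesis using that[of \<sigma>] \<sigma> fin eq unfolding q_def \<Sigma>_def by blast
qed

section \<open>Energies of configurations\<close>

text \<open>
  For \<open>n\<close> points the potential enters with the factor \<open>n - 1\<close>, so that this is the sum of one
  kernel over all ordered pairs of distinct points.
\<close>

definition config_energy :: "(complex \<Rightarrow> ennreal) \<Rightarrow> 'i set \<Rightarrow> ('i \<Rightarrow> complex) \<Rightarrow> ennreal" where
  "config_energy q S z = (\<Sum>i\<in>S. \<Sum>j\<in>S - {i}. log_pair (z i) (z j) + q (z i))"

lemma config_energy_mono:
  "(\<And>z. p z \<le> q z) \<Longrightarrow> config_energy p S z \<le> config_energy q S z"
  unfolding config_energy_def by (intro sum_mono add_left_mono)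

lemma config_energy_reindex:
  assumes "bij_betw f S T"
  shows "config_energy q T z = config_energy q S (z \<circ> f)"
proof -
  have "(\<Sum>j\<in>T - {f i}. log_pair (z (f i)) (z j) + q (z (f i))) = (\<Sum>j\<in>S - {i}. log_pair (z (f i)) (z (f j)) + q (z (f i)))"
    if "i \<in> S" for i
  proof (rule sum.reindex_bij_betw[symmetric])
    show "bij_betw f (S - {i}) (T - {f i})"
      using assms that by (intro bij_betw_DiffI) (auto simp: bij_betw_def)
  qed
  then show ?thesis
    unfolding config_energy_def by (subst sum.reindex_bij_betw[OF assms, symmetric]) (auto intro!: sum.cong)
qed

text \<open>Each ordered pair of points survives the removal of one of the remaining points.\<close>

lemma config_energy_remove:
  assumes "finite S"
  shows "(\<Sum>m\<in>S. config_energy q (S - {m}) z) = of_nat (card S - 2) * config_energy q S z"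
proof -
  define g where "g i j = (if i = j then 0 else log_pair (z i) (z j) + q (z i))" for i j
  have E: "config_energy q T z = (\<Sum>i\<in>T. \<Sum>j\<in>T. g i j)" if "finite T" for T
    unfolding config_energy_def
  proof (rule sum.cong[OF refl])
    fix i assume "i \<in> T"
    then have "(\<Sum>j\<in>T. g i j) = g i i + (\<Sum>j\<in>T - {i}. g i j)" using that by (rule sum.remove[rotated])
    also have "\<dots> = (\<Sum>j\<in>T - {i}. g i j)" by (simp add: g_def)
    also have "\<dots> = (\<Sum>j\<in>T - {i}. log_pair (z i) (z j) + q (z i))" by (intro sum.cong) (auto simp: g_def)
    finally show "(\<Sum>j\<in>T - {i}. log_pair (z i) (z j) + q (z i)) = (\<Sum>j\<in>T. g i j)" ..
  qed
  have "(\<Sum>m\<in>S. config_energy q (S - {m}) z) = (\<Sum>m\<in>S. \<Sum>i\<in>S. \<Sum>j\<in>S. if m = i \<or> m = j then 0 else g i j)"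
  proof (rule sum.cong[OF refl])
    fix m assume m: "m \<in> S"
    have "config_energy q (S - {m}) z = (\<Sum>i\<in>S - {m}. \<Sum>j\<in>S - {m}. g i j)" using assms by (intro E) auto
    also have "\<dots> = (\<Sum>i\<in>S - {m}. \<Sum>j\<in>S. if m = i \<or> m = j then 0 else g i j)"
      using assms by (intro sum.cong refl sum.mono_neutral_cong_left) auto
    also have "\<dots> = (\<Sum>i\<in>S. \<Sum>j\<in>S. if m = i \<or> m = j then 0 else g i j)"
      using assms by (intro sum.mono_neutral_left) auto
    finally show "config_energy q (S - {m}) z = (\<Sum>i\<in>S. \<Sum>j\<in>S. if m = i \<or> m = j then 0 else g i j)" .
  qed
  also have "\<dots> = (\<Sum>i\<in>S. \<Sum>m\<in>S. \<Sum>j\<in>S. if m = i \<or> m = j then 0 else g i j)"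
    by (rule sum.swap)
  also have "\<dots> = (\<Sum>i\<in>S. \<Sum>j\<in>S. \<Sum>m\<in>S. if m = i \<or> m = j then 0 else g i j)"
    by (intro sum.cong refl sum.swap)
  also have "\<dots> = (\<Sum>i\<in>S. \<Sum>j\<in>S. of_nat (card S - 2) * g i j)"
  proof (intro sum.cong refl)
    fix i j assume ij: "i \<in> S" "j \<in> S"
    show "(\<Sum>m\<in>S. if m = i \<or> m = j then 0 else g i j) = of_nat (card S - 2) * g i j"
    proof (cases "i = j")
      case False
      have "(\<Sum>m\<in>S. if m = i \<or> m = j then 0 else g i j) = (\<Sum>m\<in>S - {i, j}. g i j)"
        using assms by (intro sum.mono_neutral_cong_right) auto
      also have "card (S - {i, j}) = card S - 2"
        using assms ij False by (subst card_Diff_subset) auto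
      then have "(\<Sum>m\<in>S - {i, j}. g i j) = of_nat (card S - 2) * g i j" by simp
      finally show ?thesis .
    qed (simp add: g_def sum.neutral)
  qed
  also have "\<dots> = of_nat (card S - 2) * config_energy q S z"
    using assms by (simp add: E sum_distrib_left)
  finally show ?thesis .
qed

lemma config_energy_lower_bound_Suc:
  assumes n: "n \<ge> 2"
    and low: "\<And>(S :: nat set) z. finite S \<Longrightarrow> card S = n \<Longrightarrow> of_nat (n * (n - 1)) * e \<le> config_energy q S z"
    and S: "finite (S :: nat set)" "card S = Suc n"
  shows "of_nat (Suc n * n) * e \<le> config_energy q S z"
proof -
  have "of_nat (n - 1) * (of_nat (Suc n * n) * e) = of_nat ((n - 1) * (Suc n * n)) * e"
    by (simp only: of_nat_mult mult.assoc)
  also have "(n - 1) * (Suc n * n) = Suc n * (n * (n - 1))" by (simp only: mult_ac)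
  also have "of_nat (Suc n * (n * (n - 1))) * e = (\<Sum>m\<in>S. of_nat (n * (n - 1)) * e)"
    using S(2) by (simp only: sum_constant of_nat_mult mult.assoc)
  also have "\<dots> \<le> (\<Sum>m\<in>S. config_energy q (S - {m}) z)"
    using S by (intro sum_mono low) auto
  also have "\<dots> = of_nat (n - 1) * config_energy q S z"
    using S by (subst config_energy_remove) auto
  finally show ?thesis
    using n by (subst (asm) ennreal_mult_le_mult_iff) auto
qed

text \<open>
  Averaging over subconfigurations, the minimal energy per pair does not decrease with the number
  of points. This is the monotonicity behind the transfinite diameter.
\<close>

lemma config_energy_lower_bound_mono:
  assumes n: "n \<ge> 2" and N: "N \<ge> n"
    and low: "\<And>z. of_nat (n * (n - 1)) * e \<le> config_energy q {..<n} z"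
  shows "of_nat (N * (N - 1)) * e \<le> config_energy q {..<N} z"
proof -
  have "\<forall>(S :: nat set) z. finite S \<longrightarrow> card S = N \<longrightarrow> of_nat (N * (N - 1)) * e \<le> config_energy q S z"
    using N
  proof (induction N rule: dec_induct)
    case base
    show ?case
    proof (intro allI impI)
      fix S :: "nat set" and z assume S: "finite S" "card S = n"
      then obtain f where "bij_betw f {..<n} S"
        using bij_betw_iff_card[of "{..<n}" S] by auto
      then have eq: "config_energy q S z = config_energy q {..<n} (z \<circ> f)"
        by (rule config_energy_reindex)
      show "of_nat (n * (n - 1)) * e \<le> config_energy q S z"
        unfolding eq by (rule low)
    qed
  next
    case (step k)
    show ?case
    proof (intro allI impI)
      fix S :: "nat set" and z assume S: "finite S" "card S = Suc k"
      show "of_nat (Suc k * (Suc k - 1)) * e \<le> config_energy q S z"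
        using config_energy_lower_bound_Suc[of k e q S z] step n S by simp
    qed
  qed
  then show ?thesis by simp
qed

lemma config_energy_growth:
  assumes q: "\<And>z. ennreal (2 * \<delta> * growth z) \<le> q z" and \<delta>: "\<delta> > 0"
  shows "ennreal (2 * \<delta> * real (N - 1) * (\<Sum>j<N. growth (z j))) \<le> config_energy q {..<N} z"
proof -
  have "ennreal (2 * \<delta> * real (N - 1) * (\<Sum>j<N. growth (z j))) = (\<Sum>i<N. of_nat (N - 1) * ennreal (2 * \<delta> * growth (z i)))"
  proof -
    have "(\<Sum>i<N. of_nat (N - 1) * ennreal (2 * \<delta> * growth (z i))) = (\<Sum>i<N. ennreal (2 * \<delta> * real (N - 1) * growth (z i)))"
      using \<delta> growth_nonneg
      by (intro sum.cong refl) (simp add: ennreal_of_nat_eq_real_of_nat ennreal_mult[symmetric] mult_ac)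
    also have "\<dots> = ennreal (\<Sum>i<N. 2 * \<delta> * real (N - 1) * growth (z i))"
      using \<delta> growth_nonneg by (intro sum_ennreal) auto
    finally show ?thesis by (simp add: sum_distrib_left)
  qed
  also have "\<dots> \<le> (\<Sum>i<N. of_nat (N - 1) * q (z i))"
    by (intro sum_mono mult_left_mono q) auto
  also have "\<dots> = (\<Sum>i<N. \<Sum>j\<in>{..<N} - {i}. q (z i))" by (intro sum.cong) auto
  also have "\<dots> \<le> config_energy q {..<N} z"
    unfolding config_energy_def by (intro sum_mono) auto
  finally show ?thesis .
qed

section \<open>The partition function\<close>

abbreviation boltzmann :: "real \<Rightarrow> (complex \<Rightarrow> ereal) \<Rightarrow> nat \<Rightarrow> (nat \<Rightarrow> complex) \<Rightarrow> ennreal" where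
  "boltzmann \<beta> W N \<zeta> \<equiv> ennexp (- (ereal \<beta> * hamiltonian W N \<zeta>))"

abbreviation statistic :: "(real \<Rightarrow> real) \<Rightarrow> nat \<Rightarrow> (nat \<Rightarrow> complex) \<Rightarrow> real" where
  "statistic f N \<zeta> \<equiv> \<Sum>j<N. f (Re (\<zeta> j))"

lemma measurable_ennexp [measurable]: "ennexp \<in> borel_measurable borel"
  unfolding ennexp_def[abs_def] by measurable

lemma measurable_hamiltonian:
  assumes [measurable]: "W \<in> borel_measurable borel"
  shows "hamiltonian W N \<in> borel_measurable (area_power N)"
proof -
  note measurable_coordinate[measurable]
  show ?thesis
    unfolding hamiltonian_def[abs_def]
    by (intro borel_measurable_ereal_add borel_measurable_ereal_sum borel_measurable_ereal_times measurable_log_kernel) auto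
qed

lemma sum_ne_MInfty:
  fixes f :: "'a \<Rightarrow> ereal"
  assumes "\<And>i. i \<in> A \<Longrightarrow> f i \<noteq> - \<infinity>"
  shows "sum f A \<noteq> - \<infinity>"
  using assms by (induction A rule: infinite_finite_induct) auto

text \<open>
  Up to the shifts, which add up to \<open>N\<^sup>2 B\<close>, the Hamiltonian exceeds the energy of the configuration by
  one copy of the potential at each point, because it weights the potential with \<open>N\<close> and not with
  \<open>N - 1\<close>. This surplus is nonnegative.
\<close>

lemma boltzmann_factor_le:
  fixes f :: "real \<Rightarrow> real"
  assumes \<beta>: "\<beta> > 0" and N: "N \<ge> 1" and lower: "\<And>z. ereal (2 * growth z - B) \<le> W z"
    and f: "\<And>x. f x \<ge> 0" and t: "t \<ge> 0"
    and P: "ennreal P \<le> config_energy (\<lambda>z. reduced B W z + ennreal (t * f (Re z))) {..<N} \<zeta>"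
  shows "boltzmann \<beta> W N \<zeta> * ennreal (exp (- (\<beta> * t * real N * statistic f N \<zeta>)))
      \<le> ennreal (exp (\<beta> * ((real N)\<^sup>2 * B - P)))"
proof (cases "hamiltonian W N \<zeta> = \<infinity>")
  case True
  then show ?thesis using \<beta> by (simp add: ennexp_def)
next
  case False
  let ?S1 = "\<Sum>j<N. \<Sum>l\<in>{..<N} - {j}. log_kernel (\<zeta> j) (\<zeta> l)" and ?S2 = "\<Sum>j<N. W (\<zeta> j)"
  have nb: "W z \<noteq> - \<infinity>" for z using lower[of z] by auto
  have nbl: "log_kernel z w \<noteq> - \<infinity>" for z w by (simp add: log_kernel_def)
  have S: "?S1 \<noteq> - \<infinity>" "?S2 \<noteq> - \<infinity>"
    by (intro sum_ne_MInfty nbl nb; simp)+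
  have S': "?S1 \<noteq> \<infinity>" "?S2 \<noteq> \<infinity>"
    using False S N unfolding hamiltonian_def by (cases ?S1; cases ?S2; auto)+
  have inj: "\<zeta> j \<noteq> \<zeta> l" if "j < N" "l < N" "l \<noteq> j" for j l
  proof -
    have "log_kernel (\<zeta> j) (\<zeta> l) \<noteq> \<infinity>"
      using S'(1) that by (auto simp: sum_Pinfty)
    then show ?thesis by (auto simp: log_kernel_def)
  qed
  have "W (\<zeta> j) \<noteq> \<infinity>" if "j < N" for j
    using S'(2) that by (auto simp: sum_Pinfty)
  then have "\<exists>w. W (\<zeta> j) = ereal w" if "j < N" for j
    using nb[of "\<zeta> j"] that by (cases "W (\<zeta> j)") auto
  then obtain w where w: "\<And>j. j < N \<Longrightarrow> W (\<zeta> j) = ereal (w j)" by metis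
  define k where "k j l = - ln (cmod (\<zeta> j - \<zeta> l))" for j l
  define h where "h = (\<Sum>j<N. \<Sum>l\<in>{..<N} - {j}. k j l) + real N * (\<Sum>j<N. w j)"
  define g where "g j = growth (\<zeta> j)" for j
  have H: "hamiltonian W N \<zeta> = ereal h"
  proof -
    have "?S1 = (\<Sum>j<N. \<Sum>l\<in>{..<N} - {j}. ereal (k j l))"
      by (intro sum.cong refl) (use inj in \<open>auto simp: log_kernel_def k_def ln_div\<close>)
    moreover have "?S2 = (\<Sum>j<N. ereal (w j))" by (intro sum.cong refl) (use w in auto)
    ultimately show ?thesis unfolding hamiltonian_def h_def by simp
  qed
  define p where "p = (\<Sum>j<N. \<Sum>l\<in>{..<N} - {j}. (g j + g l + k j l) + (w j + B - 2 * g j + t * f (Re (\<zeta> j))))"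
  have pair: "log_pair (\<zeta> j) (\<zeta> l) + (reduced B W (\<zeta> j) + ennreal (t * f (Re (\<zeta> j))))
     = ennreal ((g j + g l + k j l) + (w j + B - 2 * g j + t * f (Re (\<zeta> j))))
     \<and> (g j + g l + k j l) + (w j + B - 2 * g j + t * f (Re (\<zeta> j))) \<ge> 0" if "j < N" "l < N" "l \<noteq> j" for j l
  proof -
    have 1: "log_pair (\<zeta> j) (\<zeta> l) = ennreal (g j + g l + k j l)" "g j + g l + k j l \<ge> 0"
      using inj[OF that] log_kernel_growth_nonneg[of "\<zeta> j" "\<zeta> l"]
      by (auto simp: log_pair_off_diag g_def k_def log_kernel_def ln_div)
    have 2: "reduced B W (\<zeta> j) = ennreal (w j + B - 2 * g j)" "w j + B - 2 * g j \<ge> 0"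
      using w[OF that(1)] lower[of "\<zeta> j"] by (auto simp: reduced_def g_def e2ennreal_ereal algebra_simps)
    have 3: "t * f (Re (\<zeta> j)) \<ge> 0" using f t by simp
    show ?thesis using 1 2 3 by (simp add: ennreal_plus[symmetric] add.assoc del: ennreal_plus)
  qed
  have "config_energy (\<lambda>z. reduced B W z + ennreal (t * f (Re z))) {..<N} \<zeta> = ennreal p"
  proof -
    have "config_energy (\<lambda>z. reduced B W z + ennreal (t * f (Re z))) {..<N} \<zeta>
      = (\<Sum>j<N. \<Sum>l\<in>{..<N} - {j}. ennreal ((g j + g l + k j l) + (w j + B - 2 * g j + t * f (Re (\<zeta> j)))))"
      unfolding config_energy_def by (intro sum.cong refl) (use pair in auto)
    also have "\<dots> = (\<Sum>j<N. ennreal (\<Sum>l\<in>{..<N} - {j}. (g j + g l + k j l) + (w j + B - 2 * g j + t * f (Re (\<zeta> j)))))"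
      by (intro sum.cong refl sum_ennreal) (use pair in auto)
    also have "\<dots> = ennreal p" unfolding p_def
      by (intro sum_ennreal sum_nonneg) (use pair in auto)
    finally show ?thesis .
  qed
  moreover have "p \<ge> 0" unfolding p_def by (intro sum_nonneg) (use pair in auto)
  ultimately have Pp: "P \<le> p" using P by (cases "P \<ge> 0") (auto simp: ennreal_le_iff)
  have swap: "(\<Sum>j<N. \<Sum>l\<in>{..<N} - {j}. g l) = (\<Sum>j<N. \<Sum>l\<in>{..<N} - {j}. g j)"
  proof -
    have "(\<Sum>j<N. \<Sum>l\<in>{..<N} - {j}. g l) = (\<Sum>j<N. (\<Sum>l<N. g l) - g j)"
      by (intro sum.cong refl) (simp add: sum_diff1)
    also have "\<dots> = real N * (\<Sum>l<N. g l) - (\<Sum>j<N. g j)" by (simp add: sum_subtractf)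
    also have "\<dots> = (\<Sum>j<N. real (N - 1) * g j)" using N by (simp add: of_nat_diff left_diff_distrib sum_subtractf sum_distrib_left)
    finally show ?thesis by simp
  qed
  have "p = (\<Sum>j<N. \<Sum>l\<in>{..<N} - {j}. k j l) + (\<Sum>j<N. \<Sum>l\<in>{..<N} - {j}. g l) - (\<Sum>j<N. \<Sum>l\<in>{..<N} - {j}. g j)
      + (\<Sum>j<N. \<Sum>l\<in>{..<N} - {j}. w j + B + t * f (Re (\<zeta> j)))"
    unfolding p_def sum.distrib[symmetric] sum_subtractf[symmetric] by (intro sum.cong refl) (simp add: algebra_simps)
  also have "\<dots> = (\<Sum>j<N. \<Sum>l\<in>{..<N} - {j}. k j l) + (\<Sum>j<N. real (N - 1) * (w j + B + t * f (Re (\<zeta> j))))"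
    unfolding swap by simp
  finally have p: "p = (\<Sum>j<N. \<Sum>l\<in>{..<N} - {j}. k j l) + real (N - 1) * (\<Sum>j<N. w j + B + t * f (Re (\<zeta> j)))"
    by (simp add: sum_distrib_left)
  have "(\<Sum>j<N. w j + B + t * f (Re (\<zeta> j))) \<ge> 0"
  proof (intro sum_nonneg)
    fix j assume "j \<in> {..<N}"
    then have "2 * growth (\<zeta> j) - B \<le> w j" using lower[of "\<zeta> j"] w by auto
    moreover have "t * f (Re (\<zeta> j)) \<ge> 0" using f t by simp
    ultimately show "0 \<le> w j + B + t * f (Re (\<zeta> j))" using growth_nonneg[of "\<zeta> j"] by simp
  qed
  then have "p \<le> (\<Sum>j<N. \<Sum>l\<in>{..<N} - {j}. k j l) + real N * (\<Sum>j<N. w j + B + t * f (Re (\<zeta> j)))"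
    unfolding p by (intro add_left_mono mult_right_mono) auto
  also have "\<dots> = h + t * real N * statistic f N \<zeta> + (real N)\<^sup>2 * B"
    by (simp add: h_def sum.distrib sum_distrib_left[symmetric] power2_eq_square algebra_simps)
  finally have "P - (real N)\<^sup>2 * B \<le> h + t * real N * statistic f N \<zeta>" using Pp by linarith
  then have "\<beta> * (P - (real N)\<^sup>2 * B) \<le> \<beta> * (h + t * real N * statistic f N \<zeta>)"
    using \<beta> by (intro mult_left_mono) auto
  then have "exp (- (\<beta> * h)) * exp (- (\<beta> * t * real N * statistic f N \<zeta>)) \<le> exp (\<beta> * ((real N)\<^sup>2 * B - P))"
    by (simp add: exp_add[symmetric] algebra_simps)
  then show ?thesis by (simp add: H ennexp_def ennreal_mult[symmetric] ennreal_leI)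
qed

lemma finite_growth_integral: "(\<integral>\<^sup>+z. ennreal (exp (- (4 * growth z))) \<partial>area) < \<infinity>"
proof -
  have lor: "(\<integral>\<^sup>+x. ennreal (inverse (1 + x\<^sup>2)) \<partial>lborel) < \<infinity>"
    using integrable_inverse_1_plus_square
    by (simp add: set_integrable_def einterval_def real_integrable_def top.not_eq_extremum)
  have "(\<integral>\<^sup>+z. ennreal (exp (- (4 * growth z))) \<partial>area) = (\<integral>\<^sup>+z. ennreal (1 / pi) * ennreal (exp (- (4 * growth z))) \<partial>lborel)"
    unfolding area_def by (subst nn_integral_density) auto
  also have "\<dots> \<le> (\<integral>\<^sup>+z. ennreal (inverse (1 + (Re z)\<^sup>2)) * ennreal (inverse (1 + (Im z)\<^sup>2)) \<partial>lborel)"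
  proof (rule nn_integral_mono)
    fix z :: complex
    have "(1 + (Re z)\<^sup>2) * (1 + (Im z)\<^sup>2) \<le> (1 + (cmod z)\<^sup>2) * (1 + (cmod z)\<^sup>2)"
      unfolding cmod_power2 by (intro mult_mono) auto
    also have "\<dots> \<le> (1 + cmod z)^2 * (1 + cmod z)^2"
      by (intro mult_mono) (auto simp: power2_sum)
    finally have le: "(1 + (Re z)\<^sup>2) * (1 + (Im z)\<^sup>2) \<le> (1 + cmod z)^4" by (simp add: power_add[symmetric])
    have pos: "1 + cmod z > 0" "(1 + (Re z)\<^sup>2) * (1 + (Im z)\<^sup>2) > 0" by (simp_all add: add_pos_nonneg)
    have "exp (- (4 * growth z)) = inverse ((1 + cmod z)^4)"
      using pos(1) exp_of_nat_mult[of 4 "growth z"] by (simp add: growth_def exp_minus)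
    also have "\<dots> \<le> inverse ((1 + (Re z)\<^sup>2) * (1 + (Im z)\<^sup>2))" by (rule le_imp_inverse_le[OF le pos(2)])
    finally have e: "exp (- (4 * growth z)) \<le> inverse (1 + (Re z)\<^sup>2) * inverse (1 + (Im z)\<^sup>2)" by simp
    have "(1 / pi) * exp (- (4 * growth z)) \<le> 1 * exp (- (4 * growth z))"
      using pi_gt3 by (intro mult_right_mono) auto
    with e have "(1 / pi) * exp (- (4 * growth z)) \<le> inverse (1 + (Re z)\<^sup>2) * inverse (1 + (Im z)\<^sup>2)" by linarith
    then show "ennreal (1 / pi) * ennreal (exp (- (4 * growth z))) \<le> ennreal (inverse (1 + (Re z)\<^sup>2)) * ennreal (inverse (1 + (Im z)\<^sup>2))"
      by (simp add: ennreal_mult[symmetric] ennreal_leI)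
  qed
  also have "\<dots> = (\<integral>\<^sup>+p. ennreal (inverse (1 + (fst p)\<^sup>2)) * ennreal (inverse (1 + (snd p)\<^sup>2)) \<partial>(lborel \<Otimes>\<^sub>M lborel))"
    by (subst lborel_complex_eq, subst nn_integral_distr) auto
  also have "\<dots> = (\<integral>\<^sup>+x. \<integral>\<^sup>+y. ennreal (inverse (1 + x\<^sup>2)) * ennreal (inverse (1 + y\<^sup>2)) \<partial>lborel \<partial>lborel)"
    by (subst lborel.nn_integral_fst[symmetric]) auto
  also have "\<dots> = (\<integral>\<^sup>+x. ennreal (inverse (1 + x\<^sup>2)) \<partial>lborel) * (\<integral>\<^sup>+y. ennreal (inverse (1 + y\<^sup>2)) \<partial>lborel)"
    by (simp add: nn_integral_cmult nn_integral_multc)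
  also have "\<dots> < \<infinity>" using lor by (simp add: ennreal_mult_less_top)
  finally show ?thesis .
qed

text \<open>
  A fraction of order \<open>1 / N\<close> of the energy pays for integrability at infinity, at the cost of a
  factor that is only exponential in \<open>N\<close>; for the rest the assumed lower bound is used.
\<close>

lemma perturbed_partition_function_le:
  fixes f :: "real \<Rightarrow> real"
  assumes \<beta>: "\<beta> > 0" and \<delta>: "\<delta> > 0" and N: "N \<ge> 2" "2 \<le> \<beta> * \<delta> * (real N - 1)"
    and lsc: "lower_semicontinuous W"
    and lower: "\<And>z. ereal (2 * (1 + \<delta>) * growth z - B) \<le> W z"
    and f: "\<And>x. f x \<ge> 0" and t: "t \<ge> 0" and e: "e \<ge> 0"
    and low: "\<And>z. of_nat (N * (N - 1)) * ennreal e \<le> config_energy (\<lambda>z. reduced B W z + ennreal (t * f (Re z))) {..<N} z"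
  shows "(\<integral>\<^sup>+\<zeta>. boltzmann \<beta> W N \<zeta> * ennreal (exp (- (\<beta> * t * real N * statistic f N \<zeta>))) \<partial>area_power N)
    \<le> ennreal (exp (\<beta> * ((real N)\<^sup>2 * B) - \<beta> * (real N)\<^sup>2 * e + real N * (\<beta> * e + 2 * e / \<delta>)))
      * (\<integral>\<^sup>+z. ennreal (exp (- (4 * growth z))) \<partial>area) ^ N"
proof -
  let ?q = "\<lambda>z. reduced B W z + ennreal (t * f (Re z))"
  let ?n = "real N - 1"
  have n: "?n > 0" using N by simp
  \<comment> \<open>The fraction for which the growth term contributes \<open>(1 + \<bar>z\<bar>)\<^sup>-\<^sup>4\<close> for each point, which is integrable.\<close>
  define \<kappa> where "\<kappa> = 2 / (\<beta> * \<delta> * ?n)"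
  have \<kappa>: "0 \<le> \<kappa>" "\<kappa> \<le> 1" using \<beta> \<delta> n N(2) by (auto simp: \<kappa>_def divide_le_eq)
  have lower': "ereal (2 * growth z - B) \<le> W z" for z
    by (rule growth_bound_weaken[OF \<delta> lower])
  have conf: "confining \<delta> (reduced B W)" by (rule confining_reduced[OF \<delta> lsc lower])
  have gq: "ennreal (2 * \<delta> * growth z) \<le> ?q z" for z
    using conf unfolding confining_def by (meson add_increasing2 zero_le)
  have bound: "boltzmann \<beta> W N \<zeta> * ennreal (exp (- (\<beta> * t * real N * statistic f N \<zeta>)))
    \<le> ennreal (exp (\<beta> * ((real N)\<^sup>2 * B) - \<beta> * (real N)\<^sup>2 * e + real N * (\<beta> * e + 2 * e / \<delta>))) * (\<Prod>j<N. ennreal (exp (- (4 * growth (\<zeta> j)))))" for \<zeta>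
  proof -
    define G where "G = (\<Sum>j<N. growth (\<zeta> j))"
    define a where "a = real N * ?n * e"
    define b where "b = 2 * \<delta> * ?n * G"
    have a0: "a \<ge> 0" using n e by (simp add: a_def)
    have b0: "b \<ge> 0" unfolding b_def G_def using n \<delta> by (intro mult_nonneg_nonneg sum_nonneg growth_nonneg) auto
    have la: "ennreal a \<le> config_energy ?q {..<N} \<zeta>"
      using low[of \<zeta>] N(1) e by (simp add: a_def ennreal_of_nat_eq_real_of_nat ennreal_mult[symmetric] of_nat_diff)
    have lb: "ennreal b \<le> config_energy ?q {..<N} \<zeta>"
      using config_energy_growth[of \<delta> ?q N \<zeta>, OF gq \<delta>] N(1) by (simp add: b_def G_def of_nat_diff)
    have "ennreal ((1 - \<kappa>) * a + \<kappa> * b) \<le> ennreal (max a b)"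
    proof (rule ennreal_leI)
      have "(1 - \<kappa>) * a + \<kappa> * b \<le> (1 - \<kappa>) * max a b + \<kappa> * max a b"
        using \<kappa> by (intro add_mono mult_left_mono) auto
      then show "(1 - \<kappa>) * a + \<kappa> * b \<le> max a b" by (simp add: algebra_simps)
    qed
    also have "\<dots> \<le> config_energy ?q {..<N} \<zeta>" using la lb by (simp add: max_def)
    finally have "boltzmann \<beta> W N \<zeta> * ennreal (exp (- (\<beta> * t * real N * statistic f N \<zeta>)))
      \<le> ennreal (exp (\<beta> * ((real N)\<^sup>2 * B - ((1 - \<kappa>) * a + \<kappa> * b))))"
      using N by (intro boltzmann_factor_le[OF \<beta> _ lower' f t]) auto
    also have "\<beta> * ((real N)\<^sup>2 * B - ((1 - \<kappa>) * a + \<kappa> * b))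
      = (\<beta> * ((real N)\<^sup>2 * B) - \<beta> * (real N)\<^sup>2 * e + real N * (\<beta> * e + 2 * e / \<delta>)) + (- (4 * G))"
    proof -
      have k1: "\<beta> * \<kappa> * b = 4 * G" using \<beta> \<delta> n by (simp add: \<kappa>_def b_def field_simps)
      have k2: "\<beta> * \<kappa> * a = 2 * real N * e / \<delta>" using \<beta> \<delta> n by (simp add: \<kappa>_def a_def field_simps)
      have "\<beta> * ((real N)\<^sup>2 * B - ((1 - \<kappa>) * a + \<kappa> * b)) = \<beta> * ((real N)\<^sup>2 * B) - \<beta> * a + \<beta> * \<kappa> * a - \<beta> * \<kappa> * b"
        by (simp add: algebra_simps)
      then show ?thesis unfolding k1 k2 by (simp add: a_def algebra_simps power2_eq_square)
    qed
    also have "exp (\<dots>) = exp (\<beta> * ((real N)\<^sup>2 * B) - \<beta> * (real N)\<^sup>2 * e + real N * (\<beta> * e + 2 * e / \<delta>)) * (\<Prod>j<N. exp (- (4 * growth (\<zeta> j))))"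
      unfolding exp_add by (simp add: G_def exp_sum sum_distrib_left sum_negf[symmetric] del: sum_negf)
    finally show ?thesis by (simp add: ennreal_mult prod_nonneg prod_ennreal)
  qed
  interpret product_sigma_finite "\<lambda>_::nat. area"
    by (simp add: product_sigma_finite_def sigma_finite_area)
  have gm: "(\<lambda>z. ennreal (exp (- (4 * growth z)))) \<in> borel_measurable area" by measurable
  note measurable_coordinate[measurable]
  have "(\<integral>\<^sup>+\<zeta>. boltzmann \<beta> W N \<zeta> * ennreal (exp (- (\<beta> * t * real N * statistic f N \<zeta>))) \<partial>area_power N)
    \<le> (\<integral>\<^sup>+\<zeta>. ennreal (exp (\<beta> * ((real N)\<^sup>2 * B) - \<beta> * (real N)\<^sup>2 * e + real N * (\<beta> * e + 2 * e / \<delta>))) * (\<Prod>j<N. ennreal (exp (- (4 * growth (\<zeta> j))))) \<partial>area_power N)"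
    by (intro nn_integral_mono bound)
  also have "\<dots> = ennreal (exp (\<beta> * ((real N)\<^sup>2 * B) - \<beta> * (real N)\<^sup>2 * e + real N * (\<beta> * e + 2 * e / \<delta>))) * (\<integral>\<^sup>+\<zeta>. (\<Prod>j<N. ennreal (exp (- (4 * growth (\<zeta> j))))) \<partial>area_power N)"
    by (intro nn_integral_cmult) auto
  also have "(\<integral>\<^sup>+\<zeta>. (\<Prod>j<N. ennreal (exp (- (4 * growth (\<zeta> j))))) \<partial>area_power N) = (\<integral>\<^sup>+z. ennreal (exp (- (4 * growth z))) \<partial>area) ^ N"
    unfolding area_power_def using gm by (subst product_nn_integral_prod) auto
  finally show ?thesis .
qed

lemma density_jensen:
  fixes X :: "'a \<Rightarrow> real"
  assumes w[measurable]: "w \<in> borel_measurable M" and Z: "(\<integral>\<^sup>+x. w x \<partial>M) = Z" "0 < Z" "Z < \<infinity>"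
    and X[measurable]: "X \<in> borel_measurable M" and bd: "\<And>x. \<bar>X x\<bar> \<le> C"
  shows "prob_space (density M (\<lambda>x. w x / Z))"
    "Z * ennreal (exp (\<integral>x. X x \<partial>density M (\<lambda>x. w x / Z))) \<le> (\<integral>\<^sup>+x. w x * ennreal (exp (X x)) \<partial>M)"
proof -
  define P where "P = density M (\<lambda>x. w x / Z)"
  have sP[measurable_cong]: "sets P = sets M" by (simp add: P_def)
  have "emeasure P (space P) = (\<integral>\<^sup>+x. w x / Z \<partial>M)"
    unfolding P_def by (subst emeasure_density) (auto intro!: nn_integral_cong)
  also have "\<dots> = 1" using Z by (subst nn_integral_divide) (auto simp: ennreal_divide_self)
  finally show P: "prob_space (density M (\<lambda>x. w x / Z))" unfolding P_def[symmetric] by (rule prob_spaceI)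
  then interpret P: prob_space P by (simp add: P_def)
  have iX: "integrable P X" by (rule P.integrable_const_bound[of _ C]) (auto simp: bd)
  have ie: "integrable P (\<lambda>x. exp (X x))"
    by (rule P.integrable_const_bound[of _ "exp C"]) (auto intro!: AE_I2 order.trans[OF abs_ge_self bd])
  have conv: "convex_on UNIV (exp :: real \<Rightarrow> real)" using convex_on_exp[of 1] by simp
  have "exp (P.expectation X) \<le> P.expectation (\<lambda>x. exp (X x))"
    by (rule P.jensens_inequality[OF iX _ _ ie conv]) auto
  then have "ennreal (exp (P.expectation X)) \<le> (\<integral>\<^sup>+x. ennreal (exp (X x)) \<partial>P)"
    using ie by (subst nn_integral_eq_integral) (auto intro: ennreal_leI)
  also have "\<dots> = (\<integral>\<^sup>+x. w x * ennreal (exp (X x)) / Z \<partial>M)"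
    unfolding P_def by (subst nn_integral_density) (auto simp: divide_ennreal_def mult_ac)
  also have "\<dots> = (\<integral>\<^sup>+x. w x * ennreal (exp (X x)) \<partial>M) / Z"
    by (rule nn_integral_divide) measurable
  finally have "Z * ennreal (exp (P.expectation X)) \<le> Z * ((\<integral>\<^sup>+x. w x * ennreal (exp (X x)) \<partial>M) / Z)"
    by (rule mult_left_mono) simp
  also have "\<dots> = (\<integral>\<^sup>+x. w x * ennreal (exp (X x)) \<partial>M)"
    using Z by (metis ennreal_mult_divide_eq ennreal_times_divide infinity_ennreal_def less_irrefl mult.commute)
  finally show "Z * ennreal (exp (\<integral>x. X x \<partial>density M (\<lambda>x. w x / Z))) \<le> (\<integral>\<^sup>+x. w x * ennreal (exp (X x)) \<partial>M)"
    by (simp add: P_def)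
qed

lemma gibbs_measure_jensen:
  fixes f :: "real \<Rightarrow> real"
  assumes W[measurable]: "W \<in> borel_measurable borel"
    and Z: "0 < partition_function \<beta> W N" "partition_function \<beta> W N < \<infinity>"
    and f[measurable]: "f \<in> borel_measurable borel" and bd: "\<And>x. \<bar>f x\<bar> \<le> F"
  shows "prob_space (gibbs_measure \<beta> W N)" "absolutely_continuous (area_power N) (gibbs_measure \<beta> W N)"
    "partition_function \<beta> W N * ennreal (exp (- (c * (\<integral>\<zeta>. statistic f N \<zeta> \<partial>gibbs_measure \<beta> W N))))
     \<le> (\<integral>\<^sup>+\<zeta>. boltzmann \<beta> W N \<zeta> * ennreal (exp (- (c * statistic f N \<zeta>))) \<partial>area_power N)"
proof -
  have [measurable]: "hamiltonian W N \<in> borel_measurable (area_power N)" by (rule measurable_hamiltonian) simp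
  note measurable_coordinate[measurable]
  have w: "(\<lambda>\<zeta>. boltzmann \<beta> W N \<zeta>) \<in> borel_measurable (area_power N)" by measurable
  have X: "(\<lambda>\<zeta>. - (c * statistic f N \<zeta>)) \<in> borel_measurable (area_power N)" by measurable
  have bX: "\<bar>- (c * statistic f N \<zeta>)\<bar> \<le> \<bar>c\<bar> * (real N * F)" for \<zeta>
  proof -
    have "\<bar>\<Sum>j<N. f (Re (\<zeta> j))\<bar> \<le> (\<Sum>j<N. \<bar>f (Re (\<zeta> j))\<bar>)" by (rule sum_abs)
    also have "\<dots> \<le> (\<Sum>j<N. F)" by (intro sum_mono bd)
    finally show ?thesis by (simp add: abs_mult mult_left_mono)
  qed
  note J = density_jensen[OF w partition_function_def[symmetric] Z X bX]
  show "prob_space (gibbs_measure \<beta> W N)" using J(1) by (simp add: gibbs_measure_def)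
  show "absolutely_continuous (area_power N) (gibbs_measure \<beta> W N)"
    unfolding gibbs_measure_def using w by (intro absolutely_continuousI_density) measurable
  show "partition_function \<beta> W N * ennreal (exp (- (c * (\<integral>\<zeta>. statistic f N \<zeta> \<partial>gibbs_measure \<beta> W N))))
     \<le> (\<integral>\<^sup>+\<zeta>. boltzmann \<beta> W N \<zeta> * ennreal (exp (- (c * statistic f N \<zeta>))) \<partial>area_power N)"
    using J(2) by (simp add: gibbs_measure_def)
qed

lemma ennexp_le_of_ennln:
  assumes "ereal (- c) < ennln Z / ereal s" and s: "s > 0"
  shows "ennreal (exp (- (c * s))) \<le> Z" "Z > 0"
proof -
  have lt: "ereal (- (c * s)) < ennln Z"
    using assms by (cases "ennln Z") (auto simp: field_simps)
  then have "Z \<noteq> 0" by (auto simp: ennln_def)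
  then show "Z > 0" by (simp add: zero_less_iff_neq_zero)
  show "ennreal (exp (- (c * s))) \<le> Z"
  proof (cases Z)
    case (real r)
    then have r: "r > 0" using \<open>Z \<noteq> 0\<close> by (cases "r = 0") auto
    then have "- (c * s) < ln r" using lt real by (simp add: ennln_def ennreal_eq_0_iff)
    then have "exp (- (c * s)) < exp (ln r)" by (subst exp_less_cancel_iff)
    then show ?thesis using r real by (simp add: ennreal_leI)
  qed simp
qed

section \<open>Perturbation of the potential\<close>

text \<open>
  The number \<open>\<gamma>\<close> will be Robin's constant of \<open>V\<close>. The lower bound for the potentials is uniform in
  the index because they increase.
\<close>

locale external_sequence =
  fixes \<beta> \<delta> B \<gamma> :: real and Q :: "nat \<Rightarrow> complex \<Rightarrow> ereal" and V :: "complex \<Rightarrow> ereal"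
  assumes beta: "\<beta> > 0" and delta: "\<delta> > 0"
    and lsc_Q: "\<And>N. N \<ge> 1 \<Longrightarrow> lower_semicontinuous (Q N)"
    and lower_Q: "\<And>N z. N \<ge> 1 \<Longrightarrow> ereal (2 * (1 + \<delta>) * growth z - B) \<le> Q N z"
    and mono_Q: "\<And>N M z. 1 \<le> M \<Longrightarrow> M \<le> N \<Longrightarrow> Q M z \<le> Q N z"
    and lim_Q: "\<And>z. (\<lambda>N. Q N z) \<longlonglongrightarrow> V z"
    and lsc_V: "lower_semicontinuous V"
    and off_line: "\<And>z. z \<notin> \<real> \<Longrightarrow> V z = \<infinity>"
    and partition_lower: "liminf (\<lambda>N. ennln (partition_function \<beta> (Q N) N) / ereal ((real N)\<^sup>2)) \<ge> - (ereal \<beta> * ereal \<gamma>)"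
begin

definition sample_mean :: "(real \<Rightarrow> real) \<Rightarrow> nat \<Rightarrow> real" where
  "sample_mean f N = (1 / real N) * (\<integral>\<zeta>. statistic f N \<zeta> \<partial>gibbs_measure \<beta> (Q N) N)"

lemma partition_function_finite:
  assumes N: "N \<ge> 2" "2 \<le> \<beta> * \<delta> * (real N - 1)"
  shows "partition_function \<beta> (Q N) N < \<infinity>"
proof -
  let ?I = "\<integral>\<^sup>+z. ennreal (exp (- (4 * growth z))) \<partial>area"
  have N1: "N \<ge> 1" using N by simp
  have "partition_function \<beta> (Q N) N = (\<integral>\<^sup>+\<zeta>. boltzmann \<beta> (Q N) N \<zeta> * ennreal (exp (- (\<beta> * 0 * real N * (\<Sum>j<N. 0)))) \<partial>area_power N)"
    by (simp add: partition_function_def)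
  also have "\<dots> \<le> ennreal (exp (\<beta> * ((real N)\<^sup>2 * B) - \<beta> * (real N)\<^sup>2 * 0 + real N * (\<beta> * 0 + 2 * 0 / \<delta>))) * ?I ^ N"
    by (rule perturbed_partition_function_le[OF beta delta N lsc_Q[OF N1] lower_Q[OF N1]]) auto
  also have "\<dots> < \<infinity>" using finite_growth_integral by (simp add: ennreal_mult_less_top power_less_top_ennreal)
  finally show ?thesis .
qed

lemma partition_function_eventually_large:
  assumes \<eta>: "\<eta> > 0"
  shows "eventually (\<lambda>N. ereal (- (\<beta> * (\<gamma> + \<eta>))) < ennln (partition_function \<beta> (Q N) N) / ereal ((real N)\<^sup>2)) sequentially"
proof -
  have "- (ereal \<beta> * ereal \<gamma>) > ereal (- (\<beta> * (\<gamma> + \<eta>)))" using beta \<eta> by simp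
  then have "ereal (- (\<beta> * (\<gamma> + \<eta>))) < liminf (\<lambda>N. ennln (partition_function \<beta> (Q N) N) / ereal ((real N)\<^sup>2))"
    using partition_lower by (rule less_le_trans)
  then show ?thesis
    by (rule less_LiminfD)
qed

lemma eventually_proper:
  "eventually (\<lambda>N. 0 < partition_function \<beta> (Q N) N \<and> partition_function \<beta> (Q N) N < \<infinity>) sequentially"
proof -
  have "eventually (\<lambda>N. real N > 2 / (\<beta> * \<delta>) + 1) sequentially"
    using filterlim_real_sequentially by (simp add: filterlim_at_top_dense)
  with partition_function_eventually_large[OF zero_less_one] eventually_ge_at_top[of 2]
  show ?thesis
  proof eventually_elim
    case (elim N)
    have "2 \<le> \<beta> * \<delta> * (real N - 1)" using elim(3) beta delta by (simp add: field_simps)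
    then show ?case
      using ennexp_le_of_ennln(2)[OF elim(1)] partition_function_finite[OF elim(2)] elim(2) by simp
  qed
qed

text \<open>
  If all \<open>n\<close>-point configurations had energy per pair above \<open>\<gamma> + B + t a\<close> in some perturbed potential,
  the perturbed partition functions would be too small for Jensen's inequality at those \<open>N\<close> for which
  the mean of \<open>f\<close> is at most \<open>a\<close>.
\<close>

lemma perturbed_config_energy_bound:
  fixes f :: "real \<Rightarrow> real"
  assumes f[measurable]: "f \<in> borel_measurable borel" and f0: "\<And>x. 0 \<le> f x" and fF: "\<And>x. f x \<le> F"
    and t: "t \<ge> 0"
    and a: "\<exists>\<^sub>F N in sequentially. sample_mean f N \<le> a"
    and M: "M \<ge> 1" and n: "n \<ge> 2" and e: "e \<ge> 0"
    and low: "\<And>z. of_nat (n * (n - 1)) * ennreal e \<le> config_energy (\<lambda>z. reduced B (Q M) z + ennreal (t * f (Re z))) {..<n} z"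
  shows "e \<le> \<gamma> + B + t * a"
proof (rule ccontr)
  assume neg: "\<not> e \<le> \<gamma> + B + t * a"
  define \<eta> where "\<eta> = (e - (\<gamma> + B + t * a)) / 2"
  have \<eta>: "\<eta> > 0" using neg by (simp add: \<eta>_def)
  let ?I = "\<integral>\<^sup>+z. ennreal (exp (- (4 * growth z))) \<partial>area"
  obtain c where c: "?I = ennreal c" "c \<ge> 0"
    using finite_growth_integral by (cases ?I) auto
  define C0 where "C0 = ln (c + 1)"
  have IC: "?I ^ N \<le> ennreal (exp (real N * C0))" for N
  proof -
    have "c \<le> exp C0" using c(2) by (simp add: C0_def)
    then have "ennreal c ^ N \<le> ennreal (exp C0) ^ N" by (intro power_mono ennreal_leI) auto
    also have "\<dots> = ennreal (exp (real N * C0))" by (simp add: ennreal_power exp_of_nat_mult)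
    finally show ?thesis using c by simp
  qed
  define C1 where "C1 = \<beta> * e + 2 * e / \<delta> + C0"
  note ev1 = partition_function_eventually_large[OF \<eta>]
  have ev2: "eventually (\<lambda>N. N \<ge> max 2 (max n M)) sequentially" by (rule eventually_ge_at_top)
  have ev3: "eventually (\<lambda>N. real N > 2 / (\<beta> * \<delta>) + 1) sequentially"
    using filterlim_real_sequentially by (simp add: filterlim_at_top_dense)
  have ev4: "eventually (\<lambda>N. real N > C1 / (\<beta> * \<eta>)) sequentially"
    using filterlim_real_sequentially by (simp add: filterlim_at_top_dense)
  have "\<exists>\<^sub>F N in sequentially. sample_mean f N \<le> a \<and>
     (ereal (- (\<beta> * (\<gamma> + \<eta>))) < ennln (partition_function \<beta> (Q N) N) / ereal ((real N)\<^sup>2) \<and>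
      N \<ge> max 2 (max n M) \<and> real N > 2 / (\<beta> * \<delta>) + 1 \<and> real N > C1 / (\<beta> * \<eta>))"
    by (rule frequently_eventually_frequently[OF a]) (intro eventually_conj ev1 ev2 ev3 ev4)
  then obtain N where m: "sample_mean f N \<le> a"
    and Zl: "ereal (- (\<beta> * (\<gamma> + \<eta>))) < ennln (partition_function \<beta> (Q N) N) / ereal ((real N)\<^sup>2)"
    and N: "N \<ge> 2" "N \<ge> n" "N \<ge> M" and N3: "real N > 2 / (\<beta> * \<delta>) + 1" and N4: "real N > C1 / (\<beta> * \<eta>)"
    by (auto dest!: frequently_ex)
  let ?Z = "partition_function \<beta> (Q N) N"
  have N1: "N \<ge> 1" using N by simp
  have NS: "2 \<le> \<beta> * \<delta> * (real N - 1)" using N3 beta delta by (simp add: field_simps)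
  have [measurable]: "Q N \<in> borel_measurable borel"
    using lsc_Q[OF N1] by (rule measurable_lower_semicontinuous)
  have s: "(real N)\<^sup>2 > 0" using N by simp
  note Zlow = ennexp_le_of_ennln[OF Zl s]
  have Zfin: "?Z < \<infinity>" by (rule partition_function_finite[OF N(1) NS])
  have bd: "\<bar>f x\<bar> \<le> F" for x using f0 fF by (simp add: abs_of_nonneg)
  note J = gibbs_measure_jensen(3)[OF \<open>Q N \<in> borel_measurable borel\<close> Zlow(2) Zfin f bd, where c="\<beta> * t * real N"]
  let ?E = "\<integral>\<zeta>. statistic f N \<zeta> \<partial>gibbs_measure \<beta> (Q N) N"
  have red: "reduced B (Q M) z \<le> reduced B (Q N) z" for z
    unfolding reduced_def using mono_Q[OF M N(3)] by (intro e2ennreal_mono add_right_mono)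
  have low': "of_nat (N * (N - 1)) * ennreal e \<le> config_energy (\<lambda>z. reduced B (Q N) z + ennreal (t * f (Re z))) {..<N} z" for z
    by (rule order.trans[OF config_energy_lower_bound_mono[OF n N(2) low] config_energy_mono])
       (intro add_right_mono red)
  have "ennreal (exp (- (\<beta> * (\<gamma> + \<eta>) * (real N)\<^sup>2))) * ennreal (exp (- (\<beta> * t * real N * ?E))) \<le> ?Z * ennreal (exp (- (\<beta> * t * real N * ?E)))"
    by (intro mult_right_mono Zlow) simp
  also have "\<dots> \<le> (\<integral>\<^sup>+\<zeta>. boltzmann \<beta> (Q N) N \<zeta> * ennreal (exp (- (\<beta> * t * real N * statistic f N \<zeta>))) \<partial>area_power N)"
    by (rule J)
  also have "\<dots> \<le> ennreal (exp (\<beta> * ((real N)\<^sup>2 * B) - \<beta> * (real N)\<^sup>2 * e + real N * (\<beta> * e + 2 * e / \<delta>))) * ?I ^ N"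
    by (rule perturbed_partition_function_le[OF beta delta N(1) NS lsc_Q[OF N1] lower_Q[OF N1] f0 t e low'])
  also have "\<dots> \<le> ennreal (exp (\<beta> * ((real N)\<^sup>2 * B) - \<beta> * (real N)\<^sup>2 * e + real N * (\<beta> * e + 2 * e / \<delta>))) * ennreal (exp (real N * C0))"
    by (intro mult_left_mono IC) simp
  finally have "- (\<beta> * (\<gamma> + \<eta>) * (real N)\<^sup>2) + (- (\<beta> * t * real N * ?E))
      \<le> \<beta> * ((real N)\<^sup>2 * B) - \<beta> * (real N)\<^sup>2 * e + real N * (\<beta> * e + 2 * e / \<delta>) + real N * C0"
    by (simp add: ennreal_mult[symmetric] exp_add[symmetric])
  then have main: "\<beta> * (real N)\<^sup>2 * (e - \<gamma> - \<eta> - B) \<le> real N * C1 + \<beta> * t * real N * ?E"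
    by (simp add: C1_def algebra_simps)
  have "?E \<le> real N * a" using m N(1) by (simp add: sample_mean_def field_simps)
  then have "\<beta> * t * real N * ?E \<le> \<beta> * t * real N * (real N * a)"
    using beta t by (intro mult_left_mono) auto
  with main have "\<beta> * (real N)\<^sup>2 * (e - \<gamma> - \<eta> - B) \<le> real N * C1 + \<beta> * (real N)\<^sup>2 * (t * a)"
    by (simp add: power2_eq_square algebra_simps)
  moreover have "e - \<gamma> - \<eta> - B = \<eta> + t * a" by (simp add: \<eta>_def field_simps)
  ultimately have "real N * (\<beta> * real N * \<eta>) \<le> real N * C1"
    by (simp add: power2_eq_square algebra_simps)
  then have "\<beta> * real N * \<eta> \<le> C1" using N by simp
  then show False using N4 beta \<eta> by (simp add: field_simps)
qed


end

lemma sum_liminf_le: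
  fixes a :: "'i \<Rightarrow> nat \<Rightarrow> ennreal"
  shows "(\<Sum>i\<in>A. liminf (a i)) \<le> liminf (\<lambda>n. \<Sum>i\<in>A. a i n)"
proof (induction A rule: infinite_finite_induct)
  case (insert i A)
  have "(\<Sum>i\<in>insert i A. liminf (a i)) \<le> liminf (a i) + liminf (\<lambda>n. \<Sum>i\<in>A. a i n)"
    using insert by (simp add: add_left_mono)
  also have "\<dots> \<le> liminf (\<lambda>n. a i n + (\<Sum>i\<in>A. a i n))" by (rule liminf_add_le)
  finally show ?case using insert by simp
qed auto

lemma common_convergent_subsequence:
  fixes z :: "nat \<Rightarrow> nat \<Rightarrow> complex"
  assumes "\<And>j i. i < n \<Longrightarrow> cmod (z j i) \<le> R"
  shows "\<exists>r l. strict_mono (r :: nat \<Rightarrow> nat) \<and> (\<forall>i<n. (\<lambda>j. z (r j) i) \<longlonglongrightarrow> l i)"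
  using assms
proof (induction n)
  case 0
  show ?case by (intro exI[of _ id]) (auto simp: strict_mono_def)
next
  case (Suc n)
  then obtain r l where r: "strict_mono (r :: nat \<Rightarrow> nat)" "\<forall>i<n. (\<lambda>j. z (r j) i) \<longlonglongrightarrow> l i"
    by auto
  have "seq_compact (cball (0::complex) R)" using compact_cball by (simp add: compact_eq_seq_compact_metric)
  then obtain m s where s: "strict_mono (s :: nat \<Rightarrow> nat)" "((\<lambda>j. z (r j) n) \<circ> s) \<longlonglongrightarrow> m"
    using Suc.prems[of n] unfolding seq_compact_def by (metis lessI mem_cball_0)
  have "(\<lambda>j. z ((r \<circ> s) j) i) \<longlonglongrightarrow> (l(n := m)) i" if "i < Suc n" for i
  proof (cases "i = n")
    case False
    then have "((\<lambda>j. z (r j) i) \<circ> s) \<longlonglongrightarrow> l i"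
      using that r(2) s(1) by (intro LIMSEQ_subseq_LIMSEQ) auto
    then show ?thesis using False by (simp add: comp_def)
  qed (use s in \<open>simp add: comp_def\<close>)
  then show ?case using strict_mono_o[OF r(1) s(1)] by blast
qed

lemma config_energy_liminf:
  assumes q: "\<And>i. i < n \<Longrightarrow> q (l i) \<le> liminf (\<lambda>j. p j (z j i))" and z: "\<And>i. i < n \<Longrightarrow> (\<lambda>j. z j i) \<longlonglongrightarrow> l i"
  shows "config_energy q {..<n} l \<le> liminf (\<lambda>j. config_energy (p j) {..<n} (z j))"
proof -
  have "config_energy q {..<n} l \<le> (\<Sum>i<n. \<Sum>k\<in>{..<n} - {i}. liminf (\<lambda>j. log_pair (z j i) (z j k) + p j (z j i)))"
    unfolding config_energy_def
  proof (intro sum_mono)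
    fix i k assume ik: "i \<in> {..<n}" "k \<in> {..<n} - {i}"
    have "log_pair (l i) (l k) = liminf (\<lambda>j. log_pair (z j i) (z j k))"
      using ik by (intro lim_imp_Liminf[symmetric] log_pair_tendsto z) auto
    then have "log_pair (l i) (l k) + q (l i) \<le> liminf (\<lambda>j. log_pair (z j i) (z j k)) + liminf (\<lambda>j. p j (z j i))"
      using ik by (intro add_mono q) auto
    also have "\<dots> \<le> liminf (\<lambda>j. log_pair (z j i) (z j k) + p j (z j i))" by (rule liminf_add_le)
    finally show "log_pair (l i) (l k) + q (l i) \<le> liminf (\<lambda>j. log_pair (z j i) (z j k) + p j (z j i))" .
  qed
  also have "\<dots> \<le> (\<Sum>i<n. liminf (\<lambda>j. \<Sum>k\<in>{..<n} - {i}. log_pair (z j i) (z j k) + p j (z j i)))"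
    by (intro sum_mono sum_liminf_le)
  also have "\<dots> \<le> liminf (\<lambda>j. config_energy (p j) {..<n} (z j))"
    unfolding config_energy_def by (rule sum_liminf_le)
  finally show ?thesis .
qed

context external_sequence
begin

lemma lower_V: "ereal (2 * (1 + \<delta>) * growth z - B) \<le> V z"
  using lower_Q by (intro Lim_bounded2[OF lim_Q, of 1]) auto

lemma confining_Q: "N \<ge> 1 \<Longrightarrow> confining \<delta> (reduced B (Q N))"
  by (rule confining_reduced[OF delta lsc_Q lower_Q])

lemma confining_V: "confining \<delta> (reduced B V)"
  by (rule confining_reduced[OF delta lsc_V lower_V])

lemma reduced_off_line: "z \<notin> \<real> \<Longrightarrow> reduced B V z = \<infinity>"
  by (simp add: off_line reduced_def)

text \<open>A Dini argument: monotone convergence of lower semicontinuous functions.\<close>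

lemma reduced_V_le_liminf:
  assumes x: "x \<longlonglongrightarrow> z" and r: "strict_mono (r :: nat \<Rightarrow> nat)"
  shows "reduced B V z \<le> liminf (\<lambda>j. reduced B (Q (Suc (r j))) (x j))"
proof -
  have "reduced B (Q (Suc M)) z \<le> liminf (\<lambda>j. reduced B (Q (Suc (r j))) (x j))" for M
  proof -
    have "reduced B (Q (Suc M)) z \<le> liminf (\<lambda>j. reduced B (Q (Suc M)) (x j))"
      using lsc_reduced[OF lsc_Q, of "Suc M" B] x by (auto simp: lsc_def)
    also have "\<dots> \<le> liminf (\<lambda>j. reduced B (Q (Suc (r j))) (x j))"
    proof (rule Liminf_mono)
      show "eventually (\<lambda>j. reduced B (Q (Suc M)) (x j) \<le> reduced B (Q (Suc (r j))) (x j)) sequentially"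
        using eventually_ge_at_top[of M]
      proof eventually_elim
        case (elim j)
        have "M \<le> r j" using elim seq_suble[OF r] order.trans by blast
        then show ?case unfolding reduced_def by (intro e2ennreal_mono add_right_mono mono_Q) auto
      qed
    qed
    finally show ?thesis .
  qed
  moreover have "(\<lambda>M. reduced B (Q (Suc M)) z) \<longlonglongrightarrow> reduced B V z"
  proof -
    have "(\<lambda>M. Q (Suc M) z + ereal (B - 2 * growth z)) \<longlonglongrightarrow> V z + ereal (B - 2 * growth z)"
      using lower_V[of z] by (intro tendsto_add_ereal_nonneg LIMSEQ_Suc[OF lim_Q] tendsto_const) auto
    then show ?thesis unfolding reduced_def
      by (rule tendsto_compose[OF continuous_on_e2ennreal[of UNIV, unfolded continuous_on_def, rule_format, simplified]])
  qed
  ultimately show ?thesis by (intro LIMSEQ_le_const2) auto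
qed

text \<open>
  For a fixed number of points the passage from \<open>Q N\<close> to \<open>V\<close> takes place in a compact subset of
  \<open>\<complex>\<^sup>n\<close>: almost minimal configurations stay bounded because the potentials are uniformly confining,
  and the limit points lie on the line because \<open>V\<close> is infinite elsewhere.
\<close>

lemma perturbed_line_points:
  fixes f :: "real \<Rightarrow> real"
  assumes f: "continuous_on UNIV f" and f0: "\<And>x. 0 \<le> f x" and fF: "\<And>x. f x \<le> F" and t: "t \<ge> 0"
    and a: "\<exists>\<^sub>F N in sequentially. sample_mean f N \<le> a" and n: "n \<ge> 2"
  shows "0 \<le> \<gamma> + B + t * a"
    "\<exists>x :: nat \<Rightarrow> real. config_energy (\<lambda>z. reduced B V z + ennreal (t * f (Re z))) {..<n} (\<lambda>i. of_real (x i))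
      \<le> of_nat (n * (n - 1)) * ennreal (\<gamma> + B + t * a)"
proof -
  define A where "A = \<gamma> + B + t * a"
  have fm: "f \<in> borel_measurable borel" using f by (rule borel_measurable_continuous_onI)
  note bound = perturbed_config_energy_bound[OF fm f0 fF t a _ n, folded A_def]
  have A0: "0 \<le> A" by (rule bound[of 1]) auto
  then show "0 \<le> \<gamma> + B + t * a" by (simp add: A_def)
  let ?q = "\<lambda>W z. reduced B W z + ennreal (t * f (Re z))"
  let ?m = "of_nat (n * (n - 1)) :: ennreal"
  have m: "?m = ennreal (real (n * (n - 1)))" by (simp only: ennreal_of_nat_eq_real_of_nat)
  have "\<exists>z. config_energy (?q (Q (Suc M))) {..<n} z \<le> ?m * ennreal (A + 1 / real (Suc M))" for M
  proof (rule ccontr)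
    assume "\<not> ?thesis"
    then have "A + 1 / real (Suc M) \<le> A"
      using A0 by (intro bound[of "Suc M"]) (auto simp: not_le intro: less_imp_le)
    then show False by simp
  qed
  then obtain z where z: "\<And>M. config_energy (?q (Q (Suc M))) {..<n} (z M) \<le> ?m * ennreal (A + 1 / real (Suc M))"
    by metis
  define K where "K = real (n * (n - 1)) * (A + 1)"
  have K0: "K \<ge> 0" using A0 by (simp add: K_def)
  have zK: "config_energy (?q (Q (Suc M))) {..<n} (z M) \<le> ennreal K" for M
  proof -
    have "?m * ennreal (A + 1 / real (Suc M)) \<le> ?m * ennreal (A + 1)"
      by (intro mult_left_mono ennreal_leI) (auto simp: divide_le_eq)
    also have "\<dots> = ennreal K" using A0 unfolding m K_def by (simp add: ennreal_mult)
    finally show ?thesis using z[of M] order.trans by blast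
  qed
  have bd: "cmod (z M i) \<le> exp (K / (2 * \<delta>))" if i: "i < n" for M i
  proof -
    have "\<exists>k. k \<in> {..<n} - {i}" using n i by (cases "i = 0") (auto intro: exI[of _ 0] exI[of _ 1])
    then obtain k where k: "k \<in> {..<n} - {i}" by blast
    have "ennreal (2 * \<delta> * growth (z M i)) \<le> reduced B (Q (Suc M)) (z M i)"
      using confining_Q[of "Suc M"] by (auto simp: confining_def)
    also have "\<dots> \<le> log_pair (z M i) (z M k) + ?q (Q (Suc M)) (z M i)"
      by (simp add: add.assoc add_increasing add_increasing2)
    also have "\<dots> \<le> (\<Sum>k\<in>{..<n} - {i}. log_pair (z M i) (z M k) + ?q (Q (Suc M)) (z M i))"
      using k by (intro member_le_sum) auto
    also have "\<dots> \<le> config_energy (?q (Q (Suc M))) {..<n} (z M)"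
      unfolding config_energy_def using i
      by (intro member_le_sum[of i _ "\<lambda>i. \<Sum>k\<in>{..<n} - {i}. log_pair (z M i) (z M k) + ?q (Q (Suc M)) (z M i)"]) auto
    also have "\<dots> \<le> ennreal K" by (rule zK)
    finally have "2 * \<delta> * growth (z M i) \<le> K" using K0 by (simp add: ennreal_le_iff)
    then have "growth (z M i) \<le> K / (2 * \<delta>)" using delta by (simp add: field_simps)
    then have "exp (growth (z M i)) \<le> exp (K / (2 * \<delta>))" by simp
    moreover have "exp (growth (z M i)) = 1 + cmod (z M i)" by (simp add: growth_def add_pos_nonneg)
    ultimately show ?thesis by simp
  qed
  obtain r l where r: "strict_mono (r :: nat \<Rightarrow> nat)" and l: "\<And>i. i < n \<Longrightarrow> (\<lambda>j. z (r j) i) \<longlonglongrightarrow> l i"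
    using common_convergent_subsequence[of n z, OF bd] by blast
  have "config_energy (?q V) {..<n} l \<le> liminf (\<lambda>j. config_energy (?q (Q (Suc (r j)))) {..<n} (z (r j)))"
  proof (rule config_energy_liminf[OF _ l])
    fix i assume i: "i < n"
    have "(\<lambda>j. ennreal (t * f (Re (z (r j) i)))) \<longlonglongrightarrow> ennreal (t * f (Re (l i)))"
      by (intro tendsto_ennrealI tendsto_intros continuous_on_tendsto_compose[OF f] tendsto_Re l i) auto
    then have "ennreal (t * f (Re (l i))) = liminf (\<lambda>j. ennreal (t * f (Re (z (r j) i))))"
      by (intro lim_imp_Liminf[symmetric]) auto
    then have "?q V (l i) \<le> liminf (\<lambda>j. reduced B (Q (Suc (r j))) (z (r j) i)) + liminf (\<lambda>j. ennreal (t * f (Re (z (r j) i))))"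
      by (intro add_mono reduced_V_le_liminf[OF l[OF i] r]) auto
    also have "\<dots> \<le> liminf (\<lambda>j. ?q (Q (Suc (r j))) (z (r j) i))" by (rule liminf_add_le)
    finally show "?q V (l i) \<le> liminf (\<lambda>j. ?q (Q (Suc (r j))) (z (r j) i))" .
  qed
  also have "\<dots> \<le> liminf (\<lambda>j. ?m * ennreal (A + 1 / real (Suc (r j))))"
    by (intro Liminf_mono always_eventually allI z)
  also have "\<dots> = ?m * ennreal A"
  proof -
    have "(\<lambda>j. 1 / real (Suc j)) \<longlonglongrightarrow> 0"
      using LIMSEQ_inverse_real_of_nat by (simp add: inverse_eq_divide)
    then have "(\<lambda>j. 1 / real (Suc (r j))) \<longlonglongrightarrow> 0"
      using LIMSEQ_subseq_LIMSEQ[OF _ r, of "\<lambda>j. 1 / real (Suc j)"] by (simp add: comp_def)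
    then have "(\<lambda>j. ennreal (real (n * (n - 1)) * (A + 1 / real (Suc (r j))))) \<longlonglongrightarrow> ennreal (real (n * (n - 1)) * (A + 0))"
      by (intro tendsto_ennrealI tendsto_intros)
    then have "(\<lambda>j. ?m * ennreal (A + 1 / real (Suc (r j)))) \<longlonglongrightarrow> ?m * ennreal A"
      unfolding m using A0 by (simp add: ennreal_mult)
    then show ?thesis by (intro lim_imp_Liminf) auto
  qed
  finally have le: "config_energy (?q V) {..<n} l \<le> ?m * ennreal A" .
  have "l i \<in> \<real>" if i: "i < n" for i
  proof (rule ccontr)
    assume "l i \<notin> \<real>"
    then have inf: "reduced B V (l i) = \<infinity>" by (rule reduced_off_line)
    have "\<exists>k. k \<in> {..<n} - {i}" using n i by (cases "i = 0") (auto intro: exI[of _ 0] exI[of _ 1])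
    then obtain k where k: "k \<in> {..<n} - {i}" by blast
    have "\<infinity> \<le> (\<Sum>k\<in>{..<n} - {i}. log_pair (l i) (l k) + ?q V (l i))"
      using k inf by (intro order.trans[OF _ member_le_sum[of k]]) auto
    also have "\<dots> \<le> config_energy (?q V) {..<n} l"
      unfolding config_energy_def using i
      by (intro member_le_sum[of i _ "\<lambda>i. \<Sum>k\<in>{..<n} - {i}. log_pair (l i) (l k) + ?q V (l i)"]) auto
    also have "\<dots> \<le> ?m * ennreal A" by (rule le)
    finally show False by (simp add: top_unique ennreal_mult_eq_top_iff)
  qed
  then have eq: "config_energy (?q V) {..<n} (\<lambda>i. of_real (Re (l i))) = config_energy (?q V) {..<n} l"
    unfolding config_energy_def by (intro sum.cong refl) (simp add: of_real_Re)
  have "config_energy (?q V) {..<n} (\<lambda>i. of_real (Re (l i))) \<le> ?m * ennreal A"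
    unfolding eq by (rule le)
  then show "\<exists>x :: nat \<Rightarrow> real. config_energy (?q V) {..<n} (\<lambda>i. of_real (x i)) \<le> ?m * ennreal (\<gamma> + B + t * a)"
    unfolding A_def by (rule exI[of _ "\<lambda>i. Re (l i)"])
qed

end

section \<open>From configurations to measures on the line\<close>

definition empirical :: "nat \<Rightarrow> (nat \<Rightarrow> real) \<Rightarrow> real measure" where
  "empirical n x = distr (measure_pmf (pmf_of_set {..<n})) borel x"

lemma real_distribution_empirical: "real_distribution (empirical n x)"
  unfolding empirical_def by (rule prob_space.real_distribution_distr[OF measure_pmf.prob_space_axioms]) simp

lemma nn_integral_empirical:
  assumes "n > 0" and [measurable]: "g \<in> borel_measurable borel"
  shows "(\<integral>\<^sup>+y. g y \<partial>empirical n x) = (\<Sum>i<n. g (x i)) / of_nat n"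
proof -
  have "{..<n} \<noteq> {}" using assms by auto
  then show ?thesis
    unfolding empirical_def by (subst nn_integral_distr) (auto simp: nn_integral_pmf_of_set)
qed

lemma config_energy_sum_le:
  assumes n: "n \<ge> 2" and le: "config_energy q {..<n} z \<le> of_nat (n * (n - 1)) * ennreal A"
  shows "(\<Sum>i<n. q (z i)) \<le> of_nat n * ennreal A"
proof -
  have "of_nat (n - 1) * (\<Sum>i<n. q (z i)) = (\<Sum>i<n. \<Sum>j\<in>{..<n} - {i}. q (z i))"
    by (simp add: sum_distrib_left)
  also have "\<dots> \<le> config_energy q {..<n} z"
    unfolding config_energy_def by (intro sum_mono) auto
  also have "\<dots> \<le> of_nat (n - 1) * (of_nat n * ennreal A)"
    using le by (simp only: of_nat_mult mult_ac)
  finally show ?thesis using n by (subst (asm) ennreal_mult_le_mult_iff) auto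
qed

text \<open>
  On the diagonal the truncated kernel is at most \<open>L\<close>, and the diagonal carries only a fraction
  \<open>1 / n\<close> of the pairs.
\<close>

lemma empirical_energy_le:
  assumes n: "n \<ge> 2" and q[measurable]: "q \<in> borel_measurable borel"
    and le: "config_energy q {..<n} (\<lambda>i. of_real (x i)) \<le> of_nat (n * (n - 1)) * ennreal A"
  shows "(\<integral>\<^sup>+u. \<integral>\<^sup>+v. min (log_pair (of_real u) (of_real v)) L + q (of_real u) \<partial>empirical n x \<partial>empirical n x)
    \<le> ennreal A + L / of_nat n"
proof -
  let ?k = "\<lambda>u v. min (log_pair (complex_of_real u) (complex_of_real v)) L + q (complex_of_real u)"
  interpret real_distribution "empirical n x" by (rule real_distribution_empirical)
  have n0: "n > 0" using n by simp
  have n': "of_nat n \<noteq> (0::ennreal)" "of_nat n \<noteq> (\<top>::ennreal)" using n by auto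
  have mk: "(\<lambda>v. ?k u v) \<in> borel_measurable borel" for u by measurable
  have mi: "(\<lambda>u. \<integral>\<^sup>+v. ?k u v \<partial>empirical n x) \<in> borel_measurable borel" by measurable
  have row: "(\<Sum>j<n. ?k (x i) (x j)) \<le> (\<Sum>j\<in>{..<n} - {i}. log_pair (of_real (x i)) (of_real (x j)) + q (of_real (x i))) + (q (of_real (x i)) + L)"
    if "i < n" for i
  proof -
    have diag: "?k (x i) (x i) \<le> q (of_real (x i)) + L" by (simp add: min_def add.commute)
    have "(\<Sum>j<n. ?k (x i) (x j)) = ?k (x i) (x i) + (\<Sum>j\<in>{..<n} - {i}. ?k (x i) (x j))"
      using that by (intro sum.remove) auto
    also have "\<dots> \<le> (q (of_real (x i)) + L) + (\<Sum>j\<in>{..<n} - {i}. log_pair (of_real (x i)) (of_real (x j)) + q (of_real (x i)))"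
      by (rule add_mono[OF diag sum_mono]) (auto intro: add_right_mono)
    finally show ?thesis by (simp add: add.commute)
  qed
  have "(\<Sum>i<n. \<Sum>j<n. ?k (x i) (x j)) \<le> config_energy q {..<n} (\<lambda>i. of_real (x i)) + ((\<Sum>i<n. q (of_real (x i))) + of_nat n * L)"
    using sum_mono[of "{..<n}", OF row] by (simp add: sum.distrib config_energy_def)
  also have "\<dots> \<le> of_nat (n * (n - 1)) * ennreal A + (of_nat n * ennreal A + of_nat n * L)"
    using config_energy_sum_le[OF n le] le by (intro add_mono) auto
  also have "\<dots> = of_nat n * (of_nat n * ennreal A + L)"
  proof -
    have "(of_nat (n * (n - 1)) :: ennreal) + of_nat n = of_nat (n * n)"
      unfolding of_nat_add[symmetric] using n by (simp add: algebra_simps)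
    then show ?thesis by (simp add: distrib_left distrib_right[symmetric] add.assoc[symmetric] mult.assoc[symmetric])
  qed
  finally have sum: "(\<Sum>i<n. \<Sum>j<n. ?k (x i) (x j)) \<le> of_nat n * (of_nat n * ennreal A + L)" .
  have "(\<integral>\<^sup>+u. \<integral>\<^sup>+v. ?k u v \<partial>empirical n x \<partial>empirical n x) = (\<Sum>i<n. (\<Sum>j<n. ?k (x i) (x j)) / of_nat n) / of_nat n"
    by (subst nn_integral_empirical[OF n0 mi]) (simp add: nn_integral_empirical[OF n0 mk])
  also have "\<dots> = (\<Sum>i<n. \<Sum>j<n. ?k (x i) (x j)) / of_nat n / of_nat n"
    by (simp add: divide_ennreal_def sum_distrib_right)
  also have "\<dots> \<le> (of_nat n * (of_nat n * ennreal A + L)) / of_nat n / of_nat n"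
    by (intro divide_right_mono_ennreal sum)
  also have "\<dots> = ennreal A + L / of_nat n"
    using n' by (metis add_divide_distrib_ennreal ennreal_mult_divide_eq mult.commute)
  finally show ?thesis .
qed

context external_sequence
begin

text \<open>The measure is a limit, as the number of points grows, of the uniform measures on the points.\<close>

lemma perturbed_line_measure:
  fixes f :: "real \<Rightarrow> real"
  assumes f: "continuous_on UNIV f" and f0: "\<And>x. 0 \<le> f x" and fF: "\<And>x. f x \<le> F" and t: "t \<ge> 0"
    and a: "\<exists>\<^sub>F N in sequentially. sample_mean f N \<le> a"
  obtains \<mu> where "real_distribution \<mu>"
    "line_energy (\<lambda>z. reduced B V z + ennreal (t * f (Re z))) \<mu> \<le> ennreal (\<gamma> + B + t * a)"
proof -
  let ?q = "\<lambda>z. reduced B V z + ennreal (t * f (Re z))"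
  define A where "A = \<gamma> + B + t * a"
  have q: "confining \<delta> ?q"
    unfolding confining_def
  proof (intro conjI allI delta)
    show "lsc ?q"
      unfolding lsc_def
    proof (intro allI impI)
      fix z and x :: "nat \<Rightarrow> complex" assume x: "x \<longlonglongrightarrow> z"
      have "(\<lambda>j. ennreal (t * f (Re (x j)))) \<longlonglongrightarrow> ennreal (t * f (Re z))"
        by (intro tendsto_ennrealI tendsto_intros continuous_on_tendsto_compose[OF f] tendsto_Re x) auto
      then have "ennreal (t * f (Re z)) = liminf (\<lambda>j. ennreal (t * f (Re (x j))))"
        by (intro lim_imp_Liminf[symmetric]) auto
      then have "?q z \<le> liminf (\<lambda>j. reduced B V (x j)) + liminf (\<lambda>j. ennreal (t * f (Re (x j))))"
        using confining_V x by (intro add_mono) (auto simp: confining_def lsc_def)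
      also have "\<dots> \<le> liminf (\<lambda>j. ?q (x j))" by (rule liminf_add_le)
      finally show "?q z \<le> liminf (\<lambda>j. ?q (x j))" .
    qed
    show "ennreal (2 * \<delta> * growth z) \<le> ?q z" for z
      using confining_V unfolding confining_def by (meson add_increasing2 zero_le)
  qed
  then have qm[measurable]: "?q \<in> borel_measurable borel" by (rule confining_measurable)
  note pts = perturbed_line_points[OF f f0 fF t a, folded A_def]
  have A0: "A \<ge> 0" using pts(1)[of 2] by simp
  have "\<exists>x. config_energy ?q {..<n + 2} (\<lambda>i. of_real (x i)) \<le> of_nat ((n + 2) * (n + 2 - 1)) * ennreal A" for n
    by (rule pts(2)) simp
  then obtain x where x: "\<And>n. config_energy ?q {..<n + 2} (\<lambda>i. of_real (x n i)) \<le> of_nat ((n + 2) * (n + 2 - 1)) * ennreal A"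
    by metis
  define \<mu> where "\<mu> n = empirical (n + 2) (x n)" for n
  have \<mu>: "real_distribution (\<mu> n)" for n unfolding \<mu>_def by (rule real_distribution_empirical)
  \<comment> \<open>The truncation level tends to infinity, but more slowly than the number of points.\<close>
  define L where "L n = ennreal (sqrt (real (n + 2)))" for n
  have L: "L \<longlonglongrightarrow> \<infinity>"
  proof -
    have "filterlim (\<lambda>n. sqrt (real (n + 2))) at_top sequentially" by real_asymp
    then have "((\<lambda>n. ennreal (sqrt (real (n + 2)))) \<longlongrightarrow> \<top>) sequentially"
      by (rule ennreal_tendsto_top_eq_at_top[THEN iffD2])
    then show ?thesis by (simp add: L_def[abs_def])
  qed
  define e where "e n = ennreal A + L n / of_nat (n + 2)" for n
  have e: "e \<longlonglongrightarrow> ennreal A"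
  proof -
    have "e n = ennreal (A + sqrt (real (n + 2)) / real (n + 2))" for n
      unfolding e_def L_def using A0 divide_ennreal[of "sqrt (real (n + 2))" "real (n + 2)"]
      by (simp only: ennreal_of_nat_eq_real_of_nat) simp
    then have eq: "e = (\<lambda>n. ennreal (A + sqrt (real (n + 2)) / real (n + 2)))" by (rule ext)
    have "(\<lambda>n. A + sqrt (real (n + 2)) / real (n + 2)) \<longlonglongrightarrow> A" by real_asymp
    then show ?thesis unfolding eq by (rule tendsto_ennrealI)
  qed
  have le: "(\<integral>\<^sup>+u. \<integral>\<^sup>+v. min (log_pair (of_real u) (of_real v)) (L n) + ?q (of_real u) \<partial>\<mu> n \<partial>\<mu> n) \<le> e n" for n
    unfolding \<mu>_def e_def by (rule empirical_energy_le[OF _ qm x]) simp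
  have gr: "(\<integral>\<^sup>+u. ennreal (growth (of_real u)) \<partial>\<mu> n) \<le> ennreal (A / (2 * \<delta>))" for n
  proof -
    have "(\<integral>\<^sup>+u. ennreal (growth (of_real u)) \<partial>\<mu> n) = (\<Sum>i<n + 2. ennreal (growth (of_real (x n i)))) / of_nat (n + 2)"
      unfolding \<mu>_def by (rule nn_integral_empirical) auto
    also have "\<dots> \<le> (\<Sum>i<n + 2. ennreal (1 / (2 * \<delta>)) * ?q (of_real (x n i))) / of_nat (n + 2)"
    proof (intro divide_right_mono_ennreal sum_mono)
      fix i
      have "ennreal (1 / (2 * \<delta>)) * ennreal (2 * \<delta> * growth (of_real (x n i))) \<le> ennreal (1 / (2 * \<delta>)) * ?q (of_real (x n i))"
        using q unfolding confining_def by (intro mult_left_mono) (blast, simp)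
      then show "ennreal (growth (of_real (x n i))) \<le> ennreal (1 / (2 * \<delta>)) * ?q (of_real (x n i))"
        using delta growth_nonneg[of "of_real (x n i)"] by (simp add: ennreal_mult[symmetric])
    qed
    also have "\<dots> \<le> (ennreal (1 / (2 * \<delta>)) * (of_nat (n + 2) * ennreal A)) / of_nat (n + 2)"
      unfolding sum_distrib_left[symmetric]
      by (intro divide_right_mono_ennreal mult_left_mono config_energy_sum_le[OF _ x]) auto
    also have "\<dots> = ennreal (1 / (2 * \<delta>)) * ennreal A"
      by (metis ennreal_mult_divide_eq ennreal_of_nat_neq_top mult.assoc mult.commute of_nat_eq_0_iff add_2_eq_Suc' nat.distinct(2))
    also have "\<dots> = ennreal (A / (2 * \<delta>))" using A0 delta by (simp add: ennreal_mult[symmetric])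
    finally show ?thesis .
  qed
  obtain r M where "real_distribution M" "line_energy ?q M \<le> ennreal A"
    using energy_compactness[OF q \<mu> gr L e le] by blast
  then show ?thesis using that unfolding A_def by blast
qed

text \<open>
  By minimality of \<open>\<sigma>\<close> the measures for the potentials perturbed by \<open>t f\<close> have means of \<open>f\<close> at most
  \<open>a\<close>, and as \<open>t\<close> tends to 0 they approach \<open>\<sigma>\<close>, because their energies become minimal.
\<close>

lemma equilibrium_mean_le:
  fixes f :: "real \<Rightarrow> real"
  assumes \<sigma>: "real_distribution \<sigma>" and en: "line_energy (reduced B V) \<sigma> = ennreal (\<gamma> + B)" and \<gamma>0: "\<gamma> + B \<ge> 0"
    and min: "\<And>\<mu>. real_distribution \<mu> \<Longrightarrow> line_energy (reduced B V) \<sigma> \<le> line_energy (reduced B V) \<mu>"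
    and f: "continuous_on UNIV f" and f0: "\<And>x. 0 \<le> f x" and fF: "\<And>x. f x \<le> F"
    and a: "\<exists>\<^sub>F N in sequentially. sample_mean f N \<le> a"
  shows "(\<integral>x. f x \<partial>\<sigma>) \<le> a"
proof -
  let ?q = "reduced B V"
  have qm[measurable]: "?q \<in> borel_measurable borel" by (rule confining_measurable[OF confining_V])
  have fm[measurable]: "f \<in> borel_measurable borel" using f by (rule borel_measurable_continuous_onI)
  define t where "t n = 1 / real (Suc n)" for n
  have t: "t n > 0" "t n \<le> 1" for n by (auto simp: t_def)
  have "\<exists>\<mu>. real_distribution \<mu> \<and> line_energy (\<lambda>z. ?q z + ennreal (t n * f (Re z))) \<mu> \<le> ennreal (\<gamma> + B + t n * a)" for n
    using perturbed_line_measure[OF f f0 fF less_imp_le[OF t(1)] a] by metis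
  then obtain \<mu> where \<mu>: "\<And>n. real_distribution (\<mu> n)"
    "\<And>n. line_energy (\<lambda>z. ?q z + ennreal (t n * f (Re z))) (\<mu> n) \<le> ennreal (\<gamma> + B + t n * a)" by metis
  have a0: "0 \<le> \<gamma> + B + t n * a" for n
    by (rule perturbed_line_points(1)[OF f f0 fF less_imp_le[OF t(1)] a order_refl])
  have int: "integrable (\<mu> n) f" for n
  proof -
    interpret real_distribution "\<mu> n" by (rule \<mu>)
    show ?thesis using f0 fF by (intro integrable_const_bound[of _ F]) (auto simp: abs_of_nonneg)
  qed
  have split: "line_energy ?q (\<mu> n) + ennreal (t n * (\<integral>x. f x \<partial>\<mu> n)) \<le> ennreal (\<gamma> + B + t n * a)" for n
  proof -
    interpret real_distribution "\<mu> n" by (rule \<mu>)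
    have "(\<integral>\<^sup>+x. ?q (of_real x) + ennreal (t n * f x) \<partial>\<mu> n) = (\<integral>\<^sup>+x. ?q (of_real x) \<partial>\<mu> n) + (\<integral>\<^sup>+x. ennreal (t n * f x) \<partial>\<mu> n)"
      by (rule nn_integral_add) auto
    also have "(\<integral>\<^sup>+x. ennreal (t n * f x) \<partial>\<mu> n) = ennreal (\<integral>x. t n * f x \<partial>\<mu> n)"
      using int t(1)[of n] f0 by (intro nn_integral_eq_integral) (auto intro!: AE_I2)
    also have "(\<integral>x. t n * f x \<partial>\<mu> n) = t n * (\<integral>x. f x \<partial>\<mu> n)" by simp
    finally have e: "(\<integral>\<^sup>+x. ?q (of_real x) + ennreal (t n * f x) \<partial>\<mu> n) = (\<integral>\<^sup>+x. ?q (of_real x) \<partial>\<mu> n) + ennreal (t n * (\<integral>x. f x \<partial>\<mu> n))" .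
    have "line_energy (\<lambda>z. ?q z + ennreal (t n * f (Re z))) (\<mu> n) = line_energy ?q (\<mu> n) + ennreal (t n * (\<integral>x. f x \<partial>\<mu> n))"
      by (subst (1 2) line_energy_add[OF \<mu>(1)]) (simp_all add: e add.assoc)
    then show ?thesis using \<mu>(2)[of n] by simp
  qed
  have fn0: "(\<integral>x. f x \<partial>\<mu> n) \<ge> 0" for n using f0 by (intro integral_nonneg_AE) (auto intro!: AE_I2)
  have mean: "(\<integral>x. f x \<partial>\<mu> n) \<le> a" for n
  proof -
    have "ennreal (\<gamma> + B) + ennreal (t n * (\<integral>x. f x \<partial>\<mu> n)) \<le> ennreal (\<gamma> + B + t n * a)"
      using split[of n] min[OF \<mu>(1)[of n]] unfolding en by (meson add_right_mono order.trans)
    then have "\<gamma> + B + t n * (\<integral>x. f x \<partial>\<mu> n) \<le> \<gamma> + B + t n * a"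
      using \<gamma>0 fn0[of n] t(1)[of n] a0[of n] by (simp add: ennreal_plus[symmetric] del: ennreal_plus)
    then show ?thesis using t(1)[of n] by simp
  qed
  have le: "line_energy ?q (\<mu> n) \<le> ennreal (\<gamma> + B + t n * a)" for n
    using split[of n] by (meson add_increasing2 order.trans order_refl zero_le le_add_same_cancel1)
  have gr: "(\<integral>\<^sup>+x. ennreal (growth (of_real x)) \<partial>\<mu> n) \<le> ennreal ((\<gamma> + B + \<bar>a\<bar>) / (2 * \<delta>))" for n
  proof (rule growth_le_line_energy[OF confining_V \<mu>(1)])
    have "t n * a \<le> t n * \<bar>a\<bar>" using t(1)[of n] by simp
    also have "\<dots> \<le> 1 * \<bar>a\<bar>" using t(2) by (rule mult_right_mono) simp
    finally have "ennreal (\<gamma> + B + t n * a) \<le> ennreal (\<gamma> + B + \<bar>a\<bar>)" by (intro ennreal_leI) simp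
    with le[of n] show "line_energy ?q (\<mu> n) \<le> ennreal (\<gamma> + B + \<bar>a\<bar>)" by (rule order.trans)
  qed
  have e: "(\<lambda>n. ennreal (\<gamma> + B + t n * a)) \<longlonglongrightarrow> ennreal (\<gamma> + B + 0 * a)"
    unfolding t_def by (intro tendsto_ennrealI tendsto_intros LIMSEQ_inverse_real_of_nat[unfolded inverse_eq_divide])
  have le': "(\<integral>\<^sup>+x. \<integral>\<^sup>+y. min (log_pair (of_real x) (of_real y)) \<infinity> + ?q (of_real x) \<partial>\<mu> n \<partial>\<mu> n) \<le> ennreal (\<gamma> + B + t n * a)" for n
    using le[of n] by (simp add: line_energy_def min_def)
  obtain r M where r: "strict_mono (r :: nat \<Rightarrow> nat)" and M: "real_distribution M" and wc: "weak_conv_m (\<mu> \<circ> r) M"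
    and leM: "line_energy ?q M \<le> ennreal (\<gamma> + B + 0 * a)"
    using energy_compactness[OF confining_V \<mu>(1) gr tendsto_const e le'] by blast
  have "\<sigma> = M"
    by (rule line_minimizer_unique[OF confining_V \<sigma> _ min M]) (use en leM in auto)
  have "(\<lambda>n. \<integral>x. f x \<partial>(\<mu> \<circ> r) n) \<longlonglongrightarrow> (\<integral>x. f x \<partial>M)"
    using f f0 fF \<mu>(1)
    by (intro weak_conv_imp_integral_bdd_continuous_conv[OF _ M wc, of f F])
       (auto simp: continuous_on_eq_continuous_at abs_of_nonneg)
  then have "(\<integral>x. f x \<partial>M) \<le> a" by (rule LIMSEQ_le_const2) (use mean in auto)
  then show ?thesis using \<open>\<sigma> = M\<close> by simp
qed

text \<open>
  The one-sided bound, applied to \<open>F + f\<close> and to \<open>F - f\<close>, both of which are nonnegative.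
\<close>

lemma sample_mean_tendsto:
  fixes f :: "real \<Rightarrow> real"
  assumes \<sigma>: "real_distribution \<sigma>" and en: "line_energy (reduced B V) \<sigma> = ennreal (\<gamma> + B)" and \<gamma>0: "\<gamma> + B \<ge> 0"
    and min: "\<And>\<mu>. real_distribution \<mu> \<Longrightarrow> line_energy (reduced B V) \<sigma> \<le> line_energy (reduced B V) \<mu>"
    and f: "continuous_on UNIV f" and bd: "\<And>x. \<bar>f x\<bar> \<le> F"
  shows "sample_mean f \<longlonglongrightarrow> (\<integral>x. f x \<partial>\<sigma>)"
proof -
  interpret S: real_distribution \<sigma> by (rule \<sigma>)
  have low: "eventually (\<lambda>N. (\<integral>x. g x \<partial>\<sigma>) - \<epsilon> < sample_mean g N) sequentially"
    if g: "continuous_on UNIV g" and g0: "\<And>x. 0 \<le> g x" and gF: "\<And>x. g x \<le> 2 * F" and "\<epsilon> > 0" for g and \<epsilon> :: real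
  proof (rule ccontr)
    assume "\<not> ?thesis"
    then have "\<exists>\<^sub>F N in sequentially. sample_mean g N \<le> (\<integral>x. g x \<partial>\<sigma>) - \<epsilon>"
      by (simp add: not_eventually not_less)
    from equilibrium_mean_le[OF \<sigma> en \<gamma>0 min g g0 gF this] show False using \<open>\<epsilon> > 0\<close> by simp
  qed
  have fm[measurable]: "f \<in> borel_measurable borel" using f by (rule borel_measurable_continuous_onI)
  have intf: "integrable \<sigma> f" using bd by (intro S.integrable_const_bound[of _ F]) auto
  have bd': "- F \<le> f x" "f x \<le> F" for x using bd[of x] by auto
  have affine: "eventually (\<lambda>N. sample_mean (\<lambda>x. F + c * f x) N = F + c * sample_mean f N) sequentially" for c
    using eventually_proper eventually_ge_at_top[of 1]
  proof eventually_elim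
    case (elim N)
    have Qm: "Q N \<in> borel_measurable borel"
      using lsc_Q[OF elim(2)] by (rule measurable_lower_semicontinuous)
    interpret P: prob_space "gibbs_measure \<beta> (Q N) N"
      using gibbs_measure_jensen(1)[OF Qm _ _ fm bd] elim(1) by blast
    have comp: "(\<lambda>\<zeta>. \<zeta> j) \<in> measurable (gibbs_measure \<beta> (Q N) N) borel" if "j < N" for j
      using measurable_coordinate[OF that] by (simp cong: measurable_cong_sets add: gibbs_measure_def)
    have int: "integrable (gibbs_measure \<beta> (Q N) N) (\<lambda>\<zeta>. f (Re (\<zeta> j)))" if "j < N" for j
      using measurable_compose[OF comp[OF that], of "\<lambda>z. f (Re z)" borel] bd
      by (intro P.integrable_const_bound[of _ F]) auto
    have "(\<integral>\<zeta>. (\<Sum>j<N. F + c * f (Re (\<zeta> j))) \<partial>gibbs_measure \<beta> (Q N) N)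
        = (\<integral>\<zeta>. real N * F + c * statistic f N \<zeta> \<partial>gibbs_measure \<beta> (Q N) N)"
      by (simp add: sum.distrib sum_distrib_left)
    also have "\<dots> = real N * F + c * (\<integral>\<zeta>. statistic f N \<zeta> \<partial>gibbs_measure \<beta> (Q N) N)"
      using int by (subst Bochner_Integration.integral_add) (auto simp: P.prob_space)
    finally show ?case using elim(2) by (simp add: sample_mean_def field_simps)
  qed
  have mean: "(\<integral>x. F + c * f x \<partial>\<sigma>) = F + c * (\<integral>x. f x \<partial>\<sigma>)" for c
    using intf S.prob_space by simp
  have nn: "0 \<le> F + 1 * f x" "F + 1 * f x \<le> 2 * F" "0 \<le> F + (-1) * f x" "F + (-1) * f x \<le> 2 * F" for x
    using bd'[of x] by auto
  show ?thesis
  proof (rule order_tendstoI)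
    fix y assume y: "y < (\<integral>x. f x \<partial>\<sigma>)"
    have "eventually (\<lambda>N. (\<integral>x. F + 1 * f x \<partial>\<sigma>) - ((\<integral>x. f x \<partial>\<sigma>) - y) < sample_mean (\<lambda>x. F + 1 * f x) N) sequentially"
      using y by (intro low continuous_intros f nn) simp
    then show "eventually (\<lambda>N. y < sample_mean f N) sequentially"
      using affine[of 1] unfolding mean by eventually_elim simp
  next
    fix y assume y: "(\<integral>x. f x \<partial>\<sigma>) < y"
    have "eventually (\<lambda>N. (\<integral>x. F + (-1) * f x \<partial>\<sigma>) - (y - (\<integral>x. f x \<partial>\<sigma>)) < sample_mean (\<lambda>x. F + (-1) * f x) N) sequentially"
      using y by (intro low continuous_intros f nn) simp
    then show "eventually (\<lambda>N. sample_mean f N < y) sequentially"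
      using affine[of "-1"] unfolding mean by eventually_elim simp
  qed
qed

end

section \<open>Convergence of the cross-sections\<close>

theorem theorem2p2:
  fixes \<beta> k :: real
    and Q :: "nat \<Rightarrow> complex \<Rightarrow> ereal"
    and V :: "complex \<Rightarrow> ereal"
  assumes "\<beta> > 0" and "k > 1"
    and "admissible \<beta> k Q V"
    and "\<exists>U. open U \<and> {x. complex_of_real x \<in> droplet V} \<subseteq> U \<and>
             continuous_on U (\<lambda>x. V (complex_of_real x))"
  shows "\<forall>f :: real \<Rightarrow> real. continuous_on UNIV f \<and> bounded (range f) \<longrightarrow>
           (\<lambda>N. (1 / pi) * (\<integral>\<xi>. f \<xi> * cross_section \<beta> (Q N) N \<xi> \<partial>lebesgue))
             \<longlonglongrightarrow> (\<integral>\<xi>. f \<xi> \<partial>(distr (equilibrium_measure V) borel Re))"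
proof (intro allI impI)
  fix f :: "real \<Rightarrow> real" assume f: "continuous_on UNIV f \<and> bounded (range f)"
  then obtain F where F: "\<And>x. \<bar>f x\<bar> \<le> F" by (auto simp: bounded_iff)
  have fm[measurable]: "f \<in> borel_measurable borel" using f by (auto intro: borel_measurable_continuous_onI)
  have il: "increasing_limit k Q V" and Z: "liminf (\<lambda>N. ennln (partition_function \<beta> (Q N) N) / ereal ((real N)\<^sup>2))
       \<ge> - (ereal \<beta> * robin_constant V)"
    using assms(3) by (auto simp: admissible_def standing_conditions_def)
  have V: "external_potential k V" and QN: "\<And>N. N \<ge> 1 \<Longrightarrow> external_potential k (Q N)"
    and inc: "\<And>N z. N \<ge> 1 \<Longrightarrow> Q N z \<le> Q (Suc N) z" and lim: "\<And>z. (\<lambda>N. Q N z) \<longlonglongrightarrow> V z"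
    and off: "\<And>z. z \<notin> \<real> \<Longrightarrow> V z = \<infinity>"
    using il by (auto simp: increasing_limit_def)
  have mono: "Q M z \<le> Q N z" if "1 \<le> M" "M \<le> N" for M N z
    using that(2)
  proof (induction N rule: dec_induct)
    case (step n)
    then show ?case using inc[of n z] that(1) by (meson order.trans)
  qed simp
  obtain \<delta> B where \<delta>: "\<delta> > 0" and Q1: "\<And>z. ereal (2 * (1 + \<delta>) * growth z - B) \<le> Q 1 z"
    using external_potential_growth[OF QN[of 1] \<open>k > 1\<close>] by auto
  have lowQ: "ereal (2 * (1 + \<delta>) * growth z - B) \<le> Q N z" if "N \<ge> 1" for N z
    using Q1 mono[OF order_refl that] order.trans by blast
  have lowV: "ereal (2 * (1 + \<delta>) * growth z - B) \<le> V z" for z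
    using lowQ by (intro Lim_bounded2[OF lim, of 1]) auto
  obtain \<sigma> where \<sigma>: "real_distribution \<sigma>" "line_energy (reduced B V) \<sigma> < \<infinity>"
    "\<And>\<mu>. real_distribution \<mu> \<Longrightarrow> line_energy (reduced B V) \<sigma> \<le> line_energy (reduced B V) \<mu>"
    "equilibrium_measure V = distr \<sigma> borel complex_of_real"
    "robin_constant V = enn2ereal (line_energy (reduced B V) \<sigma>) - ereal B"
    using equilibrium_measure_on_line[OF V off \<delta> lowV] by blast
  obtain c where c: "line_energy (reduced B V) \<sigma> = ennreal c" "c \<ge> 0"
    using \<sigma>(2) by (cases "line_energy (reduced B V) \<sigma>") auto
  define \<gamma> where "\<gamma> = c - B"
  have \<gamma>: "robin_constant V = ereal \<gamma>" using \<sigma>(5) c by (simp add: \<gamma>_def enn2ereal_ennreal)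
  interpret external_sequence \<beta> \<delta> B \<gamma> Q V
  proof
    show "- (ereal \<beta> * ereal \<gamma>) \<le> liminf (\<lambda>N. ennln (partition_function \<beta> (Q N) N) / ereal ((real N)\<^sup>2))"
      using Z unfolding \<gamma> .
  qed (use assms(1) \<delta> QN V lowQ mono lim off in \<open>auto simp: external_potential_def\<close>)
  have tend: "sample_mean f \<longlonglongrightarrow> (\<integral>x. f x \<partial>\<sigma>)"
    using f by (intro sample_mean_tendsto[OF \<sigma>(1) _ _ \<sigma>(3) _ F]) (auto simp: c \<gamma>_def)
  have "eventually (\<lambda>N. sample_mean f N = (1 / pi) * (\<integral>\<xi>. f \<xi> * cross_section \<beta> (Q N) N \<xi> \<partial>lebesgue)) sequentially"
    using eventually_proper eventually_ge_at_top[of 1]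
  proof eventually_elim
    case (elim N)
    have Qm: "Q N \<in> borel_measurable borel"
      using lsc_Q[OF elim(2)] by (rule measurable_lower_semicontinuous)
    show ?case
      unfolding sample_mean_def using elim(1) gibbs_measure_jensen(1,2)[OF Qm _ _ fm F]
      by (intro cross_section_expectation[OF _ _ fm F, symmetric]) auto
  qed
  from Lim_transform_eventually[OF tend this]
  have "(\<lambda>N. (1 / pi) * (\<integral>\<xi>. f \<xi> * cross_section \<beta> (Q N) N \<xi> \<partial>lebesgue)) \<longlonglongrightarrow> (\<integral>x. f x \<partial>\<sigma>)" .
  moreover have "(\<integral>\<xi>. f \<xi> \<partial>(distr (equilibrium_measure V) borel Re)) = (\<integral>x. f x \<partial>\<sigma>)"
  proof -
    interpret S: real_distribution \<sigma> by (rule \<sigma>(1))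
    show ?thesis unfolding \<sigma>(4) by (simp add: integral_distr distr_distr comp_def)
  qed
  ultimately show "(\<lambda>N. (1 / pi) * (\<integral>\<xi>. f \<xi> * cross_section \<beta> (Q N) N \<xi> \<partial>lebesgue))
             \<longlonglongrightarrow> (\<integral>\<xi>. f \<xi> \<partial>(distr (equilibrium_measure V) borel Re))" by simp
qed

end
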